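(* Let $n\ge2$ and $q\in(0,n)$. There exists a non-negative convex solution $v$ of $$\det D^2v=v^{q}\chi_{\{v>0\}}\quad\text{in }B_1(0)\subset\mathbb{R}^n$$ (in the Aleksandrov sense) such that, writing $x'=(x_1,\dots,x_{n-1})$, the coincidence set is $$K=\{|x'|\le 1/2\}\cap B_1(0),$$ the non-strictly convex part of the free boundary is the $(n-1)$-dimensional cylindrical hypersurface $$\Gamma_{nsc}=\{|x'|=1/2\}\cap B_1(0),$$ and $v$ is merely Lipschitz continuous (locally Lipschitz but not $C^1$) and does not belong to $W^{2,1}$ in any neighborhood of $K$.
   Context: $B_1(0)$ is the open unit ball of $\mathbb{R}^n$; $\chi_A$ is the characteristic function of $A$. The equation is understood in the Aleksandrov sense: the Monge-Ampère measure $A\mapsto|\partial v(A)|$ of the convex function $v$ equals $v^q\chi_{\{v>0\}}\,dx$. With $\Omega=B_1(0)$: $K:=\{x\in\Omega: v(x)=0\}$ is the (convex) coincidence set; $\Gamma:=\Omega\cap\partial K$ is the free boundary; $\Gamma_{sc}:=\{x\in\Omega: x\text{ is an exposed point of }K\}$, where $x\in K$ is an exposed point of $K$ if some supporting hyperplane of $K$ meets $K$ exactly at $x$; and $\Gamma_{nsc}:=\Gamma\setminus\Gamma_{sc}$. Neighborhoods of $K$ are taken within $B_1(0)$. *)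

theory Defs
  imports "HOL-Analysis.Analysis"
begin

text \<open>Functions on a domain \<open>\<Omega>\<close> are total functions of which only the values on \<open>\<Omega>\<close> matter.\<close>

definition subdiff :: "'a::euclidean_space set \<Rightarrow> ('a \<Rightarrow> real) \<Rightarrow> 'a \<Rightarrow> 'a set" where
  "subdiff \<Omega> v x = {p. \<forall>y\<in>\<Omega>. v y \<ge> v x + p \<bullet> (y - x)}"

text \<open>
  \<open>det D\<^sup>2v = f\<close> in \<open>\<Omega>\<close>: the Monge--Ampere measure \<open>A \<mapsto> |\<partial>v(A)|\<close> has density \<open>f\<close>.
  Measurability of \<open>\<partial>v(A)\<close> is automatic for convex \<open>v\<close> and Borel \<open>A\<close>; it is spelled out because
  \<^const>\<open>emeasure\<close> returns 0 on non-measurable sets.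
\<close>
definition aleksandrov_solution ::
    "'a::euclidean_space set \<Rightarrow> ('a \<Rightarrow> real) \<Rightarrow> ('a \<Rightarrow> real) \<Rightarrow> bool" where
  "aleksandrov_solution \<Omega> f v \<longleftrightarrow>
     convex_on \<Omega> v \<and>
     (\<forall>A\<in>sets borel. A \<subseteq> \<Omega> \<longrightarrow>
        (\<Union>x\<in>A. subdiff \<Omega> v x) \<in> sets lebesgue \<and>
        emeasure lebesgue (\<Union>x\<in>A. subdiff \<Omega> v x) = (\<integral>\<^sup>+x\<in>A. ennreal (f x) \<partial>lebesgue))"

definition coincidence_set :: "'a set \<Rightarrow> ('a \<Rightarrow> real) \<Rightarrow> 'a set" where
  "coincidence_set \<Omega> v = {x\<in>\<Omega>. v x = 0}"

definition free_boundary :: "'a::euclidean_space set \<Rightarrow> ('a \<Rightarrow> real) \<Rightarrow> 'a set" where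
  "free_boundary \<Omega> v = \<Omega> \<inter> frontier (coincidence_set \<Omega> v)"

text \<open>
  \<^const>\<open>exposed_face_of\<close> also admits the degenerate hyperplane with normal 0. For a singleton face
  \<open>{x}\<close> this matters only if the whole set is \<open>{x}\<close>, and then every hyperplane through \<open>x\<close>
  supports it.
\<close>
definition free_boundary_sc :: "'a::euclidean_space set \<Rightarrow> ('a \<Rightarrow> real) \<Rightarrow> 'a set" where
  "free_boundary_sc \<Omega> v = {x\<in>\<Omega>. {x} exposed_face_of coincidence_set \<Omega> v}"

definition free_boundary_nsc :: "'a::euclidean_space set \<Rightarrow> ('a \<Rightarrow> real) \<Rightarrow> 'a set" where
  "free_boundary_nsc \<Omega> v = free_boundary \<Omega> v - free_boundary_sc \<Omega> v"

definition locally_lipschitz_on :: "'a::euclidean_space set \<Rightarrow> ('a \<Rightarrow> real) \<Rightarrow> bool" where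
  "locally_lipschitz_on \<Omega> v \<longleftrightarrow> (\<forall>x\<in>\<Omega>. \<exists>r>0. \<exists>L. L-lipschitz_on (ball x r \<inter> \<Omega>) v)"

definition C1_on :: "'a::euclidean_space set \<Rightarrow> ('a \<Rightarrow> real) \<Rightarrow> bool" where
  "C1_on \<Omega> v \<longleftrightarrow> (\<exists>g. (\<forall>x\<in>\<Omega>. GDERIV v x :> g x) \<and> continuous_on \<Omega> g)"

text \<open>Multi-indices are encoded as lists \<open>bs\<close> of basis vectors, of order \<open>length bs\<close>.\<close>

primrec partial_deriv :: "'a::euclidean_space list \<Rightarrow> ('a \<Rightarrow> real) \<Rightarrow> 'a \<Rightarrow> real" where
  "partial_deriv [] f = f"
| "partial_deriv (b # bs) f = (\<lambda>x. frechet_derivative (partial_deriv bs f) (at x) b)"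

text \<open>The space of smooth functions with compact support in \<open>U\<close>, extended by 0.\<close>

definition test_functions :: "'a::euclidean_space set \<Rightarrow> ('a \<Rightarrow> real) set" where
  "test_functions U = {\<phi>.
     (\<forall>bs\<in>lists Basis. \<forall>x. partial_deriv bs \<phi> differentiable (at x)) \<and>
     compact (closure {x. \<phi> x \<noteq> 0}) \<and> closure {x. \<phi> x \<noteq> 0} \<subseteq> U}"

definition weak_deriv ::
    "'a::euclidean_space set \<Rightarrow> 'a list \<Rightarrow> ('a \<Rightarrow> real) \<Rightarrow> ('a \<Rightarrow> real) \<Rightarrow> bool" where
  "weak_deriv U bs f g \<longleftrightarrow>
     (\<forall>C. compact C \<and> C \<subseteq> U \<longrightarrow> f absolutely_integrable_on C \<and> g absolutely_integrable_on C) \<and>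
     (\<forall>\<phi>\<in>test_functions U.
        (LINT x:U|lebesgue. f x * partial_deriv bs \<phi> x) =
        (-1) ^ length bs * (LINT x:U|lebesgue. g x * \<phi> x))"

text \<open>\<open>sobolev_W1 k U\<close> is the space \<open>W\<^bsup>k,1\<^esup>(U)\<close>; the empty list accounts for \<open>f\<close> itself.\<close>

definition sobolev_W1 :: "nat \<Rightarrow> 'a::euclidean_space set \<Rightarrow> ('a \<Rightarrow> real) set" where
  "sobolev_W1 k U = {f. f absolutely_integrable_on U \<and>
     (\<forall>bs\<in>lists Basis. length bs \<le> k \<longrightarrow>
        (\<exists>g. g absolutely_integrable_on U \<and> weak_deriv U bs f g))}"

text \<open>
  The coordinate with index \<open>k\<close> plays the role of \<open>x\<^sub>n\<close>. The vector \<open>x'\<close> of the remaining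
  coordinates is represented in \<open>\<real>\<^sup>n\<close> with \<open>k\<close>-th coordinate 0, which does not change its norm.
\<close>
definition drop_coord :: "'n \<Rightarrow> real ^ 'n \<Rightarrow> real ^ 'n" where
  "drop_coord k x = (\<chi> i. if i = k then 0 else x $ i)"

end

theory Submission
  imports Defs "HOL-Complex_Analysis.Complex_Analysis"
begin

text \<open>
  Look for \<open>v(x) = V(\<bar>x'\<bar> - 1/2, x\<^sub>n)\<close> outside the cylinder and \<open>v = 0\<close> in it. With \<open>r = 1/2 + s\<close> the
  equation becomes \<open>(V\<^sub>s/r)\<^sup>n\<^sup>-\<^sup>2 (V\<^sub>s\<^sub>s V\<^sub>t\<^sub>t - V\<^sub>s\<^sub>t\<^sup>2) = V\<^sup>q\<close>. A gradient jump along the cylinder must not depend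
  on \<open>t\<close>, which suggests \<open>V = s + s\<^sup>a W(ln s, t)\<close> with \<open>a = 1 + q/2\<close>: all powers of \<open>s\<close> then balance and
  \<open>W\<close> solves an analytic Cauchy problem in \<open>t\<close> whose coefficients are entire and bounded in the
  half-plane of \<open>ln s\<close>. It is solved by a power series in \<open>t\<close> (Cauchy--Kovalevskaya with Nagumo
  norms), uniformly for \<open>0 < s < 1/2\<close> but only for small \<open>t\<close>; since \<open>q < n\<close>, the scaling
  \<open>V(s, t) \<mapsto> \<mu> V(s, \<lambda>t)\<close> stretches it to \<open>\<bar>t\<bar> < 1\<close>.

  The function \<open>v\<close> has supporting planes everywhere, its gradient is injective off the cylinder with
  Jacobian \<open>v\<^sup>q\<close>, and subgradients on the cylinder lie in a hyperplane, which gives the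
  Monge--Ampere measure. If \<open>v\<close> were in \<open>W\<^sup>2\<^sup>,\<^sup>1\<close>, its second derivative across the cylinder would be an
  integrable function, but the second differences of \<open>v\<close> keep a fixed mass on arbitrarily thin
  neighbourhoods of the interface.
\<close>

section \<open>Power series with Nagumo bounds\<close>

text \<open>A jump \<open>p(t)\<close> of the slope that varies with \<open>t\<close> would make the
  determinant start with \<open>s V_ss p'' - p'^2\<close>; positivity would force
  \<open>V_ss\<close> to grow like \<open>1/s\<close>, against a bounded \<open>V_s\<close>. Once
  the slope is constant, \<open>V_ss\<close> and \<open>V_tt\<close> scale like
  \<open>s^(a-2)\<close> and \<open>s^a\<close>, while \<open>V^q\<close> scales like
  \<open>s^q\<close>; hence \<open>2a - 2 = q\<close>.

  The obstacle is that the equation degenerates at \<open>s = 0\<close> and contains the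
  non-analytic power \<open>s^(q/2)\<close>. In \<open>z = ln s\<close> the operator
  \<open>s d/ds\<close> becomes \<open>d/dz\<close> and the power becomes
  \<open>exp (q z / 2)\<close>, but the interface moves to infinity, so every estimate has to be
  uniform on an unbounded half-plane.

  The data at \<open>t = 0\<close> are \<open>W = c\<close>, \<open>W_t = 0\<close> with a constant
  \<open>c > 0\<close>. The factor of \<open>W_tt\<close> in the equation is then
  \<open>a (a - 1) c\<close>: it is nonzero, which makes the line \<open>t = 0\<close>
  noncharacteristic, and positive, which gives \<open>V_ss > 0\<close> for small \<open>t\<close>
  and, with the positive determinant, strict convexity. The final scaling requires
  \<open>\<mu>^n \<lambda>^2 = \<mu>^q\<close>, which can be solved for \<open>\<mu>\<close> because
  \<open>q < n\<close>.\<close>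

definition lhp :: "complex set" where
  "lhp = {z. Re z < 0}"

definition bdist :: "complex \<Rightarrow> real" where
  "bdist z = min 1 (- Re z)"

lemma open_lhp: "open lhp"
  unfolding lhp_def by (simp add: open_halfspace_Re_lt)

lemma bdist_pos: "z \<in> lhp \<Longrightarrow> 0 < bdist z"
  by (simp add: lhp_def bdist_def)

lemma bdist_le_1: "bdist z \<le> 1"
  by (simp add: bdist_def)

lemma bdist_near:
  assumes "norm (z - w) \<le> r"
  shows "bdist w \<ge> bdist z - r"
proof -
  have "Re (w - z) \<le> r"
    using complex_Re_le_cmod[of "w - z"] assms by (simp add: norm_minus_commute)
  then show ?thesis using assms norm_ge_zero[of "z - w"] unfolding bdist_def min_def
    by (auto simp del: norm_ge_zero)
qed

text \<open>Cauchy's estimate on a circle of radius \<open>d / (k + 2)\<close>: the weight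
  \<open>bdist ^ k\<close> changes by at most the factor
  \<open>(1 + 1 / (k + 1)) ^ k \<le> 3\<close> there, whereas a fixed fraction of \<open>d\<close>
  would cost a factor exponential in \<open>k\<close>. The remaining
  \<open>k + 2 \<le> 2 (k + 1)\<close> completes the constant 6.\<close>

lemma nagumo_deriv_bound:
  assumes hol: "f holomorphic_on lhp"
    and bd: "\<And>z. z \<in> lhp \<Longrightarrow> norm (f z) * bdist z ^ k \<le> B"
    and z: "z \<in> lhp"
  shows "norm (deriv f z) * bdist z ^ Suc k \<le> 6 * real (Suc k) * B"
proof -
  define d where "d = bdist z"
  define r where "r = d / real (k + 2)"
  have d: "0 < d" using bdist_pos[OF z] by (simp add: d_def)
  then have r: "0 < r" by (simp add: r_def)
  have dr: "d - r = d * (real (k + 1) / real (k + 2))"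
    by (simp add: r_def field_simps)
  have drpos: "0 < d - r"
    unfolding dr using d by simp
  have near: "w \<in> lhp \<and> d - r \<le> bdist w" if "norm (z - w) \<le> r" for w
  proof -
    have "d - r \<le> bdist w" using bdist_near[OF that] by (simp add: d_def)
    moreover have "w \<in> lhp" using calculation drpos by (auto simp: lhp_def bdist_def)
    ultimately show ?thesis by simp
  qed
  have sub: "cball z r \<subseteq> lhp" using near by (auto simp: dist_norm)
  have B0: "0 \<le> B"
    using bd[OF z] bdist_pos[OF z] by (meson mult_nonneg_nonneg norm_ge_zero zero_le_power less_imp_le order_trans)
  have ineq: "norm (f w) \<le> B / (d - r) ^ k" if "norm (z - w) = r" for w
  proof -
    have w: "w \<in> lhp" "d - r \<le> bdist w" using near[of w] that by auto
    have "norm (f w) * (d - r) ^ k \<le> norm (f w) * bdist w ^ k"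
      using w drpos by (intro mult_left_mono power_mono) auto
    also have "\<dots> \<le> B" using bd[OF w(1)] .
    finally show ?thesis using drpos by (simp add: field_simps)
  qed
  have "norm ((deriv ^^ 1) f z) \<le> fact 1 * (B / (d - r) ^ k) / r ^ 1"
  proof (rule Cauchy_inequality)
    show "f holomorphic_on ball z r"
      using hol holomorphic_on_subset sub ball_subset_cball by blast
    show "continuous_on (cball z r) f"
      using hol holomorphic_on_imp_continuous_on continuous_on_subset sub by blast
  qed (use r ineq in auto)
  then have "norm (deriv f z) \<le> B / (d - r) ^ k / r" by simp
  then have "norm (deriv f z) * d ^ Suc k \<le> B / (d - r) ^ k / r * d ^ Suc k"
    using d by (intro mult_right_mono) auto
  also have "\<dots> = B * real (k + 2) * (d / (d - r)) ^ k"
    using d drpos unfolding power_divide by (simp add: r_def)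
  also have "d / (d - r) = 1 + 1 / real (k + 1)"
  proof -
    have "d / (d - r) = real (k + 2) / real (k + 1)"
      unfolding dr using d by simp
    then show ?thesis by (simp add: field_simps)
  qed
  also have "B * real (k + 2) * (1 + 1 / real (k + 1)) ^ k \<le> B * real (k + 2) * 3"
  proof -
    have "(1 + 1 / real (k + 1)) ^ k \<le> exp (1 / real (k + 1)) ^ k"
      by (intro power_mono exp_ge_add_one_self) auto
    also have "\<dots> = exp (real k * (1 / real (k + 1)))"
      by (rule exp_of_nat_mult [symmetric])
    also have "\<dots> \<le> exp 1" by (simp add: field_simps)
    also have "\<dots> \<le> 3" by (rule exp_le)
    finally show ?thesis using B0 by (intro mult_left_mono) auto
  qed
  also have "\<dots> \<le> B * (2 * real (Suc k)) * 3"
    using B0 by (intro mult_right_mono mult_left_mono) auto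
  finally show ?thesis by (simp add: d_def mult_ac)
qed

text \<open>The subtracted term serves the induction: one step is the telescoping bound of
  \<open>1 / (k + 2)^2\<close> by \<open>1 / (k + 1) - 1 / (k + 2)\<close>.\<close>

lemma sum_inverse_squares_le: "(\<Sum>i\<le>k. 1 / (real i + 1)^2) \<le> 2 - 1 / (real k + 1)"
proof (induction k)
  case (Suc k)
  have "1 / (real k + 2)^2 \<le> 1 / (real k + 1) - 1 / (real k + 2)"
    by (simp add: power2_eq_square divide_simps)
  then show ?case using Suc by (simp add: add_ac)
qed simp

text \<open>With \<open>a = i + 1\<close> and \<open>b = k - i + 1\<close>, the inequality
  \<open>(a + b)^2 \<le> 4 (a^2 + b^2)\<close> bounds \<open>1 / (a b)^2\<close> by
  \<open>4 / (k + 1)^2\<close> times \<open>1 / a^2 + 1 / b^2\<close>, and each of the two resulting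
  sums is at most 2. Hence the weight \<open>1 / (k + 1)^2\<close> is submultiplicative up to the
  constant 16.\<close>

lemma convolution_inverse_squares_le:
  "(\<Sum>i\<le>k. 1 / (real i + 1)^2 * (1 / (real (k - i) + 1)^2)) \<le> 16 / (real k + 1)^2"
proof -
  let ?e = "\<lambda>i. 1 / (real i + 1)^2"
  have split: "?e i * ?e (k - i) \<le> 4 / (real k + 1)^2 * (?e i + ?e (k - i))" if "i \<le> k" for i
  proof -
    let ?a = "real i + 1" and ?b = "real (k - i) + 1"
    have ab: "?a > 0" "?b > 0" by auto
    have "(real k + 1)^2 \<le> (?a + ?b)^2" using that by (intro power_mono) auto
    also have "\<dots> \<le> 2 * (?a^2 + ?b^2)"
      using zero_le_power2[of "?a - ?b"] by (simp add: power2_eq_square algebra_simps)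
    also have "\<dots> \<le> 4 * (?a^2 + ?b^2)" by simp
    finally have "1 / (?a^2 * ?b^2) \<le> 4 / (real k + 1)^2 * ((?a^2 + ?b^2) / (?a^2 * ?b^2))"
      using ab by (simp add: field_simps)
    also have "(?a^2 + ?b^2) / (?a^2 * ?b^2) = ?e i + ?e (k - i)"
      using ab by (simp add: field_simps)
    finally show ?thesis by simp
  qed
  have rev: "(\<Sum>i\<le>k. ?e (k - i)) = (\<Sum>i\<le>k. ?e i)"
    by (rule sum.reindex_bij_witness[of _ "\<lambda>i. k - i" "\<lambda>i. k - i"]) auto
  have "(\<Sum>i\<le>k. ?e i * ?e (k - i)) \<le> (\<Sum>i\<le>k. 4 / (real k + 1)^2 * (?e i + ?e (k - i)))"
    using split by (intro sum_mono) auto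
  also have "\<dots> = 4 / (real k + 1)^2 * (2 * (\<Sum>i\<le>k. ?e i))"
    by (simp only: sum_distrib_left [symmetric] sum.distrib rev mult_2)
  also have "\<dots> \<le> 4 / (real k + 1)^2 * (2 * 2)"
  proof -
    have "(\<Sum>i\<le>k. ?e i) \<le> 2 - 1 / (real k + 1)" by (rule sum_inverse_squares_le)
    also have "\<dots> \<le> 2" by simp
    finally show ?thesis by (intro mult_left_mono) auto
  qed
  finally show ?thesis by simp
qed

section \<open>Holomorphic families of power series and their weighted bounds\<close>

type_synonym fser = "complex \<Rightarrow> complex fps"

text \<open>
  A map from points \<open>z = ln s\<close> to power series in \<open>t\<close>. In \<open>bnd\<close> and \<open>dbnd\<close> a derivative in \<open>z\<close> costs one
  power of the distance to the boundary and a factor \<open>k + 1\<close>; both are recovered by integrating in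
  \<open>t\<close>, at the price of a factor \<open>1/al\<close>, so that large \<open>al\<close> closes the fixed-point estimate. The weights
  \<open>1/(k + 1)\<^sup>2\<close> make the bounds stable under products.
\<close>

definition reg :: "fser \<Rightarrow> bool" where
  "reg f \<longleftrightarrow> (\<forall>k. (\<lambda>z. fps_nth (f z) k) holomorphic_on lhp) \<and>
     (\<forall>k. \<forall>x<0. fps_nth (f (complex_of_real x)) k \<in> \<real>)"

definition bnd :: "real \<Rightarrow> real \<Rightarrow> fser \<Rightarrow> bool" where
  "bnd al K f \<longleftrightarrow> reg f \<and>
     (\<forall>k. \<forall>z\<in>lhp. norm (fps_nth (f z) k) * bdist z ^ k \<le> K * al ^ k / (real k + 1)^2)"

definition dbnd :: "real \<Rightarrow> real \<Rightarrow> fser \<Rightarrow> bool" where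
  "dbnd al K f \<longleftrightarrow> reg f \<and>
     (\<forall>k. \<forall>z\<in>lhp. norm (fps_nth (f z) k) * bdist z ^ Suc k \<le> K * al ^ k / (real k + 1))"

text \<open>\<open>d/dz\<close> acts on functions of \<open>s\<close> as the Euler operator \<open>s d/ds\<close>.\<close>

definition th :: "fser \<Rightarrow> fser" where
  "th f z = Abs_fps (\<lambda>k. deriv (\<lambda>w. fps_nth (f w) k) z)"

lemma th_nth: "fps_nth (th f z) k = deriv (\<lambda>w. fps_nth (f w) k) z"
  by (simp add: th_def)

lemma reg_holo: "reg f \<Longrightarrow> (\<lambda>z. fps_nth (f z) k) holomorphic_on lhp"
  by (simp add: reg_def)

lemma reg_fdiff: "reg f \<Longrightarrow> z \<in> lhp \<Longrightarrow> (\<lambda>z. fps_nth (f z) k) field_differentiable at z"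
  using reg_holo open_lhp holomorphic_on_imp_differentiable_at by blast

lemma reg_real: "reg f \<Longrightarrow> x < 0 \<Longrightarrow> fps_nth (f (complex_of_real x)) k \<in> \<real>"
  by (simp add: reg_def)

lemma reg_add: "reg f \<Longrightarrow> reg g \<Longrightarrow> reg (\<lambda>z. f z + g z)"
  unfolding reg_def by (auto intro!: holomorphic_intros)

lemma reg_mult: "reg f \<Longrightarrow> reg g \<Longrightarrow> reg (\<lambda>z. f z * g z)"
  unfolding reg_def fps_mult_nth by (auto intro!: holomorphic_intros)

text \<open>The imaginary part vanishes along the negative axis, hence so does its derivative in
  that direction.\<close>

lemma deriv_real:
  assumes "f holomorphic_on lhp" "\<And>x. x < 0 \<Longrightarrow> f (complex_of_real x) \<in> \<real>" "x < 0"
  shows "deriv f (complex_of_real x) \<in> \<real>"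
proof -
  have z: "complex_of_real x \<in> lhp" using assms(3) by (simp add: lhp_def)
  have "(f has_field_derivative deriv f (of_real x)) (at (of_real x))"
    using assms(1) z open_lhp holomorphic_derivI by blast
  then have "((\<lambda>t. f (complex_of_real t)) has_vector_derivative deriv f (of_real x)) (at x)"
    by (rule has_vector_derivative_real_field)
  then have "((\<lambda>t. Im (f (complex_of_real t))) has_vector_derivative Im (deriv f (of_real x))) (at x)"
    by (rule bounded_linear.has_vector_derivative[OF bounded_linear_Im])
  then have 1: "((\<lambda>t. 0) has_vector_derivative Im (deriv f (of_real x))) (at x)"
  proof (rule has_vector_derivative_transform_within_open[of _ _ _ "{..<0}"])
    show "\<And>t. t \<in> {..<0} \<Longrightarrow> Im (f (complex_of_real t)) = 0"
      using assms(2) complex_is_Real_iff by auto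
  qed (use assms in auto)
  have "Im (deriv f (of_real x)) = 0"
    using vector_derivative_unique_at[OF 1 has_vector_derivative_const] by simp
  then show ?thesis by (simp add: complex_is_Real_iff)
qed

lemma reg_th: "reg f \<Longrightarrow> reg (th f)"
  unfolding reg_def th_nth using deriv_real holomorphic_deriv open_lhp by blast

lemma reg_integral: "reg f \<Longrightarrow> reg (\<lambda>z. fps_integral0 (f z))"
proof -
  assume f: "reg f"
  have "(\<lambda>z. fps_nth (fps_integral0 (f z)) k) holomorphic_on lhp \<and>
    (\<forall>x<0. fps_nth (fps_integral0 (f (complex_of_real x))) k \<in> \<real>)" for k
    using f by (cases k) (auto simp: reg_def intro!: holomorphic_intros simp del: of_nat_Suc)
  then show ?thesis by (simp add: reg_def)
qed

lemma reg_const: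
  assumes "c holomorphic_on lhp" "\<And>x. x < 0 \<Longrightarrow> c (complex_of_real x) \<in> \<real>"
  shows "reg (\<lambda>z. fps_const (c z))"
  proof -
  have "(\<lambda>z. fps_nth (fps_const (c z)) k) holomorphic_on lhp" for k
    using assms(1) by (cases k) (auto intro!: holomorphic_intros)
  then show ?thesis unfolding reg_def using assms(2) by (auto simp: fps_const_def)
qed

lemma bnd_nonneg:
  assumes "bnd al K f" shows "0 \<le> K"
proof -
  have "norm (fps_nth (f (-1)) 0) * bdist (-1) ^ 0 \<le> K * al ^ 0 / (real 0 + 1)^2"
    using assms unfolding bnd_def lhp_def by (elim conjE allE[of _ 0] ballE[of _ _ "-1"]) auto
  then have "norm (fps_nth (f (-1)) 0) \<le> K" by simp
  then show ?thesis using norm_ge_zero order_trans by blast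
qed

lemma dbnd_nonneg:
  assumes "dbnd al K f" shows "0 \<le> K"
proof -
  have "norm (fps_nth (f (-1)) 0) * bdist (-1) ^ Suc 0 \<le> K * al ^ 0 / (real 0 + 1)"
    using assms unfolding dbnd_def lhp_def by (elim conjE allE[of _ 0] ballE[of _ _ "-1"]) auto
  then have "norm (fps_nth (f (-1)) 0) \<le> K" by (simp add: bdist_def)
  then show ?thesis using norm_ge_zero order_trans by blast
qed

lemma bnd_const:
  assumes "c holomorphic_on lhp" "\<And>x. x < 0 \<Longrightarrow> c (complex_of_real x) \<in> \<real>"
    and "\<And>z. z \<in> lhp \<Longrightarrow> norm (c z) \<le> K" "0 \<le> K" "0 \<le> al"
  shows "bnd al K (\<lambda>z. fps_const (c z))"
  unfolding bnd_def using assms by (auto simp: reg_const)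

lemma bnd_mono: "bnd al K f \<Longrightarrow> K \<le> L \<Longrightarrow> 0 \<le> al \<Longrightarrow> bnd al L f"
  unfolding bnd_def
  by (meson divide_right_mono mult_right_mono order_trans zero_le_power zero_le_power2)

lemma bnd_add:
  assumes "bnd al K f" "bnd al L g"
  shows "bnd al (K + L) (\<lambda>z. f z + g z)"
proof -
  have "norm (fps_nth (f z + g z) k) * bdist z ^ k \<le> (K + L) * al ^ k / (real k + 1)^2"
    if z: "z \<in> lhp" for z k
  proof -
    have "norm (fps_nth (f z + g z) k) * bdist z ^ k
      \<le> (norm (fps_nth (f z) k) + norm (fps_nth (g z) k)) * bdist z ^ k"
      using bdist_pos[OF z] by (intro mult_right_mono) (auto simp: norm_triangle_ineq)
    also have "\<dots> \<le> K * al ^ k / (real k + 1)^2 + L * al ^ k / (real k + 1)^2"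
      using assms z by (auto simp: bnd_def distrib_right intro!: add_mono)
    finally show ?thesis by (simp add: add_divide_distrib distrib_right)
  qed
  then show ?thesis using assms reg_add by (auto simp: bnd_def)
qed

lemma dbnd_add:
  assumes "dbnd al K f" "dbnd al L g"
  shows "dbnd al (K + L) (\<lambda>z. f z + g z)"
proof -
  have "norm (fps_nth (f z + g z) k) * bdist z ^ Suc k \<le> (K + L) * al ^ k / (real k + 1)"
    if z: "z \<in> lhp" for z k
  proof -
    have "norm (fps_nth (f z + g z) k) * bdist z ^ Suc k
      \<le> (norm (fps_nth (f z) k) + norm (fps_nth (g z) k)) * bdist z ^ Suc k"
      using bdist_pos[OF z] by (intro mult_right_mono) (auto simp: norm_triangle_ineq)
    also have "\<dots> \<le> K * al ^ k / (real k + 1) + L * al ^ k / (real k + 1)"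
      using assms z by (auto simp: dbnd_def distrib_right simp del: power_Suc intro!: add_mono)
    finally show ?thesis by (simp add: add_divide_distrib distrib_right)
  qed
  then show ?thesis using assms reg_add by (auto simp: dbnd_def)
qed

lemma bnd_mult:
  assumes "bnd al K f" "bnd al L g" "0 \<le> al"
  shows "bnd al (16 * K * L) (\<lambda>z. f z * g z)"
proof -
  have KL: "0 \<le> K" "0 \<le> L" using assms bnd_nonneg by auto
  have "norm (fps_nth (f z * g z) k) * bdist z ^ k \<le> 16 * K * L * al ^ k / (real k + 1)^2"
    if z: "z \<in> lhp" for z k
  proof -
    let ?e = "\<lambda>i. 1 / (real i + 1)^2"
    have "norm (fps_nth (f z * g z) k) * bdist z ^ k
      \<le> (\<Sum>i\<le>k. norm (fps_nth (f z) i * fps_nth (g z) (k - i))) * bdist z ^ k"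
      using bdist_pos[OF z] unfolding fps_mult_nth atLeast0AtMost
      by (intro mult_right_mono norm_sum) auto
    also have "\<dots> = (\<Sum>i\<le>k. (norm (fps_nth (f z) i) * bdist z ^ i) *
        (norm (fps_nth (g z) (k - i)) * bdist z ^ (k - i)))"
      unfolding sum_distrib_right
      by (rule sum.cong) (auto simp: norm_mult mult_ac power_add [symmetric])
    also have "\<dots> \<le> (\<Sum>i\<le>k. (K * al ^ i / (real i + 1)^2) * (L * al ^ (k - i) / (real (k - i) + 1)^2))"
      using assms z bdist_pos[OF z] KL
      by (intro sum_mono mult_mono) (auto simp: bnd_def simp del: of_nat_diff)
    also have "\<dots> = K * L * al ^ k * (\<Sum>i\<le>k. ?e i * ?e (k - i))"
      unfolding sum_distrib_left
      by (rule sum.cong) (auto simp: mult_ac power_add [symmetric])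
    also have "\<dots> \<le> K * L * al ^ k * (16 / (real k + 1)^2)"
      using KL assms(3) convolution_inverse_squares_le by (intro mult_left_mono) auto
    finally show ?thesis by (simp add: mult_ac)
  qed
  then show ?thesis using assms reg_mult by (auto simp: bnd_def)
qed

text \<open>For \<open>j \<le> k\<close> the weaker weight \<open>1 / (j + 1)\<close> of the second
  factor is at most \<open>(k + 1) / (j + 1)^2\<close>, which reduces the estimate to the
  convolution of inverse squares.\<close>

lemma dbnd_mult:
  assumes "bnd al K f" "dbnd al L g" "0 \<le> al"
  shows "dbnd al (16 * K * L) (\<lambda>z. f z * g z)"
proof -
  have KL: "0 \<le> K" "0 \<le> L" using assms bnd_nonneg dbnd_nonneg by auto
  have "norm (fps_nth (f z * g z) k) * bdist z ^ Suc k \<le> 16 * K * L * al ^ k / (real k + 1)"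
    if z: "z \<in> lhp" for z k
  proof -
    let ?e = "\<lambda>i. 1 / (real i + 1)^2"
    have "norm (fps_nth (f z * g z) k) * bdist z ^ Suc k
      \<le> (\<Sum>i\<le>k. norm (fps_nth (f z) i * fps_nth (g z) (k - i))) * bdist z ^ Suc k"
      using bdist_pos[OF z] unfolding fps_mult_nth atLeast0AtMost
      by (intro mult_right_mono norm_sum) auto
    also have "\<dots> = (\<Sum>i\<le>k. (norm (fps_nth (f z) i) * bdist z ^ i) *
        (norm (fps_nth (g z) (k - i)) * bdist z ^ Suc (k - i)))"
      unfolding sum_distrib_right
      by (rule sum.cong) (auto simp: norm_mult mult_ac power_add [symmetric])
    also have "\<dots> \<le> (\<Sum>i\<le>k. (K * al ^ i / (real i + 1)^2) * (L * al ^ (k - i) / (real (k - i) + 1)))"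
      using assms z bdist_pos[OF z] KL
      by (intro sum_mono mult_mono) (auto simp: bnd_def dbnd_def simp del: power_Suc of_nat_diff)
    also have "\<dots> \<le> (\<Sum>i\<le>k. K * L * al ^ k * (real k + 1) * (?e i * ?e (k - i)))"
    proof (rule sum_mono)
      fix i assume i: "i \<in> {..k}"
      have p: "al ^ i * al ^ (k - i) = al ^ k" using i by (simp add: power_add [symmetric])
      have "1 / (real (k - i) + 1) \<le> (real k + 1) * ?e (k - i)"
        by (simp add: divide_simps power2_eq_square)
      then have "(K * L * al ^ k * ?e i) * (1 / (real (k - i) + 1))
          \<le> (K * L * al ^ k * ?e i) * ((real k + 1) * ?e (k - i))"
        using KL assms(3) by (intro mult_left_mono) auto
      then show "(K * al ^ i / (real i + 1)^2) * (L * al ^ (k - i) / (real (k - i) + 1))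
          \<le> K * L * al ^ k * (real k + 1) * (?e i * ?e (k - i))"
        by (simp add: p [symmetric] mult_ac)
    qed
    also have "\<dots> = K * L * al ^ k * (real k + 1) * (\<Sum>i\<le>k. ?e i * ?e (k - i))"
      by (rule sum_distrib_left [symmetric])
    also have "\<dots> \<le> K * L * al ^ k * (real k + 1) * (16 / (real k + 1)^2)"
      using KL assms(3) convolution_inverse_squares_le by (intro mult_left_mono) auto
    also have "\<dots> = 16 * K * L * al ^ k / (real k + 1)"
      by (simp add: power2_eq_square)
    finally show ?thesis .
  qed
  then show ?thesis using assms reg_mult[of f g] by (auto simp: dbnd_def bnd_def)
qed

lemma bnd_imp_dbnd:
  assumes "bnd al K f" "0 \<le> al"
  shows "dbnd al K f"
proof -
  have K: "0 \<le> K" using assms bnd_nonneg by auto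
  have "norm (fps_nth (f z) k) * bdist z ^ Suc k \<le> K * al ^ k / (real k + 1)"
    if z: "z \<in> lhp" for z k
  proof -
    have "norm (fps_nth (f z) k) * bdist z ^ Suc k \<le> norm (fps_nth (f z) k) * bdist z ^ k"
      using bdist_pos[OF z] bdist_le_1[of z]
      by (intro mult_left_mono) (auto simp: mult_le_cancel_right1)
    also have "\<dots> \<le> K * al ^ k / (real k + 1)^2" using assms z by (auto simp: bnd_def)
    also have "\<dots> \<le> K * al ^ k / (real k + 1)"
      using K assms(2) by (intro divide_left_mono) (auto simp: power2_eq_square)
    finally show ?thesis .
  qed
  then show ?thesis using assms by (auto simp: dbnd_def bnd_def)
qed

lemma dbnd_th:
  assumes "bnd al K f"
  shows "dbnd al (6 * K) (th f)"
proof -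
  have "norm (fps_nth (th f z) k) * bdist z ^ Suc k \<le> 6 * K * al ^ k / (real k + 1)"
    if z: "z \<in> lhp" for z k
  proof -
    have "norm (deriv (\<lambda>w. fps_nth (f w) k) z) * bdist z ^ Suc k
        \<le> 6 * real (Suc k) * (K * al ^ k / (real k + 1)^2)"
      using assms z by (intro nagumo_deriv_bound) (auto simp: bnd_def reg_def)
    also have "\<dots> = 6 * K * al ^ k / (real k + 1)"
      by (simp add: power2_eq_square add_ac divide_simps)
    finally show ?thesis by (simp add: th_nth)
  qed
  then show ?thesis using assms reg_th by (auto simp: dbnd_def bnd_def)
qed

text \<open>Integration moves coefficient \<open>j\<close> to \<open>j + 1\<close>: the division by
  \<open>j + 1\<close> restores the square in the weight, the extra power of \<open>bdist\<close>
  becomes the right one, and the missing factor \<open>al\<close> shows up as \<open>1 / al\<close>.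
  The 4 bounds \<open>((j + 2) / (j + 1))^2\<close>.\<close>

lemma bnd_integral:
  assumes "dbnd al L f" "0 < al"
  shows "bnd al (4 * L / al) (\<lambda>z. fps_integral0 (f z))"
proof -
  have L: "0 \<le> L" using assms dbnd_nonneg by auto
  have "norm (fps_nth (fps_integral0 (f z)) k) * bdist z ^ k \<le> 4 * L / al * al ^ k / (real k + 1)^2"
    if z: "z \<in> lhp" for z k
  proof (cases k)
    case 0
    then show ?thesis using L assms by simp
  next
    case (Suc j)
    have "norm (fps_nth (fps_integral0 (f z)) k) * bdist z ^ k
       = norm (fps_nth (f z) j) * bdist z ^ Suc j / real (Suc j)"
      using Suc by (simp add: norm_mult norm_inverse norm_divide divide_inverse mult_ac del: of_nat_Suc power_Suc)
    also have "\<dots> \<le> L * al ^ j / (real j + 1) / real (Suc j)"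
      using assms z by (intro divide_right_mono) (auto simp: dbnd_def simp del: power_Suc)
    also have "\<dots> = L * al ^ j * (1 / (real j + 1)^2)" by (simp add: power2_eq_square)
    also have "\<dots> \<le> L * al ^ j * (4 / (real j + 2)^2)"
    proof -
      have "(real j + 2)^2 \<le> (2 * (real j + 1))^2" by (intro power_mono) auto
      also have "\<dots> = 4 * (real j + 1)^2" by (simp only: power_mult_distrib) simp
      finally have "1 / (real j + 1)^2 \<le> 4 / (real j + 2)^2"
        by (simp add: divide_simps)
      then show ?thesis using L assms by (intro mult_left_mono) auto
    qed
    also have "\<dots> = 4 * L / al * al ^ k / (real k + 1)^2"
      using Suc assms(2) by (simp add: add_ac)
    finally show ?thesis .
  qed
  then show ?thesis using assms reg_integral by (auto simp: bnd_def dbnd_def)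
qed

lemma dbnd_mono: "dbnd al K f \<Longrightarrow> K \<le> L \<Longrightarrow> 0 \<le> al \<Longrightarrow> dbnd al L f"
  unfolding dbnd_def
proof (intro conjI allI ballI; elim conjE)
  fix k z assume "K \<le> L" "0 \<le> al" "z \<in> lhp"
    "\<forall>k. \<forall>z\<in>lhp. norm (fps_nth (f z) k) * bdist z ^ Suc k \<le> K * al ^ k / (real k + 1)"
  moreover have "K * al ^ k / (real k + 1) \<le> L * al ^ k / (real k + 1)"
    using calculation by (intro divide_right_mono mult_right_mono) auto
  ultimately show "norm (fps_nth (f z) k) * bdist z ^ Suc k \<le> L * al ^ k / (real k + 1)"
    using order_trans by blast
qed

definition causal :: "((nat \<Rightarrow> fser) \<Rightarrow> fser) \<Rightarrow> bool" where
  "causal F \<longleftrightarrow> (\<forall>n u w. (\<forall>i z. \<forall>k\<le>n. fps_nth (u i z) k = fps_nth (w i z) k) \<longrightarrow>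
     (\<forall>z. \<forall>k\<le>n. fps_nth (F u z) k = fps_nth (F w z) k))"

lemma causalD:
  assumes "causal F" "\<And>i z k. k \<le> n \<Longrightarrow> fps_nth (u i z) k = fps_nth (w i z) k" "k \<le> n"
  shows "fps_nth (F u z) k = fps_nth (F w z) k"
  using assms unfolding causal_def by blast

text \<open>The order of the quantifiers matters: \<open>L\<close> depends on \<open>K\<close>
  alone, so that \<open>al\<close> can be chosen after \<open>L\<close> in the fixed-point argument.
  Operators with \<open>admD\<close> may lose one derivative in \<open>z\<close>, those with
  \<open>admB\<close> lose none.\<close>

definition admB :: "((nat \<Rightarrow> fser) \<Rightarrow> fser) \<Rightarrow> bool" where
  "admB F \<longleftrightarrow> causal F \<and>
     (\<forall>K. \<exists>L. \<forall>al>0. \<forall>u. (\<forall>i. bnd al K (u i)) \<longrightarrow> bnd al L (F u))"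

definition admD :: "((nat \<Rightarrow> fser) \<Rightarrow> fser) \<Rightarrow> bool" where
  "admD F \<longleftrightarrow> causal F \<and>
     (\<forall>K. \<exists>L. \<forall>al>0. \<forall>u. (\<forall>i. bnd al K (u i)) \<longrightarrow> dbnd al L (F u))"

lemma admB_proj: "admB (\<lambda>u. u i)"
  unfolding admB_def causal_def by blast

lemma admB_const:
  assumes "c holomorphic_on lhp" "\<And>x. x < 0 \<Longrightarrow> c (complex_of_real x) \<in> \<real>"
    and "\<And>z. z \<in> lhp \<Longrightarrow> norm (c z) \<le> K"
  shows "admB (\<lambda>u z. fps_const (c z))"
proof -
  have "norm (c (-1)) \<le> K" using assms(3)[of "-1"] by (simp add: lhp_def)
  then have "0 \<le> K" using norm_ge_zero order_trans by blast
  then show ?thesis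
    unfolding admB_def causal_def using bnd_const[OF assms] by (meson less_imp_le)
qed

lemma causal_add: "causal F \<Longrightarrow> causal G \<Longrightarrow> causal (\<lambda>u z. F u z + G u z)"
  by (auto simp: causal_def)

lemma causal_mult:
  assumes "causal F" "causal G"
  shows "causal (\<lambda>u z. F u z * G u z)"
  unfolding causal_def
proof (intro allI impI)
  fix n k :: nat and u w :: "nat \<Rightarrow> fser" and z
  assume uw: "\<forall>i z. \<forall>k\<le>n. fps_nth (u i z) k = fps_nth (w i z) k" and k: "k \<le> n"
  have "fps_nth (F u z) i = fps_nth (F w z) i" "fps_nth (G u z) i = fps_nth (G w z) i" if "i \<le> n" for i
    by (rule causalD[OF assms(1) _ that], simp add: uw) (rule causalD[OF assms(2) _ that], simp add: uw)
  with k show "fps_nth (F u z * G u z) k = fps_nth (F w z * G w z) k"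
    unfolding fps_mult_nth by (intro sum.cong) auto
qed

lemma causal_th: "causal F \<Longrightarrow> causal (\<lambda>u. th (F u))"
  by (auto simp: causal_def th_nth)

lemma admBD:
  "admB F \<Longrightarrow> \<exists>L. \<forall>al u. 0 < al \<longrightarrow> (\<forall>i. bnd al K (u i)) \<longrightarrow> bnd al L (F u)"
  unfolding admB_def by blast

lemma admDD:
  "admD F \<Longrightarrow> \<exists>L. \<forall>al u. 0 < al \<longrightarrow> (\<forall>i. bnd al K (u i)) \<longrightarrow> dbnd al L (F u)"
  unfolding admD_def by blast

lemma admB_add:
  assumes "admB F" "admB G"
  shows "admB (\<lambda>u z. F u z + G u z)"
  unfolding admB_def
proof (intro conjI allI)
  show "causal (\<lambda>u z. F u z + G u z)"
    using assms causal_add[of F G] by (simp add: admB_def admB_def)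
  fix K
  obtain L1 L2 where "\<And>al u. 0 < al \<Longrightarrow> (\<And>i. bnd al K (u i)) \<Longrightarrow> bnd al L1 (F u)"
    "\<And>al u. 0 < al \<Longrightarrow> (\<And>i. bnd al K (u i)) \<Longrightarrow> bnd al L2 (G u)"
    using admBD[OF assms(1), of K] admBD[OF assms(2), of K] by metis
  then have "bnd al (L1 + L2) (\<lambda>z. F u z + G u z)"
    if "0 < al" "\<forall>i. bnd al K (u i)" for al u
    using that by (intro bnd_add) auto
  then show "\<exists>L. \<forall>al>0. \<forall>u. (\<forall>i. bnd al K (u i)) \<longrightarrow> bnd al L (\<lambda>z. F u z + G u z)"
    by blast
qed

lemma admB_mult:
  assumes "admB F" "admB G"
  shows "admB (\<lambda>u z. F u z * G u z)"
  unfolding admB_def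
proof (intro conjI allI)
  show "causal (\<lambda>u z. F u z * G u z)"
    using assms causal_mult[of F G] by (simp add: admB_def admB_def)
  fix K
  obtain L1 L2 where "\<And>al u. 0 < al \<Longrightarrow> (\<And>i. bnd al K (u i)) \<Longrightarrow> bnd al L1 (F u)"
    "\<And>al u. 0 < al \<Longrightarrow> (\<And>i. bnd al K (u i)) \<Longrightarrow> bnd al L2 (G u)"
    using admBD[OF assms(1), of K] admBD[OF assms(2), of K] by metis
  then have "bnd al (16 * L1 * L2) (\<lambda>z. F u z * G u z)"
    if "0 < al" "\<forall>i. bnd al K (u i)" for al u
    using that by (intro bnd_mult) auto
  then show "\<exists>L. \<forall>al>0. \<forall>u. (\<forall>i. bnd al K (u i)) \<longrightarrow> bnd al L (\<lambda>z. F u z * G u z)"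
    by blast
qed

lemma admD_add:
  assumes "admD F" "admD G"
  shows "admD (\<lambda>u z. F u z + G u z)"
  unfolding admD_def
proof (intro conjI allI)
  show "causal (\<lambda>u z. F u z + G u z)"
    using assms causal_add[of F G] by (simp add: admD_def admD_def)
  fix K
  obtain L1 L2 where "\<And>al u. 0 < al \<Longrightarrow> (\<And>i. bnd al K (u i)) \<Longrightarrow> dbnd al L1 (F u)"
    "\<And>al u. 0 < al \<Longrightarrow> (\<And>i. bnd al K (u i)) \<Longrightarrow> dbnd al L2 (G u)"
    using admDD[OF assms(1), of K] admDD[OF assms(2), of K] by metis
  then have "dbnd al (L1 + L2) (\<lambda>z. F u z + G u z)"
    if "0 < al" "\<forall>i. bnd al K (u i)" for al u
    using that by (intro dbnd_add) auto
  then show "\<exists>L. \<forall>al>0. \<forall>u. (\<forall>i. bnd al K (u i)) \<longrightarrow> dbnd al L (\<lambda>z. F u z + G u z)"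
    by blast
qed

lemma admD_mult:
  assumes "admB F" "admD G"
  shows "admD (\<lambda>u z. F u z * G u z)"
  unfolding admD_def
proof (intro conjI allI)
  show "causal (\<lambda>u z. F u z * G u z)"
    using assms causal_mult[of F G] by (simp add: admB_def admD_def)
  fix K
  obtain L1 L2 where "\<And>al u. 0 < al \<Longrightarrow> (\<And>i. bnd al K (u i)) \<Longrightarrow> bnd al L1 (F u)"
    "\<And>al u. 0 < al \<Longrightarrow> (\<And>i. bnd al K (u i)) \<Longrightarrow> dbnd al L2 (G u)"
    using admBD[OF assms(1), of K] admDD[OF assms(2), of K] by metis
  then have "dbnd al (16 * L1 * L2) (\<lambda>z. F u z * G u z)"
    if "0 < al" "\<forall>i. bnd al K (u i)" for al u
    using that by (intro dbnd_mult) auto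
  then show "\<exists>L. \<forall>al>0. \<forall>u. (\<forall>i. bnd al K (u i)) \<longrightarrow> dbnd al L (\<lambda>z. F u z * G u z)"
    by blast
qed

lemma admD_th:
  assumes "admB F"
  shows "admD (\<lambda>u. th (F u))"
  unfolding admD_def
proof (intro conjI allI)
  show "causal (\<lambda>u. th (F u))"
    using assms causal_th by (simp add: admB_def)
  fix K
  obtain L where "\<And>al u. 0 < al \<Longrightarrow> (\<And>i. bnd al K (u i)) \<Longrightarrow> bnd al L (F u)"
    using admBD[OF assms, of K] by metis
  then have "dbnd al (6 * L) (th (F u))" if "0 < al" "\<forall>i. bnd al K (u i)" for al u
    using that by (intro dbnd_th) auto
  then show "\<exists>L. \<forall>al>0. \<forall>u. (\<forall>i. bnd al K (u i)) \<longrightarrow> dbnd al L (th (F u))"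
    by blast
qed

lemma admB_imp_admD:
  assumes "admB F"
  shows "admD (\<lambda>u. F u)"
  unfolding admD_def
proof (intro conjI allI)
  show "causal (\<lambda>u. F u)"
    using assms  by (simp add: admB_def)
  fix K
  obtain L where "\<And>al u. 0 < al \<Longrightarrow> (\<And>i. bnd al K (u i)) \<Longrightarrow> bnd al L (F u)"
    using admBD[OF assms, of K] by metis
  then have "dbnd al (L) (F u)" if "0 < al" "\<forall>i. bnd al K (u i)" for al u
    using that by (intro bnd_imp_dbnd) auto
  then show "\<exists>L. \<forall>al>0. \<forall>u. (\<forall>i. bnd al K (u i)) \<longrightarrow> dbnd al L (F u)"
    by blast
qed

text \<open>Picard iteration among the \<open>u\<close> with bound \<open>K0 + 1\<close>. The bound
  \<open>L\<close> of the right-hand side there is known before \<open>al\<close>, and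
  \<open>al = 4 * L + 1\<close> makes the integral contribute at most 1, so the bound is preserved.
  By causality the coefficients up to \<open>n\<close> of the \<open>n\<close>-th iterate are final.
  Since the components from \<open>m\<close> on have zero right-hand side, one \<open>L\<close>
  serves all of them.\<close>

lemma admissible_system_solution:
  fixes Phi :: "(nat \<Rightarrow> fser) \<Rightarrow> nat \<Rightarrow> fser"
  assumes adm: "\<And>i. admD (\<lambda>u. Phi u i)" and zero: "\<And>u i z. i \<ge> m \<Longrightarrow> Phi u i z = 0"
    and init: "\<And>i al. 0 < al \<Longrightarrow> bnd al K0 (u0 i)"
  shows "\<exists>al K u. 0 < al \<and> (\<forall>i. bnd al K (u i)) \<and>
     (\<forall>i z. u i z = u0 i z + fps_integral0 (Phi u i z))"
proof -
  define K where "K = K0 + 1"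
  have K0: "0 \<le> K0" using bnd_nonneg[OF init[of 1 0]] by simp
  have "\<forall>i. \<exists>L. \<forall>al>0. \<forall>u. (\<forall>j. bnd al K (u j)) \<longrightarrow> dbnd al L (Phi u i)"
    using adm unfolding admD_def by blast
  then obtain Lf where Lf:
    "\<And>i al u. al > 0 \<Longrightarrow> (\<And>j. bnd al K (u j)) \<Longrightarrow> dbnd al (Lf i) (Phi u i)"
    by metis
  define L where "L = (\<Sum>i<m. \<bar>Lf i\<bar>)"
  have L0: "0 \<le> L" by (simp add: L_def sum_nonneg)
  define al where "al = 4 * L + 1"
  have al: "0 < al" "4 * L / al \<le> 1" using L0 by (auto simp: al_def)
  have PhiL: "dbnd al L (Phi u i)" if "\<And>j. bnd al K (u j)" for u i
  proof (cases "i < m")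
    case True
    have "Lf i \<le> \<bar>Lf i\<bar>" by simp
    also have "\<dots> \<le> L" unfolding L_def using True by (intro member_le_sum) auto
    finally show ?thesis using dbnd_mono Lf[OF al(1) that] al(1) by fastforce
  next
    case False
    then have "Phi u i = (\<lambda>z. 0)" using zero by (intro ext) simp
    then show ?thesis using L0 al(1) by (simp add: dbnd_def reg_def)
  qed
  define S where "S = (\<lambda>u i z. u0 i z + fps_integral0 (Phi u i z))"
  have S_bnd: "bnd al K (S u i)" if "\<And>j. bnd al K (u j)" for u i
  proof -
    have "bnd al (K0 + 4 * L / al) (S u i)"
      unfolding S_def using bnd_add[OF init[OF al(1)] bnd_integral[OF PhiL[OF that] al(1)]] .
    then show ?thesis using bnd_mono al unfolding K_def by fastforce
  qed
  define T where "T n = (S ^^ n) u0" for n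
  have T_Suc: "T (Suc n) = S (T n)" for n by (simp add: T_def)
  have T_bnd: "bnd al K (T n i)" for n i
  proof (induction n arbitrary: i)
    case 0
    show ?case using bnd_mono[OF init[OF al(1)], of K] al(1) by (simp add: T_def K_def)
  next
    case (Suc n)
    then show ?case unfolding T_Suc using S_bnd by blast
  qed
  have S_causal: "fps_nth (S u i z) k = fps_nth (S w i z) k"
    if "k \<le> Suc n" "\<And>i z k. k \<le> n \<Longrightarrow> fps_nth (u i z) k = fps_nth (w i z) k" for u w i z k n
  proof (cases k)
    case (Suc j)
    then have "fps_nth (Phi u i z) j = fps_nth (Phi w i z) j"
      using adm[of i] that causalD[of "\<lambda>u. Phi u i" n u w j z] unfolding admD_def by auto
    then show ?thesis using Suc by (simp add: S_def)
  qed (simp add: S_def)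
  have T_step: "fps_nth (T (Suc n) i z) k = fps_nth (T n i z) k" if "k \<le> n" for n i z k
    using that
  proof (induction n arbitrary: i z k)
    case 0
    then show ?case by (simp add: T_def S_def)
  next
    case (Suc n)
    then show ?case unfolding T_Suc[of "Suc n"] T_Suc[of n]
      using S_causal[of k n "S (T n)" "T n"] T_Suc by metis
  qed
  have T_stable: "fps_nth (T n i z) k = fps_nth (T k i z) k" if "k \<le> n" for n i z k
    using that
  proof (induction n rule: dec_induct)
    case (step n)
    then show ?case using T_step by simp
  qed simp
  \<comment> \<open>The limit is read off along the diagonal; the bounds pass to it because each of
    its coefficients is a coefficient of some iterate.\<close>
  define u where "u i z = Abs_fps (\<lambda>k. fps_nth (T k i z) k)" for i z
  have u_eq: "fps_nth (u i z) k = fps_nth (T n i z) k" if "k \<le> n" for i z k n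
    using T_stable[OF that] by (simp add: u_def)
  have u_eq': "fps_nth (u i z) k = fps_nth (T k i z) k" for i z k
    by (simp add: u_def)
  have "bnd al K (u i)" for i
  proof -
    have "\<forall>k. bnd al K (T k i)" using T_bnd by blast
    then show ?thesis unfolding bnd_def reg_def u_eq' by blast
  qed
  moreover have "u i z = S u i z" for i z
  proof (rule fps_ext)
    fix k
    have "fps_nth (S u i z) k = fps_nth (S (T k) i z) k"
      by (rule S_causal[of k k]) (auto simp: u_eq)
    also have "\<dots> = fps_nth (T (Suc k) i z) k" by (simp add: T_Suc)
    also have "\<dots> = fps_nth (u i z) k" using u_eq[of k "Suc k"] by simp
    finally show "fps_nth (u i z) k = fps_nth (S u i z) k" by simp
  qed
  ultimately show ?thesis using al(1) unfolding S_def by blast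
qed

section \<open>Formal identities and the Cauchy problem\<close>

lemma th_add:
  "reg f \<Longrightarrow> reg g \<Longrightarrow> z \<in> lhp \<Longrightarrow> th (\<lambda>z. f z + g z) z = th f z + th g z"
  by (rule fps_ext) (auto simp: th_nth reg_fdiff)

lemma th_const [simp]: "th (\<lambda>z. c) z = 0"
  by (rule fps_ext) (auto simp: th_nth)

lemma th_integral:
  assumes "reg f" "z \<in> lhp"
  shows "th (\<lambda>z. fps_integral0 (f z)) z = fps_integral0 (th f z)"
proof (rule fps_ext)
  fix k
  show "fps_nth (th (\<lambda>z. fps_integral0 (f z)) z) k = fps_nth (fps_integral0 (th f z)) k"
    using assms by (cases k) (auto simp: th_nth reg_fdiff simp del: of_nat_Suc)
qed

text \<open>Coefficient \<open>k + 1\<close> of \<open>g\<close> is a combination of its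
  coefficients up to \<open>k\<close>.\<close>

lemma fps_linear_ode_zero:
  fixes g h :: "'a::field_char_0 fps"
  assumes "fps_deriv g = h * g" "fps_nth g 0 = 0"
  shows "g = 0"
proof (rule fps_ext)
  fix n
  show "fps_nth g n = fps_nth 0 n"
  proof (induction n rule: less_induct)
    case (less n)
    show ?case
    proof (cases n)
      case (Suc k)
      have "of_nat (Suc k) * fps_nth g (Suc k) = fps_nth (h * g) k"
        using arg_cong[OF assms(1), of "\<lambda>f. fps_nth f k"] by simp
      also have "\<dots> = 0"
        unfolding fps_mult_nth using less Suc by (intro sum.neutral) auto
      finally show ?thesis using Suc by (simp del: of_nat_Suc)
    qed (use assms in simp)
  qed
qed

text \<open>The hypothesis is the differential equation of \<open>1 / d\<close>, polynomial in
  \<open>y\<close>; then \<open>1 - y d\<close> solves a homogeneous linear equation with initial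
  value 0. This removes the divisions from the Cauchy problem.\<close>

lemma riccati_inverse:
  fixes y d :: "'a::field_char_0 fps"
  assumes "fps_deriv y = - (y * (y * fps_deriv d))" "fps_nth y 0 * fps_nth d 0 = 1"
  shows "y * d = 1"
proof -
  have "1 - y * d = 0"
  proof (rule fps_linear_ode_zero)
    show "fps_deriv (1 - y * d) = (- (y * fps_deriv d)) * (1 - y * d)"
      using assms(1) by (simp add: algebra_simps)
  qed (use assms(2) in simp)
  then show ?thesis by simp
qed

lemma bnd_reg: "bnd al K f \<Longrightarrow> reg f"
  by (simp add: bnd_def)

text \<open>
  Here \<open>L\<close>, \<open>D\<close>, \<open>X\<close> are \<open>(\<theta> + a) W\<close>, \<open>(\<theta> + a - 1)(\<theta> + a) W\<close>, \<open>(\<theta> + a) W\<^sub>t\<close> with \<open>\<theta> = d/dz\<close>, and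
  \<open>E = r\<^sup>m (1 + \<tau>L)\<^sup>-\<^sup>m (1 + \<tau>W)\<^sup>q\<close> with \<open>\<tau> = s\<^sup>q\<^sup>/\<^sup>2\<close>, \<open>m = n - 2\<close>. Taking \<open>E\<close> and the inverses of
  \<open>D\<close>, \<open>1 + \<tau>L\<close>, \<open>1 + \<tau>W\<close> as further unknowns, each with its own evolution equation, turns the
  equation into a first-order system with polynomial right-hand side.
\<close>

lemma ck_series:
  fixes q :: real and m :: nat
  assumes q: "0 < q"
  defines "a \<equiv> 1 + q / 2"
  defines "c \<equiv> 1 / (2 * a)"
  defines "tau \<equiv> \<lambda>z. exp (complex_of_real (q / 2) * z)"
  defines "T \<equiv> \<lambda>z. fps_const (tau z)"
  defines "C \<equiv> \<lambda>r. fps_const (complex_of_real r)"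
  shows "\<exists>al K W L D V X Z E. 0 < al \<and> (\<forall>f\<in>{W, L, D, V, X, Z, E}. bnd al K f) \<and>
    (\<forall>z\<in>lhp. th W z = L z - C a * W z \<and> th L z = D z - C (a - 1) * L z \<and>
       th V z = X z - C a * V z \<and>
       fps_deriv (W z) = V z \<and> fps_deriv (L z) = X z \<and> fps_deriv (V z) = Z z \<and>
       D z * Z z = X z * X z + E z \<and>
       fps_deriv (E z) * ((1 + T z * L z) * (1 + T z * W z)) =
         E z * T z * (C q * (V z * (1 + T z * L z)) - C (real m) * (X z * (1 + T z * W z))) \<and>
       fps_nth (W z) 0 = of_real c \<and> fps_nth (L z) 0 = of_real (a * c) \<and>
       fps_nth (D z) 0 = of_real (a * (a - 1) * c) \<and>
       fps_nth (E z) 0 = (1 / 2 + exp z) ^ m * (1 / (1 + tau z * of_real (a * c))) ^ m *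
          (1 + tau z * of_real c) powr of_real q)"
proof -
  \<comment> \<open>The choice \<open>c = 1 / (2 * a)\<close> puts both \<open>c\<close> and
    \<open>a * c\<close> into the interval from 0 to 1/2. As \<open>tau\<close> has modulus at most
    1, the quantities \<open>1 + tau c\<close> and \<open>1 + tau (a c)\<close> stay in the right
    half-plane with modulus between 1/2 and 2.\<close>
  have a: "1 < a" "0 < c" "a * c = 1 / 2" "c \<le> 1 / 2" "0 \<le> c" "0 \<le> a * c" "a * c \<le> 1 / 2" using q by (auto simp: a_def c_def field_simps)
  have tau_norm: "norm (tau z) \<le> 1" if "z \<in> lhp" for z
    using that q by (simp add: tau_def lhp_def mult_le_0_iff)
  have small: "norm (tau z * of_real d) \<le> 1 / 2" if "z \<in> lhp" "0 \<le> d" "d \<le> 1 / 2" for z d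
    using mult_mono[OF tau_norm[OF that(1)] that(3)] that by (simp add: norm_mult)
  have lower: "1 / 2 \<le> norm (1 + tau z * of_real d)" if "z \<in> lhp" "0 \<le> d" "d \<le> 1 / 2" for z d
    using norm_diff_ineq[of 1 "tau z * of_real d"] small[OF that] by simp
  have upper: "norm (1 + tau z * of_real d) \<le> 2" if "z \<in> lhp" "0 \<le> d" "d \<le> 1 / 2" for z d
    using norm_triangle_ineq[of 1 "tau z * of_real d"] small[OF that] by simp
  have Re_pos: "0 < Re (1 + tau z * of_real d)" if "z \<in> lhp" "0 \<le> d" "d \<le> 1 / 2" for z d
    using abs_Re_le_cmod[of "tau z * of_real d"] small[OF that] by simp
  have tau_hol: "tau holomorphic_on lhp" unfolding tau_def by (intro holomorphic_intros)
  have tau_real: "tau (of_real x) = of_real (exp (q / 2 * x))" for x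
    by (simp add: tau_def flip: of_real_mult exp_of_real)
  define n0 where "n0 d z = 1 / (1 + tau z * complex_of_real d)" for d z
  have n0_hol: "n0 d holomorphic_on lhp" if "0 \<le> d" "d \<le> 1 / 2" for d
    unfolding n0_def proof (intro holomorphic_intros tau_hol)
    fix z assume "z \<in> lhp"
    from lower[OF this that] show "1 + tau z * complex_of_real d \<noteq> 0" by auto
  qed
  have n0_real: "n0 d (of_real x) \<in> \<real>" for d x
  proof -
    have "n0 d (of_real x) = of_real (1 / (1 + exp (q / 2 * x) * d))"
      by (simp only: n0_def tau_real of_real_divide of_real_add of_real_mult of_real_1)
    then show ?thesis by (simp only: Reals_of_real)
  qed
  have n0_norm: "norm (n0 d z) \<le> 2" if "z \<in> lhp" "0 \<le> d" "d \<le> 1 / 2" for d z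
  proof -
    have "inverse (norm (1 + tau z * of_real d)) \<le> inverse (1 / 2)"
      using lower[OF that] by (intro le_imp_inverse_le) simp_all
    then show ?thesis by (simp add: n0_def norm_divide inverse_eq_divide)
  qed
  \<comment> \<open>The value of \<open>r\<^sup>m (1 + \<tau>L)\<^sup>-\<^sup>m (1 +
    \<tau>W)\<^sup>q\<close> for the data \<open>W = c\<close>, \<open>L = a c\<close>, with
    \<open>r = 1/2 + s = 1/2 + exp z\<close>.\<close>
  define e0 where "e0 z = (1 / 2 + exp z) ^ m * n0 (a * c) z ^ m * (1 + tau z * of_real c) powr of_real q" for z
  have e0_hol: "e0 holomorphic_on lhp"
  proof -
    have "1 + tau z * of_real c \<notin> \<real>\<^sub>\<le>\<^sub>0" if "z \<in> lhp" for z
      using Re_pos[OF that, of c] a by (auto simp: complex_nonpos_Reals_iff)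
    then show ?thesis unfolding e0_def using tau_hol n0_hol[OF a(6,7)]
      by (intro holomorphic_intros) simp_all
  qed
  have e0_real: "e0 (of_real x) \<in> \<real>" for x
  proof -
    have 1: "1 + tau (of_real x) * of_real c = of_real (1 + exp (q / 2 * x) * c)"
      by (simp add: tau_real)
    have "0 < 1 + exp (q / 2 * x) * c" using a by (intro add_pos_pos mult_pos_pos) auto
    then have "(1 + tau (of_real x) * of_real c) powr of_real q \<in> \<real>"
      unfolding 1 by (subst powr_of_real) auto
    moreover have "1 / 2 + exp (complex_of_real x) = of_real (1 / 2 + exp x)"
      by (simp add: exp_of_real)
    then have "1 / 2 + exp (complex_of_real x) \<in> \<real>" by (simp only: Reals_of_real)
    ultimately show ?thesis unfolding e0_def
      using n0_real by (blast intro: Reals_mult Reals_power)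
  qed
  have e0_norm: "norm (e0 z) \<le> 2 ^ m * 2 ^ m * exp (q * ln 2)" if z: "z \<in> lhp" for z
  proof -
    have "norm (1 / 2 + exp z) \<le> 1 / 2 + 1"
    proof -
      have "norm (exp z) \<le> 1" using z by (simp add: lhp_def)
      moreover have "norm (1 / 2 + exp z) \<le> 1 / 2 + norm (exp z)"
        using norm_triangle_ineq[of "1 / 2" "exp z"] by (simp del: norm_exp_eq_Re)
      ultimately show ?thesis by linarith
    qed
    then have 1: "norm (1 / 2 + exp z) \<le> 2" by simp
    have nz: "1 + tau z * of_real c \<noteq> 0" using lower[OF z, of c] a by auto
    have "norm ((1 + tau z * of_real c) powr of_real q) = exp (q * ln (norm (1 + tau z * of_real c)))"
      using nz by (simp add: powr_def)
    also have "\<dots> \<le> exp (q * ln 2)"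
      using q upper[OF z, of c] a nz by (auto intro!: mult_left_mono)
    finally have 2: "norm ((1 + tau z * of_real c) powr of_real q) \<le> exp (q * ln 2)" .
    show ?thesis unfolding e0_def norm_mult norm_power
      using 1 2 n0_norm[OF z a(6,7)] by (intro mult_mono power_mono) auto
  qed
  \<comment> \<open>\<open>W_tt\<close> solved from the equation \<open>D W_tt - X^2 = E\<close>,
    with the unknown \<open>u 2\<close> in place of \<open>1 / D\<close>.\<close>
  define ZZ where "ZZ u z = u 2 z * (u 1 z * u 1 z + u 5 z)" for u :: "nat \<Rightarrow> fser" and z
  \<comment> \<open>The unknowns 0 to 5 are \<open>W_t\<close>, \<open>X\<close>,
    \<open>1 / D\<close>, \<open>1 / (1 + \<tau>L)\<close>, \<open>1 / (1 + \<tau>W)\<close> and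
    \<open>E\<close>. The series \<open>W\<close>, \<open>L\<close> and \<open>D\<close> do not
    occur themselves and are recovered afterwards by integration in \<open>t\<close>. The last
    equation is the logarithmic derivative of \<open>E\<close>.\<close>
  define Phi where "Phi u i z =
    (if i = 0 then ZZ u z
     else if i = 1 then th (ZZ u) z + C a * ZZ u z
     else if i = 2 then C (-1) * (u 2 z * (u 2 z * (th (u 1) z + C (a - 1) * u 1 z)))
     else if i = 3 then C (-1) * (T z * (u 3 z * (u 3 z * u 1 z)))
     else if i = 4 then C (-1) * (T z * (u 4 z * (u 4 z * u 0 z)))
     else if i = 5 then T z * (u 5 z * (C (- real m) * (u 3 z * u 1 z) + C q * (u 4 z * u 0 z)))
     else 0)" for u :: "nat \<Rightarrow> fser" and i :: nat and z
  \<comment> \<open>Data \<open>W = c\<close> and \<open>W_t = 0\<close>, whence the value 0 for the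
    first two unknowns.\<close>
  define u0 where "u0 i z =
    (if i = 2 then C (1 / (a * (a - 1) * c))
     else if i = 3 then fps_const (n0 (a * c) z)
     else if i = 4 then fps_const (n0 c z)
     else if i = 5 then fps_const (e0 z)
     else 0)" for i :: nat and z
  have admC: "admB (\<lambda>u z. C r)" for r
    unfolding C_def by (rule admB_const[of _ "\<bar>r\<bar>"]) auto
  have admT: "admB (\<lambda>u z. T z)"
    unfolding T_def using tau_hol tau_norm by (intro admB_const) (auto simp: tau_real)
  have admZ: "admB (\<lambda>u. ZZ u)"
    unfolding ZZ_def by (intro admB_mult admB_add admB_proj)
  have adm0: "admD (\<lambda>u z. 0)"
    using admB_imp_admD[OF admC[of 0]] by (simp add: C_def)
  have adm: "admD (\<lambda>u. Phi u i)" for i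
  proof -
    consider "i = 0" | "i = 1" | "i = 2" | "i = 3" | "i = 4" | "i = 5" | "i \<ge> 6" by linarith
    then show ?thesis
    proof cases
      case 1 then show ?thesis unfolding Phi_def using admB_imp_admD[OF admZ] by simp
    next
      case 2
      have "admD (\<lambda>u z. th (ZZ u) z + C a * ZZ u z)"
        by (intro admD_add admD_th admD_mult admC admB_imp_admD admZ)
      with 2 show ?thesis unfolding Phi_def by simp
    next
      case 3
      have "admD (\<lambda>u z. C (-1) * (u 2 z * (u 2 z * (th (u 1) z + C (a - 1) * u 1 z))))"
        by (intro admD_add admD_th admD_mult admC admB_imp_admD[OF admB_proj] admB_proj)
      with 3 show ?thesis unfolding Phi_def by simp
    next
      case 4
      have "admD (\<lambda>u z. C (-1) * (T z * (u 3 z * (u 3 z * u 1 z))))"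
        by (intro admB_imp_admD admB_mult admC admT admB_proj)
      with 4 show ?thesis unfolding Phi_def by simp
    next
      case 5
      have "admD (\<lambda>u z. C (-1) * (T z * (u 4 z * (u 4 z * u 0 z))))"
        by (intro admB_imp_admD admB_mult admC admT admB_proj)
      with 5 show ?thesis unfolding Phi_def by simp
    next
      case 6
      have "admD (\<lambda>u z. T z * (u 5 z * (C (- real m) * (u 3 z * u 1 z) + C q * (u 4 z * u 0 z))))"
        by (intro admB_imp_admD admB_mult admB_add admC admT admB_proj)
      with 6 show ?thesis unfolding Phi_def by simp
    next
      case 7 then show ?thesis unfolding Phi_def using adm0 by simp
    qed
  qed
  define K0 where "K0 = \<bar>1 / (a * (a - 1) * c)\<bar> + 2 + 2 ^ m * 2 ^ m * exp (q * ln 2)"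
  have K0: "0 \<le> K0" "\<bar>1 / (a * (a - 1) * c)\<bar> \<le> K0" "2 \<le> K0" "2 ^ m * 2 ^ m * exp (q * ln 2) \<le> K0"
    by (auto simp: K0_def)
  have init: "bnd al K0 (u0 i)" if "0 < al" for al i
  proof -
    have "bnd al K0 (\<lambda>z. C (1 / (a * (a - 1) * c)))"
      unfolding C_def using K0 that
      by (intro bnd_const) (auto simp del: of_real_mult of_real_divide of_real_diff of_real_power of_real_add)
    moreover have "bnd al K0 (\<lambda>z. fps_const (n0 (a * c) z))"
      by (rule bnd_const) (use K0 that n0_hol[OF a(6,7)] n0_real order_trans[OF n0_norm[OF _ a(6,7)] K0(3)] in auto)
    moreover have "bnd al K0 (\<lambda>z. fps_const (n0 c z))"
      by (rule bnd_const) (use K0 that n0_hol[OF a(5,4)] n0_real order_trans[OF n0_norm[OF _ a(5,4)] K0(3)] in auto)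
    moreover have "bnd al K0 (\<lambda>z. fps_const (e0 z))"
      by (rule bnd_const) (use K0 that e0_hol e0_real order_trans[OF e0_norm K0(4)] in auto)
    moreover have "bnd al K0 (\<lambda>z. 0)"
      using bnd_const[of "\<lambda>z. 0" K0 al] K0 that by simp
    ultimately show ?thesis unfolding u0_def
      by (cases "i = 2"; cases "i = 3"; cases "i = 4"; cases "i = 5") auto
  qed
  obtain al K u where al: "0 < al" and ub: "\<And>i. bnd al K (u i)"
    and ueq: "\<And>i z. u i z = u0 i z + fps_integral0 (Phi u i z)"
    using admissible_system_solution[of Phi 6 K0 u0, OF adm _ init] unfolding Phi_def by auto
  define Z where "Z = ZZ u"
  \<comment> \<open>On constants \<open>th\<close> vanishes, so \<open>a c\<close> and
    \<open>a (a - 1) c\<close> are the initial values of \<open>(\<theta> + a) W\<close> and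
    \<open>(\<theta> + a - 1) (\<theta> + a) W\<close>.\<close>
  define W where "W z = C c + fps_integral0 (u 0 z)" for z
  define L where "L z = C (a * c) + fps_integral0 (u 1 z)" for z
  define D where "D z = C (a * (a - 1) * c) + fps_integral0 (th (u 1) z + C (a - 1) * u 1 z)" for z
  have ureg: "reg (u i)" for i using ub bnd_reg by blast
  have "\<exists>KZ. bnd al KZ Z"
    using admBD[OF admZ, of K] al ub unfolding Z_def by blast
  then obtain KZ where KZ: "bnd al KZ Z" by blast
  have C_bnd: "bnd al \<bar>r\<bar> (\<lambda>z. C r)" for r
    unfolding C_def using al by (intro bnd_const) auto
  have int_bnd: "\<exists>L. bnd al L (\<lambda>z. fps_integral0 (F u z))" if "admD F" for F
    using admDD[OF that, of K] al ub bnd_integral by blast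
  have W_bnd: "\<exists>K. bnd al K W"
    unfolding W_def using int_bnd[OF admB_imp_admD[OF admB_proj[of 0]]] bnd_add[OF C_bnd] by blast
  have L_bnd: "\<exists>K. bnd al K L"
    unfolding L_def using int_bnd[OF admB_imp_admD[OF admB_proj[of 1]]] bnd_add[OF C_bnd] by blast
  have admDD': "admD (\<lambda>u z. th (u 1) z + C (a - 1) * u 1 z)"
    by (intro admD_add admD_th admD_mult admC admB_imp_admD[OF admB_proj] admB_proj)
  have D_bnd: "\<exists>K. bnd al K D"
    unfolding D_def using int_bnd[OF admDD'] bnd_add[OF C_bnd] by blast
  obtain KW KL KD where KK: "bnd al KW W" "bnd al KL L" "bnd al KD D"
    using W_bnd L_bnd D_bnd by blast
  define KM where "KM = Max {KW, KL, KD, K, KZ}"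
  have bnds: "\<forall>f\<in>{W, L, D, u 0, u 1, Z, u 5}. bnd al KM f"
    using bnd_mono[OF KK(1)] bnd_mono[OF KK(2)] bnd_mono[OF KK(3)] bnd_mono[OF ub] bnd_mono[OF KZ] al
    by (auto simp: KM_def)
  have Zreg: "reg Z" using KZ bnd_reg by blast
  have main: "th W z = L z - C a * W z \<and> th L z = D z - C (a - 1) * L z \<and>
       th (u 0) z = u 1 z - C a * u 0 z \<and>
       fps_deriv (W z) = u 0 z \<and> fps_deriv (L z) = u 1 z \<and> fps_deriv (u 0 z) = Z z \<and>
       D z * Z z = u 1 z * u 1 z + u 5 z \<and>
       fps_deriv (u 5 z) * ((1 + T z * L z) * (1 + T z * W z)) =
         u 5 z * T z * (C q * (u 0 z * (1 + T z * L z)) - C (real m) * (u 1 z * (1 + T z * W z))) \<and>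
       fps_nth (W z) 0 = of_real c \<and> fps_nth (L z) 0 = of_real (a * c) \<and>
       fps_nth (D z) 0 = of_real (a * (a - 1) * c) \<and>
       fps_nth (u 5 z) 0 = e0 z" if z: "z \<in> lhp" for z
  proof (intro conjI)
    have u0eq: "u 0 w = fps_integral0 (Z w)" for w
      using ueq[of 0 w] by (simp add: u0_def Phi_def Z_def)
    have u1eq: "u 1 w = fps_integral0 (th Z w + C a * Z w)" for w
      using ueq[of 1 w] by (simp add: u0_def Phi_def Z_def)
    have int_add: "fps_integral0 (f + g) = fps_integral0 f + fps_integral0 g" for f g :: "complex fps"
    proof (rule fps_ext)
      fix k show "fps_nth (fps_integral0 (f + g)) k = fps_nth (fps_integral0 f + fps_integral0 g) k"
        by (cases k) (auto simp: distrib_left simp del: of_nat_Suc)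
    qed
    have int_diff: "fps_integral0 (f - g) = fps_integral0 f - fps_integral0 g" for f g :: "complex fps"
      using int_add[of "f - g" g] by simp
    have int_C: "fps_integral0 (C r * f) = C r * fps_integral0 f" for r and f :: "complex fps"
    proof (rule fps_ext)
      fix k show "fps_nth (fps_integral0 (C r * f)) k = fps_nth (C r * fps_integral0 f) k"
        by (cases k) (auto simp: C_def mult_ac simp del: of_nat_Suc)
    qed
    \<comment> \<open>The system does not impose \<open>X = (\<theta> + a) W_t\<close>. It holds
      because both sides are integrals in \<open>t\<close> of \<open>(\<theta> + a) Z\<close>, as
      \<open>th\<close> commutes with the integral; the relation between \<open>L\<close> and
      \<open>W\<close> follows by one more integration.\<close>
    have thu0: "th (u 0) w = u 1 w - C a * u 0 w" if w: "w \<in> lhp" for w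
    proof -
      have "th (u 0) w = th (\<lambda>w. fps_integral0 (Z w)) w" using u0eq by presburger
      also have "\<dots> = fps_integral0 (th Z w)" using th_integral[OF Zreg w] .
      also have "\<dots> = u 1 w - C a * u 0 w" unfolding u1eq u0eq int_add int_C by simp
      finally show ?thesis .
    qed
    show "th (u 0) z = u 1 z - C a * u 0 z" using thu0[OF z] .
    have CC: "C r * C s = C (r * s)" "C r + C s = C (r + s)" "C r - C s = C (r - s)" for r s
      by (simp_all add: C_def)
    have creg: "reg (\<lambda>z. C r)" for r using C_bnd bnd_reg by blast
    have ireg: "reg (\<lambda>z. fps_integral0 (u i z))" for i using reg_integral[OF ureg] .
    have "th W z = fps_integral0 (th (u 0) z)"
      using th_add[OF creg ireg z] th_integral[OF ureg z] unfolding W_def by simp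
    also have "\<dots> = fps_integral0 (u 1 z - C a * u 0 z)"
      using thu0[OF z] by simp
    also have "\<dots> = L z - C a * W z"
      unfolding int_diff int_C L_def W_def by (simp add: CC distrib_left)
    finally show "th W z = L z - C a * W z" .
    have "th L z = fps_integral0 (th (u 1) z)"
      using th_add[OF creg ireg z] th_integral[OF ureg z] unfolding L_def by simp
    also have "\<dots> = D z - C (a - 1) * L z"
      unfolding D_def L_def int_add int_C by (simp add: CC distrib_left mult_ac)
    finally show "th L z = D z - C (a - 1) * L z" .
    show dW: "fps_deriv (W z) = u 0 z" by (simp add: W_def fps_deriv_fps_integral C_def)
    show dL: "fps_deriv (L z) = u 1 z" by (simp add: L_def fps_deriv_fps_integral C_def)
    show "fps_deriv (u 0 z) = Z z" by (simp add: u0eq fps_deriv_fps_integral)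
    have duI: "fps_deriv (u i z) = Phi u i z" if "\<exists>w. u0 i z = fps_const w" for i
      using that by (subst ueq) (auto simp: fps_deriv_fps_integral)
    have Cm: "C (-1) * f = - f" for f
      by (rule fps_ext) (simp add: C_def)
    have Cneg: "C (- r) * f = - (C r * f)" for r f
      by (rule fps_ext) (simp add: C_def)
    have dD: "fps_deriv (D z) = th (u 1) z + C (a - 1) * u 1 z"
      by (simp add: D_def fps_deriv_fps_integral C_def)
    have dTL: "fps_deriv (1 + T z * L z) = T z * u 1 z" by (simp add: T_def dL)
    have dTW: "fps_deriv (1 + T z * W z) = T z * u 0 z" by (simp add: T_def dW)
    have "u 2 z * D z = 1"
    proof (rule riccati_inverse)
      have "\<exists>w. u0 2 z = fps_const w" by (simp add: u0_def C_def)
      from duI[OF this] show "fps_deriv (u 2 z) = - (u 2 z * (u 2 z * fps_deriv (D z)))"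
        by (simp add: Phi_def dD Cm)
      have "fps_nth (u 2 z) 0 = of_real (1 / (a * (a - 1) * c))"
        by (subst ueq) (simp add: u0_def C_def)
      then show "fps_nth (u 2 z) 0 * fps_nth (D z) 0 = 1"
        using a by (simp add: D_def C_def)
    qed
    then show "D z * Z z = u 1 z * u 1 z + u 5 z"
      by (simp add: Z_def ZZ_def mult.assoc [symmetric] mult.commute)
    have n0_inv: "n0 d z * (1 + tau z * complex_of_real d) = 1" if "0 \<le> d" "d \<le> 1 / 2" for d
      using lower[OF z that] by (auto simp: n0_def)
    have N: "u 3 z * (1 + T z * L z) = 1"
    proof (rule riccati_inverse)
      have "\<exists>w. u0 3 z = fps_const w" by (simp add: u0_def)
      from duI[OF this] show "fps_deriv (u 3 z) = - (u 3 z * (u 3 z * fps_deriv (1 + T z * L z)))"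
        unfolding dTL by (simp add: Phi_def Cm mult_ac)
      have "fps_nth (u 3 z) 0 = n0 (a * c) z"
        by (subst ueq) (simp add: u0_def)
      then show "fps_nth (u 3 z) 0 * fps_nth (1 + T z * L z) 0 = 1"
        using n0_inv[OF a(6,7)] by (simp add: L_def C_def T_def)
    qed
    have M: "u 4 z * (1 + T z * W z) = 1"
    proof (rule riccati_inverse)
      have "\<exists>w. u0 4 z = fps_const w" by (simp add: u0_def)
      from duI[OF this] show "fps_deriv (u 4 z) = - (u 4 z * (u 4 z * fps_deriv (1 + T z * W z)))"
        unfolding dTW by (simp add: Phi_def Cm mult_ac)
      have "fps_nth (u 4 z) 0 = n0 c z"
        by (subst ueq) (simp add: u0_def)
      then show "fps_nth (u 4 z) 0 * fps_nth (1 + T z * W z) 0 = 1"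
        using n0_inv[OF a(5,4)] by (simp add: W_def C_def T_def)
    qed
    have "\<exists>w. u0 5 z = fps_const w" by (simp add: u0_def)
    from duI[OF this] have dE: "fps_deriv (u 5 z) =
        T z * (u 5 z * (C q * (u 4 z * u 0 z) - C (real m) * (u 3 z * u 1 z)))"
      by (simp add: Phi_def Cneg)
    have "fps_deriv (u 5 z) * ((1 + T z * L z) * (1 + T z * W z)) =
        T z * u 5 z * (C q * u 0 z * (1 + T z * L z) * (u 4 z * (1 + T z * W z))
          - C (real m) * u 1 z * (1 + T z * W z) * (u 3 z * (1 + T z * L z)))"
      unfolding dE by (simp only: right_diff_distrib left_diff_distrib mult_ac)
    then show "fps_deriv (u 5 z) * ((1 + T z * L z) * (1 + T z * W z)) =
         u 5 z * T z * (C q * (u 0 z * (1 + T z * L z)) - C (real m) * (u 1 z * (1 + T z * W z)))"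
      unfolding N M by (simp add: mult_ac)
    show "fps_nth (W z) 0 = of_real c" by (simp add: W_def C_def)
    show "fps_nth (L z) 0 = of_real (a * c)" by (simp add: L_def C_def)
    show "fps_nth (D z) 0 = of_real (a * (a - 1) * c)" by (simp add: D_def C_def)
    show "fps_nth (u 5 z) 0 = e0 z" by (subst ueq) (simp add: u0_def)
  qed
  show ?thesis
    by (rule exI[of _ al], rule exI[of _ KM], rule exI[of _ W], rule exI[of _ L], rule exI[of _ D],
        rule exI[of _ "u 0"], rule exI[of _ "u 1"], rule exI[of _ Z], rule exI[of _ "u 5"],
        rule conjI[OF al], rule conjI[OF bnds], rule ballI, rule main[unfolded e0_def n0_def])
qed

section \<open>The profile\<close>

text \<open>Under this condition \<open>reval\<close> is additive, multiplicative and compatible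
  with \<open>fps_deriv\<close>, so that identities between complex series turn into identities
  between real functions of \<open>t\<close>.\<close>

definition realfps :: "real \<Rightarrow> complex fps \<Rightarrow> bool" where
  "realfps t F \<longleftrightarrow> (\<forall>k. fps_nth F k \<in> \<real>) \<and> ereal \<bar>t\<bar> < fps_conv_radius F"

definition reval :: "complex fps \<Rightarrow> real \<Rightarrow> real" where
  "reval F t = Re (eval_fps F (complex_of_real t))"

lemma realfps_sums:
  assumes "realfps t F"
  shows "(\<lambda>k. Re (fps_nth F k) * t ^ k) sums reval F t"
proof -
  have "(\<lambda>k. fps_nth F k * of_real t ^ k) sums eval_fps F (of_real t)"
    using assms by (intro sums_eval_fps) (simp add: realfps_def)
  then have "(\<lambda>k. Re (fps_nth F k * of_real t ^ k)) sums Re (eval_fps F (of_real t))"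
    by (rule sums_Re)
  then show ?thesis by (simp add: reval_def flip: of_real_power)
qed

lemma eval_reval:
  assumes "realfps t F"
  shows "eval_fps F (complex_of_real t) = of_real (reval F t)"
proof -
  have 1: "(\<lambda>k. fps_nth F k * of_real t ^ k) sums eval_fps F (of_real t)"
    using assms by (intro sums_eval_fps) (simp add: realfps_def)
  have 2: "fps_nth F k * of_real t ^ k = of_real (Re (fps_nth F k) * t ^ k)" for k
    using assms by (simp add: realfps_def)
  have "(\<lambda>k. complex_of_real (Re (fps_nth F k) * t ^ k)) sums of_real (reval F t)"
    using sums_of_real[OF realfps_sums[OF assms]] .
  with 1 show ?thesis unfolding 2 using sums_unique2 by blast
qed

lemma realfps_add:
  assumes "realfps t F" "realfps t G"
  shows "realfps t (F + G)"
proof -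
  have "ereal \<bar>t\<bar> < min (fps_conv_radius F) (fps_conv_radius G)"
    using assms by (simp add: realfps_def)
  also have "\<dots> \<le> fps_conv_radius (F + G)" by (rule fps_conv_radius_add)
  finally show ?thesis using assms
    by (simp add: realfps_def)
qed

lemma realfps_diff:
  assumes "realfps t F" "realfps t G"
  shows "realfps t (F - G)"
proof -
  have "ereal \<bar>t\<bar> < min (fps_conv_radius F) (fps_conv_radius G)"
    using assms by (simp add: realfps_def)
  also have "\<dots> \<le> fps_conv_radius (F - G)" by (rule fps_conv_radius_diff)
  finally show ?thesis using assms
    by (simp add: realfps_def)
qed

lemma realfps_mult:
  assumes "realfps t F" "realfps t G"
  shows "realfps t (F * G)"
proof -
  have "ereal \<bar>t\<bar> < min (fps_conv_radius F) (fps_conv_radius G)"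
    using assms by (simp add: realfps_def)
  also have "\<dots> \<le> fps_conv_radius (F * G)" by (rule fps_conv_radius_mult)
  finally show ?thesis using assms
    unfolding realfps_def fps_mult_nth by (intro conjI allI sum_in_Reals Reals_mult) auto
qed

lemma realfps_const: "realfps t (fps_const (of_real c))"
  unfolding realfps_def by auto

lemma realfps_1: "realfps t 1"
  using realfps_const[of t 1] by simp

lemma realfps_deriv:
  assumes "realfps t F"
  shows "realfps t (fps_deriv F)"
proof -
  have "ereal \<bar>t\<bar> < fps_conv_radius F" using assms by (simp add: realfps_def)
  also have "\<dots> \<le> fps_conv_radius (fps_deriv F)" by (rule fps_conv_radius_deriv)
  finally show ?thesis using assms by (simp add: realfps_def)
qed

lemma reval_add: "realfps t F \<Longrightarrow> realfps t G \<Longrightarrow> reval (F + G) t = reval F t + reval G t"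
  unfolding reval_def by (subst eval_fps_add) (auto simp: realfps_def)

lemma reval_diff: "realfps t F \<Longrightarrow> realfps t G \<Longrightarrow> reval (F - G) t = reval F t - reval G t"
  unfolding reval_def by (subst eval_fps_diff) (auto simp: realfps_def)

lemma reval_mult:
  assumes "realfps t F" "realfps t G"
  shows "reval (F * G) t = reval F t * reval G t"
proof -
  have "eval_fps (F * G) (of_real t) = eval_fps F (of_real t) * eval_fps G (of_real t)"
    using assms by (intro eval_fps_mult) (auto simp: realfps_def)
  also have "\<dots> = of_real (reval F t * reval G t)"
    by (simp only: eval_reval[OF assms(1)] eval_reval[OF assms(2)] of_real_mult)
  finally show ?thesis by (simp only: reval_def Re_complex_of_real)
qed

lemma reval_const [simp]: "reval (fps_const (of_real c)) t = c"
  by (simp add: reval_def)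

lemma reval_1 [simp]: "reval 1 t = 1"
  by (simp add: reval_def)

lemma reval_0: "reval F 0 = Re (fps_nth F 0)"
  by (simp add: reval_def eval_fps_at_0)

lemma reval_deriv:
  assumes "realfps t F"
  shows "(reval F has_real_derivative reval (fps_deriv F) t) (at t)"
proof -
  have "(eval_fps F has_field_derivative eval_fps (fps_deriv F) (of_real t)) (at (of_real t))"
    using assms by (intro has_field_derivative_eval_fps) (simp add: realfps_def)
  then have "((\<lambda>x. eval_fps F (of_real x)) has_vector_derivative eval_fps (fps_deriv F) (of_real t)) (at t)"
    by (rule has_vector_derivative_real_field)
  then have "((\<lambda>x. Re (eval_fps F (of_real x))) has_vector_derivative Re (eval_fps (fps_deriv F) (of_real t))) (at t)"
    by (rule bounded_linear.has_vector_derivative[OF bounded_linear_Re])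
  then show ?thesis
    by (simp add: reval_def[abs_def] has_real_derivative_iff_has_vector_derivative)
qed

section \<open>From holomorphic families to functions of two real variables\<close>

definition ev :: "fser \<Rightarrow> real \<Rightarrow> real \<Rightarrow> real" where
  "ev f x t = reval (f (complex_of_real x)) t"

lemma bdist_ge_half: "x < - 1 / 2 \<Longrightarrow> 1 / 2 \<le> bdist (complex_of_real x)"
  by (simp add: bdist_def)

text \<open>Left of \<open>-1/2\<close> the weight \<open>bdist\<close> is at least 1/2, so the
  coefficients grow at most like \<open>(2 * al) ^ k\<close>, uniformly up to
  \<open>x = -\<infinity>\<close>, that is, up to the interface \<open>s = 0\<close>.\<close>

lemma bnd_coeff:
  assumes "bnd al K f" "0 < al" "x < - 1 / 2"
  shows "norm (fps_nth (f (complex_of_real x)) k) \<le> K * (2 * al) ^ k / (real k + 1)^2"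
proof -
  let ?F = "norm (fps_nth (f (complex_of_real x)) k)"
  have "?F * (1 / 2) ^ k \<le> ?F * bdist (of_real x) ^ k"
    using bdist_ge_half[OF assms(3)] by (intro mult_left_mono power_mono) auto
  also have "\<dots> \<le> K * al ^ k / (real k + 1)^2"
    using assms by (auto simp: bnd_def lhp_def)
  finally have "?F * (1 / 2) ^ k * 2 ^ k \<le> K * al ^ k / (real k + 1)^2 * 2 ^ k"
    by (intro mult_right_mono) auto
  then show ?thesis by (simp add: power_mult_distrib power_one_over mult_ac)
qed

lemma bnd_coeff':
  assumes "bnd al K f" "0 < al" "x < - 1 / 2"
  shows "norm (fps_nth (f (complex_of_real x)) k) \<le> K * (2 * al) ^ k"
proof -
  have "K * (2 * al) ^ k / (real k + 1)^2 \<le> K * (2 * al) ^ k"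
  proof -
    have "K * (2 * al) ^ k / (real k + 1)^2 \<le> K * (2 * al) ^ k / 1"
      using bnd_nonneg[OF assms(1)] assms(2) by (intro divide_left_mono) auto
    then show ?thesis by simp
  qed
  then show ?thesis using bnd_coeff[OF assms] order_trans by blast
qed

lemma dbnd_coeff:
  assumes "dbnd al K f" "0 < al" "x < - 1 / 2"
  shows "norm (fps_nth (f (complex_of_real x)) k) \<le> 2 * K * (2 * al) ^ k"
proof -
  let ?F = "norm (fps_nth (f (complex_of_real x)) k)"
  have "?F * (1 / 2) ^ Suc k \<le> ?F * bdist (of_real x) ^ Suc k"
    using bdist_ge_half[OF assms(3)] by (intro mult_left_mono power_mono) auto
  also have "\<dots> \<le> K * al ^ k / (real k + 1)"
    using assms by (auto simp: dbnd_def lhp_def simp del: power_Suc)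
  also have "\<dots> \<le> K * al ^ k"
  proof -
    have "K * al ^ k / (real k + 1) \<le> K * al ^ k / 1"
      using dbnd_nonneg[OF assms(1)] assms(2) by (intro divide_left_mono) auto
    then show ?thesis by simp
  qed
  finally have "?F * (1 / 2) ^ Suc k * 2 ^ Suc k \<le> K * al ^ k * 2 ^ Suc k"
    by (intro mult_right_mono) auto
  then show ?thesis by (simp add: power_mult_distrib power_one_over mult_ac)
qed

text \<open>The series converges at least up to \<open>1 / (4 * al)\<close>. The smaller range for
  \<open>t\<close> leaves room for termwise differentiation with geometric majorants.\<close>

lemma realfps_coeff:
  assumes "\<And>k. norm (fps_nth F k) \<le> B * (2 * al) ^ k" "\<And>k. fps_nth F k \<in> \<real>" "0 < al" "\<bar>t\<bar> < 1 / (8 * al)"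
  shows "realfps t F"
proof -
  let ?r = "1 / (4 * al)"
  have "summable (\<lambda>k. fps_nth F k * complex_of_real ?r ^ k)"
  proof (rule summable_comparison_test')
    show "summable (\<lambda>k. B * (1 / 2) ^ k :: real)"
      by (intro summable_mult summable_geometric) auto
    fix k :: nat
    have "norm (fps_nth F k * complex_of_real ?r ^ k) \<le> (B * (2 * al) ^ k) * ?r ^ k"
      using assms by (auto simp: norm_mult norm_power norm_divide intro!: mult_mono)
    also have "\<dots> = B * (2 * al * ?r) ^ k" by (simp only: power_mult_distrib mult.assoc)
    also have "2 * al * ?r = 1 / 2" using assms(3) by simp
    finally show "norm (fps_nth F k * complex_of_real ?r ^ k) \<le> B * (1 / 2) ^ k" .
  qed
  then have "ereal (norm (complex_of_real ?r)) \<le> fps_conv_radius F"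
    unfolding fps_conv_radius_def by (rule conv_radius_geI)
  moreover have "norm (complex_of_real ?r) = ?r" using assms(3) by (simp add: norm_divide norm_mult)
  ultimately have "ereal ?r \<le> fps_conv_radius F" by simp
  moreover have "1 / (8 * al) \<le> ?r"
    using assms(3) by (intro divide_left_mono) auto
  then have "ereal \<bar>t\<bar> < ereal ?r" using assms(4) by simp
  ultimately show ?thesis unfolding realfps_def using assms(2) less_le_trans by blast
qed

lemma bnd_realfps:
  assumes "bnd al K f" "0 < al" "x < - 1 / 2" "\<bar>t\<bar> < 1 / (8 * al)"
  shows "realfps t (f (complex_of_real x))"
  using assms(3) by (intro realfps_coeff[OF bnd_coeff'[OF assms(1-3)] _ assms(2,4)])
    (simp add: reg_real[OF bnd_reg[OF assms(1)]])

text \<open>The tail of the series is geometric and starts with a factor \<open>t\<close>.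
  Uniformity in \<open>x\<close> is what carries the signs of the initial data over to all
  \<open>s\<close> at once.\<close>

lemma ev_near:
  assumes "bnd al K f" "0 < al" "x < - 1 / 2" "\<bar>t\<bar> < 1 / (8 * al)"
  shows "\<bar>ev f x t - Re (fps_nth (f (complex_of_real x)) 0)\<bar> \<le> 4 * K * al * \<bar>t\<bar>"
proof -
  let ?F = "f (complex_of_real x)" and ?y = "2 * al * \<bar>t\<bar>"
  have K: "0 \<le> K" using bnd_nonneg[OF assms(1)] .
  have y: "0 \<le> ?y" "?y < 1 / 2" using assms by (auto simp: field_simps)
  have "(\<lambda>k. Re (fps_nth ?F k) * t ^ k) sums ev f x t"
    unfolding ev_def by (rule realfps_sums[OF bnd_realfps[OF assms]])
  then have s1: "(\<lambda>k. Re (fps_nth ?F (Suc k)) * t ^ Suc k) sums (ev f x t - Re (fps_nth ?F 0))"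
    by (subst sums_Suc_iff) simp
  have s2: "(\<lambda>k. K * ?y * ?y ^ k) sums (K * ?y * (1 / (1 - ?y)))"
    using y by (intro sums_mult geometric_sums) auto
  have "norm (ev f x t - Re (fps_nth ?F 0)) \<le> K * ?y * (1 / (1 - ?y))"
  proof (rule norm_sums_le[OF s1 s2])
    fix k
    have "norm (Re (fps_nth ?F (Suc k)) * t ^ Suc k) \<le> (K * (2 * al) ^ Suc k) * \<bar>t\<bar> ^ Suc k"
      unfolding real_norm_def abs_mult power_abs
      by (intro mult_right_mono order_trans[OF abs_Re_le_cmod] bnd_coeff'[OF assms(1-3)]) auto
    also have "\<dots> = K * ?y * ?y ^ k" by (simp add: power_mult_distrib mult_ac)
    finally show "norm (Re (fps_nth ?F (Suc k)) * t ^ Suc k) \<le> K * ?y * ?y ^ k" .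
  qed
  also have "\<dots> \<le> K * ?y * 2"
    using y K by (intro mult_left_mono) (auto simp: field_simps)
  finally show ?thesis by (simp add: mult_ac)
qed

lemma ev_bound:
  assumes "bnd al K f" "0 < al" "x < - 1 / 2" "\<bar>t\<bar> < 1 / (8 * al)"
  shows "\<bar>ev f x t\<bar> \<le> 2 * K"
proof -
  have "4 * K * al * \<bar>t\<bar> \<le> 4 * K * al * (1 / (8 * al))"
    using assms bnd_nonneg[OF assms(1)] by (intro mult_left_mono) auto
  also have "\<dots> \<le> K" using assms(2) bnd_nonneg[OF assms(1)] by simp
  finally have 1: "\<bar>ev f x t - Re (fps_nth (f (complex_of_real x)) 0)\<bar> \<le> K"
    using ev_near[OF assms] by linarith
  have "\<bar>Re (fps_nth (f (complex_of_real x)) 0)\<bar> \<le> K"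
    using order_trans[OF abs_Re_le_cmod bnd_coeff'[OF assms(1-3), of 0]] by simp
  with 1 show ?thesis by linarith
qed

text \<open>Termwise differentiation in both variables: for
  \<open>\<bar>t\<bar> < 1 / (8 * al)\<close> the terms of both differentiated series are dominated
  by constant multiples of \<open>(1/4) ^ i\<close>.\<close>

lemma ev_has_derivative:
  assumes f: "bnd al K f" and al: "0 < al" and x: "x < - 1 / 2" and t: "\<bar>t\<bar> < 1 / (8 * al)"
  shows "((\<lambda>p. ev f (fst p) (snd p)) has_derivative
    (\<lambda>h. ev (th f) x t * fst h + ev (\<lambda>z. fps_deriv (f z)) x t * snd h)) (at (x, t))"
proof -
  define r where "r = 1 / (8 * al)"
  define S where "S = {..< - 1 / 2 :: real} \<times> {- r <..< r}"
  have r: "0 < r" "al * r = 1 / 8" using al by (auto simp: r_def)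
  have S: "convex S" "open S" "(x, t) \<in> S"
    using x t by (auto simp: S_def r_def open_Times intro!: convex_Times)
  have memS: "fst p < - 1 / 2" "\<bar>snd p\<bar> < 1 / (8 * al)" if "p \<in> S" for p
    using that by (auto simp: S_def r_def)
  have K: "0 \<le> K" using bnd_nonneg[OF f] .
  define A where "A i p = Re (fps_nth (th f (of_real (fst p))) i) * snd p ^ i" for i and p :: "real \<times> real"
  \<comment> \<open>For \<open>i = 0\<close> the factor \<open>real i\<close> removes the term, so
    the truncated exponent \<open>i - 1\<close> does no harm.\<close>
  define B where "B i p = Re (fps_nth (f (of_real (fst p))) i) * (real i * snd p ^ (i - 1))" for i and p :: "real \<times> real"
  define g where "g i p = Re (fps_nth (f (of_real (fst p))) i) * snd p ^ i" for i and p :: "real \<times> real"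
  have pow: "\<bar>snd p\<bar> ^ i \<le> r ^ i" if "p \<in> S" for p i
    using memS(2)[OF that] by (intro power_mono) (auto simp: r_def)
  have A_le: "norm (A i p) \<le> 12 * K * (1 / 4) ^ i" if p: "p \<in> S" for i p
  proof -
    have "norm (A i p) \<le> (2 * (6 * K) * (2 * al) ^ i) * r ^ i"
      unfolding A_def real_norm_def abs_mult power_abs
      using K r al
      by (intro mult_mono order_trans[OF abs_Re_le_cmod] dbnd_coeff[OF dbnd_th[OF f]] al memS[OF p] pow[OF p]) auto
    also have "\<dots> = 12 * K * (2 * (al * r)) ^ i" by (simp add: power_mult_distrib mult_ac)
    finally show ?thesis by (simp add: r(2))
  qed
  have B_le: "norm (B i p) \<le> K * 8 * al * (1 / 4) ^ i" if p: "p \<in> S" for i p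
  proof (cases i)
    case 0
    then show ?thesis using K al by (simp add: B_def)
  next
    case (Suc j)
    have "norm (B i p) \<le> (K * (2 * al) ^ i / (real i + 1)^2) * (real i * r ^ j)"
      unfolding B_def real_norm_def abs_mult power_abs Suc
      using K r al
      by (intro mult_mono order_trans[OF abs_Re_le_cmod] bnd_coeff[OF f] al memS[OF p] pow[OF p]) (auto simp: pow[OF p])
    also have "\<dots> = K * (2 * al) ^ i * r ^ j * (real i / (real i + 1)^2)" by simp
    also have "\<dots> \<le> K * (2 * al) ^ i * r ^ j * 1"
      using K r al by (intro mult_left_mono) (auto simp: divide_le_eq power2_eq_square algebra_simps)
    also have "\<dots> = K * (2 * al) * (2 * (al * r)) ^ j" by (simp add: Suc power_mult_distrib mult_ac)
    also have "\<dots> = K * 8 * al * (1 / 4) ^ i" unfolding r(2) by (simp add: Suc)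
    finally show ?thesis .
  qed
  have sumA: "uniform_limit S (\<lambda>n p. \<Sum>i<n. A i p) (\<lambda>p. \<Sum>i. A i p) sequentially"
    by (rule Weierstrass_m_test[OF A_le]) (auto intro!: summable_mult summable_geometric)
  have sumB: "uniform_limit S (\<lambda>n p. \<Sum>i<n. B i p) (\<lambda>p. \<Sum>i. B i p) sequentially"
    by (rule Weierstrass_m_test[OF B_le]) (auto intro!: summable_mult summable_geometric)
  have g_deriv: "(g n has_derivative (\<lambda>h. A n p * fst h + B n p * snd h)) (at p within S)" if p: "p \<in> S" for n p
  proof -
    have z: "complex_of_real (fst p) \<in> lhp" using memS(1)[OF p] by (simp add: lhp_def)
    have "((\<lambda>w. fps_nth (f w) n) has_field_derivative fps_nth (th f (of_real (fst p))) n) (at (of_real (fst p)))"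
      unfolding th_nth using reg_holo[OF bnd_reg[OF f]] holomorphic_derivI open_lhp z by blast
    then have "((\<lambda>y. fps_nth (f (of_real y)) n) has_vector_derivative fps_nth (th f (of_real (fst p))) n) (at (fst p))"
      by (rule has_vector_derivative_real_field)
    then have "((\<lambda>y. Re (fps_nth (f (of_real y)) n)) has_vector_derivative Re (fps_nth (th f (of_real (fst p))) n)) (at (fst p))"
      by (rule bounded_linear.has_vector_derivative[OF bounded_linear_Re])
    then have 1: "((\<lambda>y. Re (fps_nth (f (of_real y)) n)) has_derivative (\<lambda>h. h * Re (fps_nth (th f (of_real (fst p))) n))) (at (fst p))"
      by (simp add: has_vector_derivative_def)
    have 2: "((\<lambda>p. Re (fps_nth (f (of_real (fst p))) n)) has_derivative
        (\<lambda>h. fst h * Re (fps_nth (th f (of_real (fst p))) n))) (at p within S)"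
      by (rule has_derivative_compose[of fst fst, OF _ 1]) (auto intro!: derivative_intros)
    have "(g n has_derivative (\<lambda>h. Re (fps_nth (f (of_real (fst p))) n) * (real n * snd h * snd p ^ (n - 1))
          + fst h * Re (fps_nth (th f (of_real (fst p))) n) * snd p ^ n)) (at p within S)"
      unfolding g_def[abs_def] by (intro has_derivative_mult 2 has_derivative_power) (auto intro!: derivative_intros)
    then show ?thesis by (rule has_derivative_eq_rhs) (auto simp: A_def B_def algebra_simps)
  qed
  have "\<exists>G. \<forall>p\<in>S. (\<lambda>n. g n p) sums G p \<and>
      (G has_derivative (\<lambda>h. (\<Sum>i. A i p) * fst h + (\<Sum>i. B i p) * snd h)) (at p within S)"
  proof (rule has_derivative_series[OF S(1) g_deriv _ S(3)])
    fix e :: real assume e: "0 < e"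
    have "\<forall>\<^sub>F n in sequentially. \<forall>p\<in>S. dist (\<Sum>i<n. A i p) (\<Sum>i. A i p) < e / 2"
      using sumA half_gt_zero[OF e] unfolding uniform_limit_iff by blast
    moreover have "\<forall>\<^sub>F n in sequentially. \<forall>p\<in>S. dist (\<Sum>i<n. B i p) (\<Sum>i. B i p) < e / 2"
      using sumB half_gt_zero[OF e] unfolding uniform_limit_iff by blast
    ultimately show "\<forall>\<^sub>F n in sequentially. \<forall>p\<in>S. \<forall>h. norm ((\<Sum>i<n. A i p * fst h + B i p * snd h)
        - ((\<Sum>i. A i p) * fst h + (\<Sum>i. B i p) * snd h)) \<le> e * norm h"
    proof eventually_elim
      case (elim n)
      show ?case
      proof (intro ballI allI)
        fix p h assume p: "p \<in> S"
        let ?a = "(\<Sum>i<n. A i p) - (\<Sum>i. A i p)" and ?b = "(\<Sum>i<n. B i p) - (\<Sum>i. B i p)"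
        have "\<bar>?a * fst h + ?b * snd h\<bar> \<le> \<bar>?a\<bar> * \<bar>fst h\<bar> + \<bar>?b\<bar> * \<bar>snd h\<bar>"
          by (metis abs_mult abs_triangle_ineq)
        also have "\<dots> \<le> e / 2 * norm h + e / 2 * norm h"
          using e elim p norm_fst_le[of "fst h" "snd h"] norm_snd_le[of "snd h" "fst h"]
          by (intro add_mono mult_mono) (auto simp: dist_real_def less_imp_le)
        finally show "norm ((\<Sum>i<n. A i p * fst h + B i p * snd h)
          - ((\<Sum>i. A i p) * fst h + (\<Sum>i. B i p) * snd h)) \<le> e * norm h"
          unfolding real_norm_def sum.distrib sum_distrib_right [symmetric] by (simp add: algebra_simps)
      qed
    qed
  next
    show "(\<lambda>n. g n (x, t)) sums ev f x t"
      unfolding g_def ev_def using realfps_sums[OF bnd_realfps[OF f al x t]] by simp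
  qed
  then obtain G where G: "\<And>p. p \<in> S \<Longrightarrow> (\<lambda>n. g n p) sums G p"
    "(G has_derivative (\<lambda>h. (\<Sum>i. A i (x, t)) * fst h + (\<Sum>i. B i (x, t)) * snd h)) (at (x, t) within S)"
    using S(3) by blast
  have Gev: "ev f (fst p) (snd p) = G p" if "p \<in> S" for p
  proof -
    have "(\<lambda>n. g n p) sums ev f (fst p) (snd p)"
      unfolding g_def ev_def using realfps_sums[OF bnd_realfps[OF f al memS[OF that]]] by simp
    then show ?thesis using G(1)[OF that] sums_unique2 by blast
  qed
  have rf: "realfps t (f (of_real x))" using bnd_realfps[OF f al x t] .
  have rth: "realfps t (th f (of_real x))"
    using x by (intro realfps_coeff[OF dbnd_coeff[OF dbnd_th[OF f] al x] _ al t])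
      (simp add: reg_real[OF reg_th[OF bnd_reg[OF f]]])
  have A_eq: "(\<Sum>i. A i (x, t)) = ev (th f) x t"
    unfolding A_def ev_def using realfps_sums[OF rth] by (simp add: sums_iff)
  have "(\<lambda>i. B (Suc i) (x, t)) sums ev (\<lambda>z. fps_deriv (f z)) x t"
    using realfps_sums[OF realfps_deriv[OF rf]] unfolding B_def ev_def
    by (simp add: mult_ac)
  then have "(\<lambda>i. B i (x, t)) sums ev (\<lambda>z. fps_deriv (f z)) x t"
    using sums_Suc_iff[of "\<lambda>i. B i (x, t)"] by (simp add: B_def)
  then have B_eq: "(\<Sum>i. B i (x, t)) = ev (\<lambda>z. fps_deriv (f z)) x t"
    by (simp add: sums_iff)
  have "(G has_derivative (\<lambda>h. ev (th f) x t * fst h + ev (\<lambda>z. fps_deriv (f z)) x t * snd h)) (at (x, t))"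
    using G(2) unfolding A_eq B_eq at_within_open[OF S(3,2)] .
  then show ?thesis
    by (rule has_derivative_transform_within_open[OF _ S(2,3)]) (simp add: Gev)
qed

text \<open>This rests on \<open>exp 1 \<le> 3 < 4\<close>. For \<open>s < 1/2\<close>, the range
  that occurs in the unit ball, the point \<open>ln s\<close> thus keeps distance 1/2 from the
  boundary of the half-plane.\<close>

lemma ln_less_neg_half:
  fixes s :: real
  assumes "0 < s" "s < 1 / 2"
  shows "ln s < - 1 / 2"
proof -
  have "exp (1 / 2 :: real) ^ 2 = exp 1" by (simp flip: exp_of_nat_mult)
  also have "\<dots> < 2 ^ 2" using exp_le by simp
  finally have "exp (1 / 2 :: real) < 2" by (rule power_less_imp_less_base) simp
  then have "1 / 2 < ln (2 :: real)" by (metis exp_less_cancel_iff exp_ln zero_less_numeral)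
  moreover have "ln s < ln (1 / 2)" using assms by simp
  moreover have "ln (1 / 2 :: real) = - ln 2" by (simp add: ln_div)
  ultimately show ?thesis by simp
qed

text \<open>The derivative of \<open>s^b F(ln s)\<close> is \<open>s^(b-1)\<close> times
  \<open>(\<theta> + b) F\<close>, whence the hypothesis on \<open>G\<close>. The cases
  \<open>b = a\<close> and \<open>b = a - 1\<close> give all derivatives of the profile up to order
  two.\<close>

lemma ev_power_has_derivative:
  assumes F: "bnd al K F" and G: "bnd al K G" and al: "0 < al"
    and thF: "\<And>z. z \<in> lhp \<Longrightarrow> th F z = G z - fps_const (complex_of_real b) * F z"
    and dF: "\<And>z. z \<in> lhp \<Longrightarrow> fps_deriv (F z) = H z"
    and s: "0 < s" "s < 1 / 2" and t: "\<bar>t\<bar> < 1 / (8 * al)"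
  shows "((\<lambda>p. fst p powr b * ev F (ln (fst p)) (snd p)) has_derivative
    (\<lambda>h. s powr (b - 1) * ev G (ln s) t * fst h + s powr b * ev H (ln s) t * snd h)) (at (s, t))"
proof -
  let ?x = "ln s"
  have x: "?x < - 1 / 2" using ln_less_neg_half[OF s] .
  then have z: "complex_of_real ?x \<in> lhp" by (simp add: lhp_def)
  have rF: "realfps t (F (of_real ?x))" and rG: "realfps t (G (of_real ?x))"
    using bnd_realfps F G al x t by blast+
  have e1: "ev (th F) ?x t = ev G ?x t - b * ev F ?x t"
    unfolding ev_def thF[OF z] using rF rG
    by (simp add: reval_diff reval_mult realfps_mult realfps_const)
  have e2: "ev (\<lambda>z. fps_deriv (F z)) ?x t = ev H ?x t"
    unfolding ev_def dF[OF z] ..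
  have dfst: "(fst has_derivative fst) (at (s, t))"
    by (rule bounded_linear_imp_has_derivative[OF bounded_linear_fst])
  have d1: "((\<lambda>p. (ln (fst p), snd p)) has_derivative (\<lambda>h. (fst h / s, snd h))) (at (s, t))"
  proof (intro has_derivative_Pair)
    have "((\<lambda>p. ln (fst p)) has_derivative (\<lambda>h. fst h * inverse s)) (at (s, t))"
      using has_derivative_compose[of fst fst "(s, t)" UNIV ln "\<lambda>h. h * inverse s"] dfst DERIV_ln[OF s(1)]
      by (simp add: has_field_derivative_def mult_commute_abs)
    then show "((\<lambda>p. ln (fst p)) has_derivative (\<lambda>h. fst h / s)) (at (s, t))"
      by (simp add: divide_inverse)
    show "(snd has_derivative snd) (at (s, t))" by (rule bounded_linear_imp_has_derivative[OF bounded_linear_snd])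
  qed
  have d2: "((\<lambda>p. ev F (fst p) (snd p)) has_derivative
      (\<lambda>h. ev (th F) ?x t * fst h + ev (\<lambda>z. fps_deriv (F z)) ?x t * snd h)) (at (?x, t))"
    using ev_has_derivative[OF F al x t] .
  have d3: "((\<lambda>p. ev F (ln (fst p)) (snd p)) has_derivative
      (\<lambda>h. (ev G ?x t - b * ev F ?x t) * (fst h / s) + ev H ?x t * snd h)) (at (s, t))"
    using has_derivative_compose[OF d1, of "\<lambda>p. ev F (fst p) (snd p)"
      "\<lambda>h. (ev G ?x t - b * ev F ?x t) * fst h + ev H ?x t * snd h"] d2 e1 e2 by simp
  have d4: "((\<lambda>p. fst p powr b) has_derivative (\<lambda>h. fst h * (b * s powr (b - 1)))) (at (s, t))"
  proof -
    have "((\<lambda>y. y powr b) has_derivative (\<lambda>h. h * (b * s powr (b - 1)))) (at s)"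
      using has_real_derivative_powr[OF s(1), of b] by (simp add: has_field_derivative_def mult_commute_abs)
    then show ?thesis
      using has_derivative_compose[of fst fst "(s, t)" UNIV "\<lambda>y. y powr b" "\<lambda>h. h * (b * s powr (b - 1))"] dfst
      by simp
  qed
  have sb: "s powr b = s * s powr (b - 1)"
    using s(1) by (simp add: powr_diff)
  have "((\<lambda>p. fst p powr b * ev F (ln (fst p)) (snd p)) has_derivative
     (\<lambda>h. s powr b * ((ev G ?x t - b * ev F ?x t) * (fst h / s) + ev H ?x t * snd h)
        + fst h * (b * s powr (b - 1)) * ev F ?x t)) (at (s, t))"
    using has_derivative_mult[OF d4 d3] by simp
  then show ?thesis
    by (rule has_derivative_eq_rhs) (use s in \<open>simp add: sb fun_eq_iff field_simps\<close>)
qed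

section \<open>Existence of the planar profile\<close>

text \<open>\<open>m = n - 2\<close>, \<open>s = \<bar>x'\<bar> - 1/2\<close> and \<open>t = x\<^sub>n\<close>; subscripts in the names denote derivatives.\<close>

definition ma_profile ::
  "nat \<Rightarrow> real \<Rightarrow> real \<Rightarrow> real \<Rightarrow> real \<Rightarrow> (real \<Rightarrow> real \<Rightarrow> real) \<Rightarrow> (real \<Rightarrow> real \<Rightarrow> real) \<Rightarrow> (real \<Rightarrow> real \<Rightarrow> real) \<Rightarrow>
   (real \<Rightarrow> real \<Rightarrow> real) \<Rightarrow> (real \<Rightarrow> real \<Rightarrow> real) \<Rightarrow> (real \<Rightarrow> real \<Rightarrow> real) \<Rightarrow> bool" where
  "ma_profile m q t1 d B V Vs Vt Vss Vst Vtt \<longleftrightarrow> 0 < t1 \<and> 0 < d \<and>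
   (\<forall>s t. 0 < s \<and> s < 1 / 2 \<and> \<bar>t\<bar> < t1 \<longrightarrow>
     ((\<lambda>p. V (fst p) (snd p)) has_derivative (\<lambda>h. Vs s t * fst h + Vt s t * snd h)) (at (s, t)) \<and>
     ((\<lambda>p. Vs (fst p) (snd p)) has_derivative (\<lambda>h. Vss s t * fst h + Vst s t * snd h)) (at (s, t)) \<and>
     ((\<lambda>p. Vt (fst p) (snd p)) has_derivative (\<lambda>h. Vst s t * fst h + Vtt s t * snd h)) (at (s, t)) \<and>
     0 < Vss s t \<and>
     Vs s t ^ m * (Vss s t * Vtt s t - (Vst s t)\<^sup>2) = (1 / 2 + s) ^ m * V s t powr q \<and>
     d * s \<le> V s t \<and> V s t \<le> B * s \<and> d \<le> Vs s t \<and> Vs s t \<le> B \<and> \<bar>Vt s t\<bar> \<le> B)"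

text \<open>The powers of \<open>s\<close> factor out and the determinant becomes
  \<open>s^q E\<close>. Since \<open>E\<close> is known only through its initial value and its
  evolution equation, its closed form is recovered from a quantity conserved in \<open>t\<close>.
  Signs and bounds come from \<open>ev_near\<close> and \<open>ev_bound\<close>, uniformly in
  \<open>s\<close>.\<close>

lemma ma_profile_exists:
  fixes q :: real and m :: nat
  assumes q: "0 < q"
  shows "\<exists>t1 B V Vs Vt Vss Vst Vtt. ma_profile m q t1 1 B V Vs Vt Vss Vst Vtt"
proof -
  define a where "a = 1 + q / 2"
  define c where "c = 1 / (2 * a)"
  define tau where "tau z = exp (complex_of_real (q / 2) * z)" for z
  define T where "T z = fps_const (tau z)" for z
  define C where "C r = fps_const (complex_of_real r)" for r
  have a: "1 < a" "0 < c" "a * c = 1 / 2" using q by (auto simp: a_def c_def)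
  from ck_series[OF q, of m, folded a_def, folded c_def, folded tau_def, folded T_def C_def]
  obtain al K W L D V X Z E where al: "0 < al"
    and bd: "\<forall>f\<in>{W, L, D, V, X, Z, E}. bnd al K f"
    and id: "\<forall>z\<in>lhp. th W z = L z - C a * W z \<and> th L z = D z - C (a - 1) * L z \<and>
       th V z = X z - C a * V z \<and>
       fps_deriv (W z) = V z \<and> fps_deriv (L z) = X z \<and> fps_deriv (V z) = Z z \<and>
       D z * Z z = X z * X z + E z \<and>
       fps_deriv (E z) * ((1 + T z * L z) * (1 + T z * W z)) =
         E z * T z * (C q * (V z * (1 + T z * L z)) - C (real m) * (X z * (1 + T z * W z))) \<and>
       fps_nth (W z) 0 = of_real c \<and> fps_nth (L z) 0 = of_real (a * c) \<and>
       fps_nth (D z) 0 = of_real (a * (a - 1) * c) \<and>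
       fps_nth (E z) 0 = (1 / 2 + exp z) ^ m * (1 / (1 + tau z * of_real (a * c))) ^ m *
          (1 + tau z * of_real c) powr of_real q"
    by blast
  have K: "0 \<le> K" using bd bnd_nonneg by blast
  \<comment> \<open>Half of the smallest initial value among \<open>W\<close>, \<open>L\<close> and
    \<open>D\<close>: a perturbation by at most \<open>eta\<close> leaves all three
    positive.\<close>
  define eta where "eta = min (c / 2) (min (a * c / 2) (a * (a - 1) * c / 2))"
  have eta: "0 < eta" "eta \<le> c / 2" "eta \<le> a * c / 2" "eta \<le> a * (a - 1) * c / 2"
    using a by (auto simp: eta_def)
  define t1 where "t1 = min (1 / (8 * al)) (eta / (4 * K * al + 1))"
  have den: "0 < 4 * K * al + 1" using K al by (simp add: add_nonneg_pos)
  have t1: "0 < t1" "t1 \<le> 1 / (8 * al)" using al eta den by (auto simp: t1_def)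
  have small: "4 * K * al * \<bar>t\<bar> \<le> eta" if "\<bar>t\<bar> < t1" for t
  proof -
    have "4 * K * al * \<bar>t\<bar> \<le> (4 * K * al + 1) * (eta / (4 * K * al + 1))"
      using that K al by (intro mult_mono) (auto simp: t1_def)
    then show ?thesis using den by simp
  qed
  define V0 where "V0 s t = s + s powr a * ev W (ln s) t" for s t
  define Vs where "Vs s t = 1 + s powr (a - 1) * ev L (ln s) t" for s t
  define Vt where "Vt s t = s powr a * ev V (ln s) t" for s t
  define Vss where "Vss s t = s powr (a - 1 - 1) * ev D (ln s) t" for s t
  define Vst where "Vst s t = s powr (a - 1) * ev X (ln s) t" for s t
  define Vtt where "Vtt s t = s powr a * ev Z (ln s) t" for s t
  have "ma_profile m q t1 1 (1 + 2 * K) V0 Vs Vt Vss Vst Vtt"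
    unfolding ma_profile_def
  proof (intro conjI allI impI t1(1); (elim conjE)?)
    fix s t :: real assume s: "0 < s" "s < 1 / 2" and tt: "\<bar>t\<bar> < t1"
    let ?x = "ln s" let ?z = "complex_of_real (ln s)"
    have x: "?x < - 1 / 2" using ln_less_neg_half[OF s] .
    then have z: "?z \<in> lhp" by (simp add: lhp_def)
    note idz = bspec[OF id z]
    have t: "\<bar>t\<bar> < 1 / (8 * al)" using tt t1 by simp
    have near: "\<bar>ev f ?x t' - Re (fps_nth (f ?z) 0)\<bar> \<le> eta"
      if "f \<in> {W, L, D, V, X, Z, E}" "\<bar>t'\<bar> < t1" for f t'
      using order_trans[OF ev_near[of al K f, OF _ al x] small[of t']] bd that t1 by auto
    have Wlow: "c / 2 \<le> ev W ?x t'" if "\<bar>t'\<bar> < t1" for t'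
      using near[of W, OF _ that] eta(2) idz by simp
    have Llow: "a * c / 2 \<le> ev L ?x t'" if "\<bar>t'\<bar> < t1" for t'
      using near[of L, OF _ that] eta(3) idz by simp
    have Dlow: "a * (a - 1) * c / 2 \<le> ev D ?x t"
      using near[of D, OF _ tt] eta(4) idz by simp
    have up: "\<bar>ev f ?x t\<bar> \<le> 2 * K" if "f \<in> {W, L, D, V, X, Z, E}" for f
      using ev_bound[of al K f, OF _ al x t] bd that by blast
    have pw: "0 < s powr a" "0 < s powr (a - 1)" "s powr a = s * s powr (a - 1)"
      "s powr (a - 1) \<le> 1" "s powr a \<le> s" "s powr a \<le> 1"
    proof -
      show "0 < s powr a" "0 < s powr (a - 1)" using s by auto
      show e: "s powr a = s * s powr (a - 1)" using s(1) by (simp add: powr_diff)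
      show l: "s powr (a - 1) \<le> 1" using s a by (intro powr_le1) auto
      show "s powr a \<le> s" unfolding e using l s by (simp add: mult_left_le)
      then show "s powr a \<le> 1" using s by simp
    qed
    have Wbd: "0 < ev W ?x t" "ev W ?x t \<le> 2 * K" using Wlow[OF tt] a up[of W] by auto
    have Lbd: "0 < ev L ?x t" "ev L ?x t \<le> 2 * K" using Llow[OF tt] a up[of L] by auto
    have D0: "0 < a * (a - 1) * c / 2" using a by simp
    show "0 < Vss s t" unfolding Vss_def using s D0 Dlow by (intro mult_pos_pos) auto
    show "1 * s \<le> V0 s t" using Wbd pw by (simp add: V0_def)
    show "1 \<le> Vs s t" using Lbd pw by (simp add: Vs_def)
    have "s powr a * ev W ?x t \<le> s * (2 * K)"
      using Wbd pw s by (intro mult_mono) auto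
    then show "V0 s t \<le> (1 + 2 * K) * s" by (simp add: V0_def algebra_simps)
    have "s powr (a - 1) * ev L ?x t \<le> 1 * (2 * K)"
      using Lbd pw by (intro mult_mono) auto
    then show "Vs s t \<le> 1 + 2 * K" by (simp add: Vs_def)
    have "s powr a * \<bar>ev V ?x t\<bar> \<le> 1 * (2 * K)"
      using up[of V] pw by (intro mult_mono) auto
    then show "\<bar>Vt s t\<bar> \<le> 1 + 2 * K" using pw by (simp add: Vt_def abs_mult)
    have idall: "\<And>z. z \<in> lhp \<Longrightarrow> th W z = L z - fps_const (complex_of_real a) * W z"
        "\<And>z. z \<in> lhp \<Longrightarrow> th L z = D z - fps_const (complex_of_real (a - 1)) * L z"
        "\<And>z. z \<in> lhp \<Longrightarrow> th V z = X z - fps_const (complex_of_real a) * V z"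
        "\<And>z. z \<in> lhp \<Longrightarrow> fps_deriv (W z) = V z" "\<And>z. z \<in> lhp \<Longrightarrow> fps_deriv (L z) = X z"
        "\<And>z. z \<in> lhp \<Longrightarrow> fps_deriv (V z) = Z z"
      using id unfolding C_def by blast+
    have bW: "bnd al K W" and bL: "bnd al K L" and bD: "bnd al K D" and bV: "bnd al K V"
      and bX: "bnd al K X" and bZ: "bnd al K Z" and bE: "bnd al K E" using bd by auto
    have dW: "((\<lambda>p. fst p powr a * ev W (ln (fst p)) (snd p)) has_derivative
      (\<lambda>h. Vs0 * fst h + Vt s t * snd h)) (at (s, t))" if "Vs0 = s powr (a - 1) * ev L ?x t" for Vs0
      using ev_power_has_derivative[OF bW bL al idall(1,4) s t] unfolding that Vt_def .
    have "((\<lambda>p. fst p + fst p powr a * ev W (ln (fst p)) (snd p)) has_derivative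
      (\<lambda>h. fst h + (s powr (a - 1) * ev L ?x t * fst h + Vt s t * snd h))) (at (s, t))"
      by (intro has_derivative_add dW[OF refl] derivative_intros)
    then show "((\<lambda>p. V0 (fst p) (snd p)) has_derivative (\<lambda>h. Vs s t * fst h + Vt s t * snd h)) (at (s, t))"
      unfolding V0_def Vs_def by (rule has_derivative_eq_rhs) (auto simp: algebra_simps)
    have "((\<lambda>p. 1 + fst p powr (a - 1) * ev L (ln (fst p)) (snd p)) has_derivative
      (\<lambda>h. 0 + (Vss s t * fst h + Vst s t * snd h))) (at (s, t))"
      unfolding Vss_def Vst_def
      by (intro has_derivative_add ev_power_has_derivative[OF bL bD al idall(2,5) s t] has_derivative_const)
    then show "((\<lambda>p. Vs (fst p) (snd p)) has_derivative (\<lambda>h. Vss s t * fst h + Vst s t * snd h)) (at (s, t))"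
      unfolding Vs_def by simp
    show "((\<lambda>p. Vt (fst p) (snd p)) has_derivative (\<lambda>h. Vst s t * fst h + Vtt s t * snd h)) (at (s, t))"
      unfolding Vt_def Vst_def Vtt_def using ev_power_has_derivative[OF bV bX al idall(3,6) s t] .
    define u where "u = s powr (a - 1)"
    have u: "0 < u" using pw by (simp add: u_def)
    have tau_u: "tau ?z = complex_of_real u"
    proof -
      have "tau ?z = complex_of_real (exp (q / 2 * ln s))"
        by (simp add: tau_def flip: exp_of_real)
      also have "exp (q / 2 * ln s) = u" using s by (simp add: u_def a_def powr_def)
      finally show ?thesis .
    qed
    have Tz: "T ?z = fps_const (complex_of_real u)" by (simp add: T_def tau_u)
    define w where "w t' = reval (W ?z) t'" for t'
    define l where "l t' = reval (L ?z) t'" for t'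
    define g where "g t' = reval (E ?z) t'" for t'
    have rf: "realfps t' (W ?z)" "realfps t' (L ?z)" "realfps t' (D ?z)" "realfps t' (V ?z)"
      "realfps t' (X ?z)" "realfps t' (Z ?z)" "realfps t' (E ?z)" if "\<bar>t'\<bar> < t1" for t'
      using bnd_realfps[OF _ al x] bW bL bD bV bX bZ bE that t1(2) by force+
    note rops = reval_add reval_diff reval_mult realfps_add realfps_diff realfps_mult realfps_const
      realfps_1 realfps_deriv
    have DZ: "ev D ?x t * ev Z ?x t = (ev X ?x t)\<^sup>2 + ev E ?x t"
    proof -
      have "reval (D ?z * Z ?z) t = reval (X ?z * X ?z + E ?z) t" using idz by simp
      then show ?thesis using rf[OF tt] by (simp add: rops ev_def power2_eq_square)
    qed
    have pos: "0 < 1 + u * l t'" "0 < 1 + u * w t'" if "\<bar>t'\<bar> < t1" for t'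
    proof -
      have "0 < l t'" using Llow[OF that] a by (simp add: l_def ev_def)
      moreover have "0 < w t'" using Wlow[OF that] a by (simp add: w_def ev_def)
      ultimately show "0 < 1 + u * l t'" "0 < 1 + u * w t'" using u by (auto intro: add_pos_pos)
    qed
    have dE: "reval (fps_deriv (E ?z)) t' * ((1 + u * l t') * (1 + u * w t')) =
        g t' * u * (q * (reval (V ?z) t' * (1 + u * l t')) - real m * (reval (X ?z) t' * (1 + u * w t')))"
      if t': "\<bar>t'\<bar> < t1" for t'
    proof -
      have "reval (fps_deriv (E ?z) * ((1 + T ?z * L ?z) * (1 + T ?z * W ?z))) t' =
         reval (E ?z * T ?z * (C q * (V ?z * (1 + T ?z * L ?z)) - C (real m) * (X ?z * (1 + T ?z * W ?z)))) t'"
        using idz by simp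
      then show ?thesis unfolding Tz C_def w_def l_def g_def
        using rf[OF t'] by (simp add: rops del: of_real_of_nat_eq)
    qed
    \<comment> \<open>At fixed \<open>s\<close> this is \<open>E (1 + u L)^m (1 + u W)^(-q)\<close>.
      The evolution equation of \<open>E\<close> says exactly that its derivative in
      \<open>t\<close> vanishes, and at \<open>t = 0\<close> it equals \<open>r^m\<close>.\<close>
    define h where "h t' = g t' * (1 + u * l t') powr real m * (1 + u * w t') powr (- q)" for t'
    have dh: "(h has_real_derivative 0) (at t')" if t': "\<bar>t'\<bar> < t1" for t'
    proof -
      have dw: "(w has_real_derivative reval (V ?z) t') (at t')"
        using reval_deriv[OF rf(1)[OF t']] idz by (simp add: w_def[abs_def])
      have dl: "(l has_real_derivative reval (X ?z) t') (at t')"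
        using reval_deriv[OF rf(2)[OF t']] idz by (simp add: l_def[abs_def])
      have dg: "(g has_real_derivative reval (fps_deriv (E ?z)) t') (at t')"
        using reval_deriv[OF rf(7)[OF t']] by (simp add: g_def[abs_def])
      let ?P = "1 + u * l t'" and ?Q = "1 + u * w t'"
      note P = pos[OF t']
      have d1: "((\<lambda>t'. (1 + u * l t') powr real m) has_real_derivative
          real m * ?P powr (real m - 1) * (u * reval (X ?z) t')) (at t')"
        using P by (auto intro!: derivative_eq_intros dl)
      have d2: "((\<lambda>t'. (1 + u * w t') powr (- q)) has_real_derivative
          (- q) * ?Q powr (- q - 1) * (u * reval (V ?z) t')) (at t')"
        using P by (auto intro!: derivative_eq_intros dw)
      have e1: "?P powr (real m - 1) = ?P powr real m / ?P" using P by (simp add: powr_diff)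
      have e2: "?Q powr (- q - 1) = ?Q powr (- q) / ?Q" using P by (simp add: powr_diff)
      have "(h has_real_derivative
          (reval (fps_deriv (E ?z)) t' * ?P powr real m
            + real m * ?P powr (real m - 1) * (u * reval (X ?z) t') * g t') * ?Q powr (- q)
          + (- q) * ?Q powr (- q - 1) * (u * reval (V ?z) t') * (g t' * ?P powr real m)) (at t')"
        unfolding h_def[abs_def] by (intro DERIV_mult dg d1 d2)
      moreover have "(reval (fps_deriv (E ?z)) t' * ?P powr real m
            + real m * ?P powr (real m - 1) * (u * reval (X ?z) t') * g t') * ?Q powr (- q)
          + (- q) * ?Q powr (- q - 1) * (u * reval (V ?z) t') * (g t' * ?P powr real m)
        = ?P powr real m * ?Q powr (- q) / (?P * ?Q) * (reval (fps_deriv (E ?z)) t' * (?P * ?Q)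
          - g t' * u * (q * (reval (V ?z) t' * ?P) - real m * (reval (X ?z) t' * ?Q)))"
        unfolding e1 e2 using P by (simp add: divide_simps) (simp add: algebra_simps)
      ultimately show ?thesis using dE[OF t'] by simp
    qed
    have h0: "h 0 = (1 / 2 + s) ^ m"
    proof -
      have w0: "w 0 = c" using idz by (simp add: w_def reval_0)
      have l0: "l 0 = a * c" using idz by (simp add: l_def reval_0)
      have p0: "0 < 1 + u * (a * c)" "0 < 1 + u * c" using pos[of 0] t1 w0 l0 by auto
      have "fps_nth (E ?z) 0 = (1 / 2 + exp ?z) ^ m * (1 / (1 + tau ?z * of_real (a * c))) ^ m *
          (1 + tau ?z * of_real c) powr of_real q" using idz by blast
      also have "exp ?z = complex_of_real s" using s by (simp add: exp_of_real)
      also have "1 + tau ?z * of_real c = complex_of_real (1 + u * c)" by (simp add: tau_u)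
      also have "1 + tau ?z * of_real (a * c) = complex_of_real (1 + u * (a * c))" by (simp add: tau_u)
      also have "complex_of_real (1 + u * c) powr of_real q = of_real ((1 + u * c) powr q)"
        using p0 by (subst powr_of_real) auto
      also have "(1 / 2 + complex_of_real s) ^ m * (1 / complex_of_real (1 + u * (a * c))) ^ m * of_real ((1 + u * c) powr q)
        = of_real ((1 / 2 + s) ^ m * (1 / (1 + u * (a * c))) ^ m * (1 + u * c) powr q)"
        by (simp only: of_real_mult of_real_power of_real_divide of_real_add of_real_1 of_real_numeral)
      finally have "g 0 = (1 / 2 + s) ^ m * (1 / (1 + u * (a * c))) ^ m * (1 + u * c) powr q"
        by (simp only: g_def reval_0 Re_complex_of_real)
      then show ?thesis unfolding h_def w0 l0 using p0
        by (simp add: powr_realpow powr_minus power_one_over)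
    qed
    have "h t = h 0"
    proof -
      have "\<exists>k. \<forall>x\<in>{- t1<..<t1}. h x = k"
        by (rule has_field_derivative_zero_constant)
          (auto intro!: has_field_derivative_at_within dh)
      then obtain k where "\<forall>x\<in>{- t1<..<t1}. h x = k" by blast
      moreover have "t \<in> {- t1<..<t1}" "0 \<in> {- t1<..<t1}" using tt t1 by auto
      ultimately show ?thesis by simp
    qed
    then have E_eq: "g t * (1 + u * l t) ^ m = (1 / 2 + s) ^ m * (1 + u * w t) powr q"
    proof -
      assume ht: "h t = h 0"
      have "g t * (1 + u * l t) ^ m = h t * (1 + u * w t) powr q"
        using pos[OF tt] by (simp add: h_def powr_realpow powr_minus)
      then show ?thesis unfolding ht h0 .
    qed
    have V0_eq: "V0 s t powr q = s powr q * (1 + u * w t) powr q"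
    proof -
      have "V0 s t = s * (1 + u * w t)"
        using pw(3) by (simp add: V0_def u_def w_def ev_def algebra_simps)
      then show ?thesis using s pos[OF tt] by (simp add: powr_mult)
    qed
    have det_eq: "Vss s t * Vtt s t - (Vst s t)\<^sup>2 = s powr q * g t"
    proof -
      have e: "s powr (a - 1 - 1) * s powr a = s powr q" "(s powr (a - 1))\<^sup>2 = s powr q"
        by (simp_all add: power2_eq_square a_def flip: powr_add)
      have "Vss s t * Vtt s t - (Vst s t)\<^sup>2 =
          s powr (a - 1 - 1) * s powr a * (ev D ?x t * ev Z ?x t) - (s powr (a - 1))\<^sup>2 * (ev X ?x t)\<^sup>2"
        by (simp add: Vss_def Vtt_def Vst_def power_mult_distrib mult_ac)
      also have "\<dots> = s powr q * ev E ?x t" unfolding e DZ by (simp add: algebra_simps)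
      finally show ?thesis by (simp add: g_def ev_def)
    qed
    have "Vs s t = 1 + u * l t" by (simp add: Vs_def u_def l_def ev_def)
    then show "Vs s t ^ m * (Vss s t * Vtt s t - (Vst s t)\<^sup>2) = (1 / 2 + s) ^ m * V0 s t powr q"
      unfolding det_eq V0_eq using E_eq by (simp add: mult_ac)
  qed simp
  then show ?thesis by blast
qed

text \<open>Scaling \<open>V\<close> by \<open>u\<close> and the argument \<open>t\<close> by
  \<open>t1\<close> multiplies the left side of the equation by \<open>u^(m+2) t1^2\<close> and the
  right side by \<open>u^q\<close>. The exponent chosen for \<open>u\<close> balances the two
  factors; it has the denominator \<open>m + 2 - q\<close>, which is positive. The slope bound
  \<open>d\<close> turns into \<open>u * d\<close>.\<close>

lemma ma_profile_rescale:
  assumes prof: "ma_profile m q t1 d B V Vs Vt Vss Vst Vtt" and q: "q < real m + 2"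
  shows "\<exists>d B V Vs Vt Vss Vst Vtt. ma_profile m q 1 d B V Vs Vt Vss Vst Vtt"
proof -
  have t1: "0 < t1" and d: "0 < d" using prof by (auto simp: ma_profile_def)
  define u where "u = t1 powr (- 2 / (real m + 2 - q))"
  have u: "0 < u" using t1 by (simp add: u_def)
  have ueq: "u ^ (m + 2) * t1\<^sup>2 = u powr q"
  proof -
    have "u powr (real m + 2 - q) = t1 powr (- 2)"
    proof -
      have "- 2 / c * c = - 2" if "c \<noteq> 0" for c :: real using that by simp
      from this[of "real m + 2 - q"] have "- 2 / (real m + 2 - q) * (real m + 2 - q) = - 2" using q by argo
      then show ?thesis unfolding u_def powr_powr by (rule arg_cong)
    qed
    then have "u powr (real m + 2) = t1 powr (- 2) * u powr q"
      using u by (simp add: powr_diff field_simps)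
    moreover have "u powr (real m + 2) = u ^ (m + 2)"
    proof -
      have "real m + 2 = real (m + 2)" by simp
      then show ?thesis by (simp only: powr_realpow[OF u])
    qed
    moreover have "t1 powr (- 2) * t1\<^sup>2 = 1"
      using t1 by (simp add: powr_minus)
    ultimately show ?thesis by (simp add: mult_ac)
  qed
  define C where "C = u * B + u * t1 * B"
  have B: "0 \<le> B"
  proof -
    have "d \<le> Vs (1 / 4) 0" "Vs (1 / 4) 0 \<le> B"
      using prof t1 unfolding ma_profile_def by auto
    then show ?thesis using d by linarith
  qed
  have "ma_profile m q 1 (u * d) C (\<lambda>s t. u * V s (t1 * t)) (\<lambda>s t. u * Vs s (t1 * t)) (\<lambda>s t. u * t1 * Vt s (t1 * t))
     (\<lambda>s t. u * Vss s (t1 * t)) (\<lambda>s t. u * t1 * Vst s (t1 * t)) (\<lambda>s t. u * t1\<^sup>2 * Vtt s (t1 * t))"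
    unfolding ma_profile_def
  proof (intro conjI allI impI; (elim conjE)?)
    show "(0 :: real) < 1" "0 < u * d" using u d by simp_all
    fix s t :: real assume s: "0 < s" "s < 1 / 2" and t: "\<bar>t\<bar> < 1"
    have tt: "\<bar>t1 * t\<bar> < t1" using t t1 by (simp add: abs_mult)
    note P = prof[unfolded ma_profile_def, THEN conjunct2, THEN conjunct2, rule_format, OF conjI[OF s(1) conjI[OF s(2) tt]]]
    have lin: "((\<lambda>p. (fst p, t1 * snd p)) has_derivative (\<lambda>h. (fst h, t1 * snd h))) (at (s, t))"
      by (intro has_derivative_Pair has_derivative_mult_right bounded_linear_imp_has_derivative
          bounded_linear_fst bounded_linear_snd)
    have comp: "((\<lambda>p. c * F (fst p) (t1 * snd p)) has_derivative (\<lambda>h. c * (a * fst h + b * (t1 * snd h)))) (at (s, t))"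
      if "((\<lambda>p. F (fst p) (snd p)) has_derivative (\<lambda>h. a * fst h + b * snd h)) (at (s, t1 * t))"
      for F :: "real \<Rightarrow> real \<Rightarrow> real" and a b c
      using has_derivative_mult_right[OF has_derivative_compose[OF lin, of "\<lambda>p. F (fst p) (snd p)" "\<lambda>h. a * fst h + b * snd h"], of c] that
      by simp
    show "((\<lambda>p. u * V (fst p) (t1 * snd p)) has_derivative (\<lambda>h. u * Vs s (t1 * t) * fst h + u * t1 * Vt s (t1 * t) * snd h)) (at (s, t))"
      by (rule has_derivative_eq_rhs[OF comp[OF P[THEN conjunct1]]]) (simp add: algebra_simps)
    show "((\<lambda>p. u * Vs (fst p) (t1 * snd p)) has_derivative (\<lambda>h. u * Vss s (t1 * t) * fst h + u * t1 * Vst s (t1 * t) * snd h)) (at (s, t))"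
      by (rule has_derivative_eq_rhs[OF comp[OF P[THEN conjunct2, THEN conjunct1]]]) (simp add: algebra_simps)
    show "((\<lambda>p. u * t1 * Vt (fst p) (t1 * snd p)) has_derivative (\<lambda>h. u * t1 * Vst s (t1 * t) * fst h + u * t1\<^sup>2 * Vtt s (t1 * t) * snd h)) (at (s, t))"
      by (rule has_derivative_eq_rhs[OF comp[OF P[THEN conjunct2, THEN conjunct2, THEN conjunct1]]])
        (simp add: algebra_simps power2_eq_square)
    note Q = P[THEN conjunct2, THEN conjunct2, THEN conjunct2]
    show "0 < u * Vss s (t1 * t)" using Q u by simp
    have "(u * Vs s (t1 * t)) ^ m * (u * Vss s (t1 * t) * (u * t1\<^sup>2 * Vtt s (t1 * t)) - (u * t1 * Vst s (t1 * t))\<^sup>2)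
      = u ^ (m + 2) * t1\<^sup>2 * (Vs s (t1 * t) ^ m * (Vss s (t1 * t) * Vtt s (t1 * t) - (Vst s (t1 * t))\<^sup>2))"
      by (simp add: power_mult_distrib power_add power2_eq_square algebra_simps)
    also have "\<dots> = u powr q * ((1 / 2 + s) ^ m * V s (t1 * t) powr q)"
      unfolding ueq using Q by simp
    also have "\<dots> = (1 / 2 + s) ^ m * (u * V s (t1 * t)) powr q"
    proof -
      have "0 \<le> d * s" using d s by simp
      then have "0 \<le> V s (t1 * t)" using Q by linarith
      then show ?thesis using u by (simp add: powr_mult)
    qed
    finally show "(u * Vs s (t1 * t)) ^ m * (u * Vss s (t1 * t) * (u * t1\<^sup>2 * Vtt s (t1 * t)) - (u * t1 * Vst s (t1 * t))\<^sup>2)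
      = (1 / 2 + s) ^ m * (u * V s (t1 * t)) powr q" .
    have C: "u * B \<le> C" "u * t1 * B \<le> C" using u t1 B by (auto simp: C_def)
    show "u * d * s \<le> u * V s (t1 * t)" using Q u by (simp add: mult.assoc)
    have "u * V s (t1 * t) \<le> u * (B * s)" using Q u by (intro mult_left_mono) auto
    also have "\<dots> \<le> C * s" using mult_right_mono[OF C(1), of s] s by (simp add: mult.assoc)
    finally show "u * V s (t1 * t) \<le> C * s" .
    show "u * d \<le> u * Vs s (t1 * t)" using Q u by simp
    have "u * Vs s (t1 * t) \<le> u * B" using Q u by (intro mult_left_mono) auto
    then show "u * Vs s (t1 * t) \<le> C" using C(1) by linarith
    have "u * t1 * \<bar>Vt s (t1 * t)\<bar> \<le> u * t1 * B" using Q u t1 by (intro mult_left_mono) auto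
    moreover have "\<bar>u * t1 * Vt s (t1 * t)\<bar> = u * t1 * \<bar>Vt s (t1 * t)\<bar>"
      using u t1 by (simp add: abs_mult)
    ultimately show "\<bar>u * t1 * Vt s (t1 * t)\<bar> \<le> C" using C(2) by linarith
  qed
  then show ?thesis by blast
qed

section \<open>Change of variables\<close>

text \<open>Only row \<open>k\<close> differs from the identity matrix, so Cramer's lemma gives the
  determinant.\<close>

lemma det_axis_update:
  fixes w :: "real ^ 'n"
  shows "det (matrix (\<lambda>h. h + (w \<bullet> h) *\<^sub>R (c *\<^sub>R axis k 1))) = 1 + c * w $ k"
proof -
  let ?x = "axis k 1 + c *\<^sub>R w"
  have D: "det (\<chi> i. if i = k then sum (\<lambda>i. ?x $ i *s row i (mat 1 :: real^'n^'n)) UNIV else row i (mat 1)) = ?x $ k * det (mat 1 :: real^'n^'n)"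
    by (rule cramer_lemma_transpose)
  have S: "sum (\<lambda>i. ?x $ i *s row i (mat 1 :: real^'n^'n)) UNIV = ?x"
    by (simp add: vec_eq_iff row_def mat_def if_distrib[of "\<lambda>z. _ * z"] sum.distrib cong: if_cong)
  have M: "(\<chi> i. if i = k then ?x else row i (mat 1)) = matrix (\<lambda>h. h + (w \<bullet> h) *\<^sub>R (c *\<^sub>R axis k 1))"
    by (simp add: vec_eq_iff matrix_def row_def mat_def inner_axis) (auto simp: axis_def)
  show ?thesis using D unfolding S M by simp
qed

lemma orthogonal_transformationD: "orthogonal_transformation f \<Longrightarrow> f x \<bullet> f y = x \<bullet> y"
  by (simp add: orthogonal_transformation_def)

text \<open>Conjugation by an orthogonal map that sends \<open>u\<close> to a multiple of a
  coordinate axis.\<close>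

lemma det_rank_one_update:
  fixes u w :: "real ^ 'n"
  shows "det (matrix (\<lambda>h. h + (w \<bullet> h) *\<^sub>R u)) = 1 + w \<bullet> u"
proof -
  fix k :: 'n
  have "norm u = norm (norm u *\<^sub>R axis k (1 :: real))" by (simp add: norm_axis_1)
  then obtain f where f: "orthogonal_transformation f" "f u = norm u *\<^sub>R axis k (1 :: real)"
    by (rule orthogonal_transformation_exists) blast
  have lf: "linear f" using f(1) by (rule orthogonal_transformation_linear)
  have finv: "orthogonal_transformation (inv f)"
    using f(1) by (rule orthogonal_transformation_inv)
  have linv: "linear (inv f)" using finv by (rule orthogonal_transformation_linear)
  have ff: "f (inv f x) = x" "inv f (f x) = x" for x
    using orthogonal_transformation_surj[OF f(1)] orthogonal_transformation_inj[OF f(1)]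
    by (simp_all add: surj_f_inv_f inv_f_f)
  let ?M = "\<lambda>h. h + (w \<bullet> h) *\<^sub>R u"
  have lM: "linear ?M"
    by (intro linearI) (auto simp: inner_add_right algebra_simps)
  have eq: "f \<circ> ?M \<circ> inv f = (\<lambda>h. h + (f w \<bullet> h) *\<^sub>R (norm u *\<^sub>R axis k 1))"
  proof
    fix h
    have "w \<bullet> inv f h = f w \<bullet> h"
      using orthogonal_transformationD[OF f(1), of w "inv f h"] ff(1)[of h] by simp
    then show "(f \<circ> ?M \<circ> inv f) h = h + (f w \<bullet> h) *\<^sub>R (norm u *\<^sub>R axis k 1)"
      using f(2) ff(1) lf by (simp add: linear_add linear_cmul)
  qed
  have one: "det (matrix f) * det (matrix (inv f)) = 1"
  proof -
    have "f \<circ> inv f = (\<lambda>x. x)" using ff by auto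
    then have "matrix f ** matrix (inv f) = matrix (\<lambda>x. x)"
      using matrix_compose[OF linv lf] by metis
    then have "matrix f ** matrix (inv f) = mat 1"
      using matrix_id_mat_1 by (simp add: id_def)
    then have "det (matrix f ** matrix (inv f)) = 1" by simp
    then show ?thesis by (simp add: det_mul)
  qed
  have "det (matrix (f \<circ> ?M \<circ> inv f)) = det (matrix f) * det (matrix ?M) * det (matrix (inv f))"
    using matrix_compose[OF linv linear_compose[OF lM lf]] matrix_compose[OF lM lf]
    by (simp add: det_mul)
  then have "det (matrix ?M) = det (matrix (f \<circ> ?M \<circ> inv f))"
    using one by (simp add: mult_ac)
  also have "\<dots> = 1 + norm u * f w $ k"
    unfolding eq by (rule det_axis_update)
  also have "norm u * f w $ k = f w \<bullet> f u"
    unfolding f(2) by (simp add: inner_axis)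
  also have "\<dots> = w \<bullet> u" using f(1) by (simp add: orthogonal_transformation_def)
  finally show ?thesis .
qed

text \<open>The map is \<open>p\<close> times a product of two rank-one updates of the identity; the
  correction by \<open>w\<close> inside \<open>z\<close> cancels the cross term created by the
  composition. The number \<open>p + c\<close> is \<open>p\<close> times the determinant of the
  factor \<open>?B\<close> and a denominator in \<open>z\<close>.\<close>

lemma det_rank_two_update:
  fixes e f :: "real ^ 'n"
  assumes card: "2 \<le> CARD('n)" and ef: "e \<bullet> e = 1" "f \<bullet> f = 1" "e \<bullet> f = 0"
    and nz: "p \<noteq> 0" "p + c \<noteq> 0"
  shows "det (matrix (\<lambda>h. p *\<^sub>R h + (a * (e \<bullet> h) + b * (f \<bullet> h)) *\<^sub>R e + (b * (e \<bullet> h) + c * (f \<bullet> h)) *\<^sub>R f))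
    = p ^ (CARD('n) - 2) * ((p + a) * (p + c) - b\<^sup>2)"
proof -
  define w where "w = (b / p) *\<^sub>R e + (c / p) *\<^sub>R f"
  define z where "z = (a / p) *\<^sub>R e + (b / p) *\<^sub>R f - (b / (p + c)) *\<^sub>R w"
  let ?A = "\<lambda>h. h + (z \<bullet> h) *\<^sub>R e" and ?B = "\<lambda>h. h + (w \<bullet> h) *\<^sub>R f" and ?P = "\<lambda>h. p *\<^sub>R h :: real ^ 'n"
  let ?M = "\<lambda>h. p *\<^sub>R h + (a * (e \<bullet> h) + b * (f \<bullet> h)) *\<^sub>R e + (b * (e \<bullet> h) + c * (f \<bullet> h)) *\<^sub>R f"
  have lA: "linear ?A" and lB: "linear ?B" and lP: "linear ?P"
    by (intro linearI; auto simp: inner_add_right algebra_simps)+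
  have fe: "f \<bullet> e = 0" using ef(3) by (simp add: inner_commute)
  have wf: "w \<bullet> f = c / p" using ef by (simp add: w_def inner_add_left)
  have we: "w \<bullet> e = b / p" using ef fe by (simp add: w_def inner_add_left)
  have zf: "z \<bullet> f = b / (p + c)"
    using ef nz by (simp add: z_def inner_add_left inner_diff_left wf divide_simps) (simp add: algebra_simps)
  have ze: "z \<bullet> e = a / p - b / (p + c) * (b / p)"
    using ef fe by (simp add: z_def inner_add_left inner_diff_left we)
  have comp: "?P \<circ> (?A \<circ> ?B) = ?M"
  proof
    fix h
    have "z \<bullet> (h + (w \<bullet> h) *\<^sub>R f) = (a / p) * (e \<bullet> h) + (b / p) * (f \<bullet> h)"
      by (simp add: inner_add_right zf) (simp add: z_def inner_add_left inner_diff_left)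
    then show "(?P \<circ> (?A \<circ> ?B)) h = ?M h"
      using nz by (simp add: w_def inner_add_left algebra_simps)
  qed
  have "det (matrix ?P) = p ^ CARD('n)" by (simp add: det_matrix_scaleR)
  moreover have "det (matrix ?M) = det (matrix ?P) * (det (matrix ?A) * det (matrix ?B))"
    unfolding comp [symmetric]
    using matrix_compose[OF linear_compose[OF lB lA] lP] matrix_compose[OF lB lA] by (simp add: det_mul)
  ultimately have "det (matrix ?M) = p ^ CARD('n) * ((1 + z \<bullet> e) * (1 + w \<bullet> f))"
    by (simp add: det_rank_one_update)
  also have "(1 + z \<bullet> e) * (1 + w \<bullet> f) = ((p + a) * (p + c) - b\<^sup>2) / p\<^sup>2"
    unfolding ze wf using nz by (simp add: divide_simps power2_eq_square) (simp add: algebra_simps)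
  also have "p ^ CARD('n) = p ^ (CARD('n) - 2) * p\<^sup>2"
    using card by (simp only: power_add [symmetric] le_add_diff_inverse2)
  finally show ?thesis using nz by simp
qed

text \<open>
  The library states the change of variables theorem only for well-ordered index types, so it is
  transported along a well-ordered copy of the index type.
\<close>

typedef 'a wo = "UNIV :: 'a set" ..

instance wo :: (finite) finite
proof
  have "(UNIV :: 'a wo set) = range Abs_wo"
    by (rule type_definition.univ[OF type_definition_wo])
  moreover have "finite (range (Abs_wo :: 'a \<Rightarrow> 'a wo))" by (rule finite_imageI) (rule finite)
  ultimately show "finite (UNIV :: 'a wo set)" by (rule ssubst)
qed

text \<open>An arbitrary injection into the naturals; any well-order would do.\<close>

definition wo_rank :: "'a::finite wo \<Rightarrow> nat" where
  "wo_rank x = (SOME f. inj f) x"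

lemma wo_rank_inj: "inj (wo_rank :: 'a::finite wo \<Rightarrow> nat)"
proof -
  have "\<exists>f :: 'a wo \<Rightarrow> nat. inj f" using finite_imp_inj_to_nat_seg[OF finite[of "UNIV :: 'a wo set"]] by blast
  then show ?thesis unfolding wo_rank_def[abs_def] by (rule someI_ex)
qed

instantiation wo :: (finite) wellorder
begin

definition "x \<le> y \<longleftrightarrow> wo_rank x \<le> wo_rank y"
definition "x < y \<longleftrightarrow> wo_rank x < wo_rank y"

instance
proof
  fix x y z :: "'a wo"
  show "(x < y) = (x \<le> y \<and> \<not> y \<le> x)"
    unfolding less_eq_wo_def less_wo_def by (rule less_le_not_le)
  show "x \<le> x"
    unfolding less_eq_wo_def by (rule order_refl)
  show "x \<le> y \<Longrightarrow> y \<le> z \<Longrightarrow> x \<le> z"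
    unfolding less_eq_wo_def by (rule order_trans)
  show "x \<le> y \<or> y \<le> x"
    unfolding less_eq_wo_def by (rule linear)
  show "x = y" if "x \<le> y" "y \<le> x"
    using that unfolding less_eq_wo_def by (intro injD[OF wo_rank_inj] order_antisym)
next
  fix P :: "'a wo \<Rightarrow> bool" and a
  assume step: "\<And>x. (\<And>y. y < x \<Longrightarrow> P y) \<Longrightarrow> P x"
  have "\<forall>x. wo_rank x = n \<longrightarrow> P x" for n
  proof (induction n rule: less_induct)
    case (less n)
    then show ?case using step unfolding less_wo_def by metis
  qed
  then show "P a" by blast
qed

end

definition to_wo :: "real ^ 'n \<Rightarrow> real ^ 'n wo" where
  "to_wo x = (\<chi> i. x $ Rep_wo i)"

definition of_wo :: "real ^ 'n wo \<Rightarrow> real ^ 'n" where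
  "of_wo x = (\<chi> i. x $ Abs_wo i)"

lemma of_wo_to_wo [simp]: "of_wo (to_wo x) = x" "to_wo (of_wo y) = y"
  by (simp_all add: of_wo_def to_wo_def vec_eq_iff Abs_wo_inverse Rep_wo_inverse)

lemma linear_to_wo: "linear to_wo" and linear_of_wo: "linear of_wo"
  by (intro linearI; simp add: to_wo_def of_wo_def vec_eq_iff)+

lemma inner_to_wo: "to_wo x \<bullet> y = x \<bullet> of_wo (y :: real ^ 'n::finite wo)"
proof -
  have "(\<Sum>i\<in>UNIV. x $ Rep_wo i * y $ i) = (\<Sum>j\<in>UNIV. x $ j * y $ Abs_wo j)"
    by (rule sum.reindex_bij_witness[of _ Abs_wo Rep_wo]) (auto simp: Rep_wo_inverse Abs_wo_inverse)
  then show ?thesis by (simp add: inner_vec_def to_wo_def of_wo_def)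
qed

lemma prod_Basis_vec: "(\<Prod>b\<in>Basis. f b) = (\<Prod>i\<in>UNIV. f (axis i 1))" for f :: "real ^ 'n \<Rightarrow> real"
proof -
  have B: "(Basis :: (real ^ 'n) set) = range (\<lambda>i. axis i 1)" by (auto simp: Basis_vec_def)
  have "inj (\<lambda>i :: 'n. axis i (1 :: real))" by (auto simp: inj_def axis_eq_axis)
  then show ?thesis unfolding B by (simp add: prod.reindex)
qed

text \<open>Relabelling coordinates takes boxes to boxes of the same volume, and boxes determine
  \<open>lborel\<close>.\<close>

lemma lborel_eq_distr_of_wo: "lborel = distr lborel borel (of_wo :: real ^ 'n::finite wo \<Rightarrow> real ^ 'n)"
proof (rule lborel_eqI)
  fix l u :: "real ^ 'n" assume lu: "\<And>b. b \<in> Basis \<Longrightarrow> l \<bullet> b \<le> u \<bullet> b"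
  have le: "l $ i \<le> u $ i" for i using lu[of "axis i 1"] by (simp add: inner_axis axis_in_Basis_iff)
  have [measurable]: "of_wo \<in> borel_measurable (borel :: (real ^ 'n wo) measure)"
    using linear_of_wo by (intro borel_measurable_continuous_onI linear_continuous_on linear_conv_bounded_linear[THEN iffD1])
  have "of_wo -` box l u = box (to_wo l) (to_wo u)"
  proof (rule set_eqI)
    fix x
    have "(\<forall>i. l $ i < x $ Abs_wo i \<and> x $ Abs_wo i < u $ i) \<longleftrightarrow> (\<forall>j. l $ Rep_wo j < x $ j \<and> x $ j < u $ Rep_wo j)"
      by (metis Rep_wo_inverse Abs_wo_inverse UNIV_I)
    then show "x \<in> of_wo -` box l u \<longleftrightarrow> x \<in> box (to_wo l) (to_wo u)"
      by (simp add: mem_box_cart of_wo_def to_wo_def)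
  qed
  then have "emeasure (distr lborel borel of_wo) (box l u) = emeasure lborel (box (to_wo l) (to_wo u))"
    by (subst emeasure_distr) simp_all
  also have "\<dots> = (\<Prod>b\<in>Basis. (to_wo u - to_wo l) \<bullet> b)"
    by (rule emeasure_lborel_box) (auto simp: Basis_vec_def inner_axis to_wo_def le)
  also have "(\<Prod>b\<in>Basis. (to_wo u - to_wo l) \<bullet> b) = (\<Prod>i\<in>UNIV. (u - l) $ Rep_wo i)"
    unfolding prod_Basis_vec by (simp add: inner_axis to_wo_def)
  also have "\<dots> = (\<Prod>i\<in>UNIV. (u - l) $ i)"
    by (rule prod.reindex_bij_witness[of _ Abs_wo Rep_wo]) (auto simp: Rep_wo_inverse Abs_wo_inverse)
  also have "\<dots> = (\<Prod>b\<in>Basis. (u - l) \<bullet> b)"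
    unfolding prod_Basis_vec by (simp add: inner_axis)
  finally show "emeasure (distr lborel borel of_wo) (box l u) = (\<Prod>b\<in>Basis. (u - l) \<bullet> b)" .
qed simp

text \<open>The image of a set under a differentiable map is handled only as a Lebesgue set, so the
  transport has to work for the completed measure.\<close>

lemma distr_lborel_imp_lebesgue:
  fixes f :: "'a::euclidean_space \<Rightarrow> 'b::euclidean_space"
  assumes f: "f \<in> borel_measurable borel" and eq: "lborel = distr lborel borel f"
  shows "f \<in> lebesgue \<rightarrow>\<^sub>M lebesgue" "distr lebesgue lebesgue f = lebesgue"
proof -
  have f': "f \<in> lborel \<rightarrow>\<^sub>M lborel" using f by simp
  have d: "distr lebesgue lborel f = lborel"
    using distr_completion[OF f'] eq by (simp cong: distr_cong)
  show "f \<in> lebesgue \<rightarrow>\<^sub>M lebesgue"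
    by (rule completion.measurable_completion2[OF measurable_completion[OF f']]) (simp add: d)
  show "distr lebesgue lebesgue f = lebesgue"
    using completion.completion_distr_eq[OF measurable_completion[OF f']] d by simp
qed

lemma measurable_of_wo: "of_wo \<in> borel_measurable (borel :: (real ^ 'n::finite wo) measure)"
  using linear_of_wo by (intro borel_measurable_continuous_onI linear_continuous_on linear_conv_bounded_linear[THEN iffD1])

lemma measurable_to_wo: "to_wo \<in> borel_measurable (borel :: (real ^ 'n::finite) measure)"
  using linear_to_wo by (intro borel_measurable_continuous_onI linear_continuous_on linear_conv_bounded_linear[THEN iffD1])

lemma lborel_eq_distr_to_wo: "lborel = distr lborel borel (to_wo :: real ^ 'n::finite \<Rightarrow> real ^ 'n wo)"
proof -
  have "distr lborel borel (to_wo :: real ^ 'n \<Rightarrow> real ^ 'n wo)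
     = distr (distr lborel borel of_wo) borel (to_wo :: real ^ 'n \<Rightarrow> real ^ 'n wo)"
    using arg_cong[OF lborel_eq_distr_of_wo, of "\<lambda>M. distr M borel to_wo"] .
  also have "\<dots> = distr lborel borel (\<lambda>x. x)"
    using measurable_of_wo measurable_to_wo by (subst distr_distr) (auto simp: o_def)
  also have "\<dots> = lborel" by (rule distr_id2) simp
  finally show ?thesis by simp
qed

text \<open>\<open>D\<close> is a globally measurable function that agrees with the Jacobian on
  \<open>S\<close>, where alone \<open>g'\<close> has a meaning; finiteness of its integral makes
  the change of variables theorem for \<open>has_integral\<close> applicable.\<close>

lemma emeasure_differentiable_image_wellorder:
  fixes g :: "real ^ 'n::{finite,wellorder} \<Rightarrow> real ^ 'n::_"
  assumes S: "S \<in> sets lebesgue"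
    and der: "\<And>x. x \<in> S \<Longrightarrow> (g has_derivative g' x) (at x)"
    and inj: "inj_on g S"
    and D: "D \<in> borel_measurable lebesgue" "\<And>x. x \<in> S \<Longrightarrow> D x = \<bar>det (matrix (g' x))\<bar>"
    and fin: "(\<integral>\<^sup>+x\<in>S. ennreal (D x) \<partial>lebesgue) < \<infinity>"
  shows "g ` S \<in> sets lebesgue" "emeasure lebesgue (g ` S) = (\<integral>\<^sup>+x\<in>S. ennreal (D x) \<partial>lebesgue)"
proof -
  let ?f = "\<lambda>x. indicator S x *\<^sub>R D x"
  have nn: "0 \<le> ?f x" for x using D(2)[of x] by (auto simp: indicator_def)
  have e: "ennreal (?f x) = ennreal (D x) * indicator S x" for x by (simp add: indicator_def)
  have "integrable lebesgue ?f"
  proof (rule integrableI_nonneg)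
    show "?f \<in> borel_measurable lebesgue" using S D(1) by simp
    show "(\<integral>\<^sup>+x. ennreal (?f x) \<partial>lebesgue) < \<infinity>" using fin unfolding e .
  qed (use nn in simp)
  then have int: "set_integrable lebesgue S D" by (simp add: set_integrable_def)
  have "(D has_integral (LINT x:S|lebesgue. D x)) S" by (rule has_integral_set_lebesgue[OF int])
  then have "((\<lambda>x. \<bar>det (matrix (g' x))\<bar>) has_integral (LINT x:S|lebesgue. D x)) S"
    using D(2) by (subst has_integral_cong[of _ _ D]) auto
  then have m: "g ` S \<in> lmeasurable" "measure lebesgue (g ` S) = (LINT x:S|lebesgue. D x)"
    using has_measure_differentiable_image[OF S _ inj, of g'] der has_derivative_at_withinI by blast+
  show "g ` S \<in> sets lebesgue" using m(1) by (rule fmeasurableD)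
  have "emeasure lebesgue (g ` S) = ennreal (LINT x:S|lebesgue. D x)"
    using m emeasure_eq_measure2 by metis
  also have "\<dots> = (\<integral>\<^sup>+x. ennreal (?f x) \<partial>lebesgue)"
    unfolding set_lebesgue_integral_def
    using int nn unfolding set_integrable_def by (intro nn_integral_eq_integral [symmetric]) auto
  finally show "emeasure lebesgue (g ` S) = (\<integral>\<^sup>+x\<in>S. ennreal (D x) \<partial>lebesgue)" unfolding e .
qed

text \<open>Conjugation with \<open>to_wo\<close>. The Jacobian is left in conjugated form, because
  \<open>det_rank_two_update\<close> evaluates it in the well-ordered copy just as well.\<close>

lemma emeasure_differentiable_image:
  fixes g :: "real ^ 'n::finite \<Rightarrow> real ^ 'n"
  assumes S: "S \<in> sets lebesgue"
    and der: "\<And>x. x \<in> S \<Longrightarrow> (g has_derivative g' x) (at x)"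
    and inj: "inj_on g S"
    and D: "D \<in> borel_measurable lebesgue"
      "\<And>x. x \<in> S \<Longrightarrow> D x = \<bar>det (matrix (\<lambda>h. to_wo (g' x (of_wo h))))\<bar>"
    and fin: "(\<integral>\<^sup>+x\<in>S. ennreal (D x) \<partial>lebesgue) < \<infinity>"
  shows "g ` S \<in> sets lebesgue" "emeasure lebesgue (g ` S) = (\<integral>\<^sup>+x\<in>S. ennreal (D x) \<partial>lebesgue)"
proof -
  note of = distr_lborel_imp_lebesgue[OF measurable_of_wo lborel_eq_distr_of_wo]
  note to = distr_lborel_imp_lebesgue[OF measurable_to_wo lborel_eq_distr_to_wo]
  let ?G = "\<lambda>y. to_wo (g (of_wo y))" and ?S = "of_wo -` S :: (real ^ 'n wo) set"
  have S': "?S \<in> sets lebesgue" using measurable_sets[OF of(1) S] by simp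
  have bl: "bounded_linear (to_wo :: real ^ 'n \<Rightarrow> _)" "bounded_linear (of_wo :: _ \<Rightarrow> real ^ 'n)"
    using linear_to_wo linear_of_wo linear_conv_bounded_linear by blast+
  have der': "(?G has_derivative (\<lambda>h. to_wo (g' (of_wo y) (of_wo h)))) (at y)" if "y \<in> ?S" for y
  proof -
    have 1: "((\<lambda>y. g (of_wo y)) has_derivative (\<lambda>h. g' (of_wo y) (of_wo h))) (at y)"
      by (rule has_derivative_compose[OF bounded_linear_imp_has_derivative[OF bl(2)]]) (use that der in simp)
    show ?thesis by (rule bounded_linear.has_derivative[OF bl(1) 1])
  qed
  have inj': "inj_on ?G ?S"
    using inj unfolding inj_on_def by (metis of_wo_to_wo vimage_eq)
  have D': "(\<lambda>y. D (of_wo y)) \<in> borel_measurable lebesgue"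
    using measurable_compose[OF of(1) D(1)] .
  have tr: "(\<integral>\<^sup>+y\<in>?S. ennreal (D (of_wo y)) \<partial>lebesgue) = (\<integral>\<^sup>+x\<in>S. ennreal (D x) \<partial>lebesgue)"
  proof -
    have m: "(\<lambda>x. ennreal (D x) * indicator S x) \<in> borel_measurable lebesgue" using S D(1) by simp
    have "(\<integral>\<^sup>+x\<in>S. ennreal (D x) \<partial>lebesgue) = (\<integral>\<^sup>+x\<in>S. ennreal (D x) \<partial>distr lebesgue lebesgue of_wo)"
      by (simp only: of(2))
    also have "\<dots> = (\<integral>\<^sup>+y. ennreal (D (of_wo y)) * indicator S (of_wo y) \<partial>lebesgue)"
      using nn_integral_distr[OF of(1)] m by simp
    finally show ?thesis by (simp add: indicator_def)
  qed
  have im: "to_wo -` (?G ` ?S) = g ` S"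
  proof (intro equalityI subsetI)
    fix x assume "x \<in> to_wo -` (?G ` ?S)"
    then obtain y where "to_wo x = to_wo (g (of_wo y))" "of_wo y \<in> S" by auto
    then show "x \<in> g ` S" by (metis of_wo_to_wo(1) imageI)
  next
    fix x assume "x \<in> g ` S"
    then obtain y where y: "y \<in> S" "x = g y" by blast
    then have "to_wo y \<in> ?S" "to_wo x = ?G (to_wo y)" by simp_all
    then show "x \<in> to_wo -` (?G ` ?S)" by blast
  qed
  have *: "?G ` ?S \<in> sets lebesgue" "emeasure lebesgue (?G ` ?S) = (\<integral>\<^sup>+y\<in>?S. ennreal (D (of_wo y)) \<partial>lebesgue)"
    using emeasure_differentiable_image_wellorder[OF S' der' inj' D'] D(2) fin tr by auto
  show "g ` S \<in> sets lebesgue" using measurable_sets[OF to(1) *(1)] im by simp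
  have "emeasure lebesgue (?G ` ?S) = emeasure (distr lebesgue lebesgue to_wo) (?G ` ?S)"
    by (simp only: to(2))
  also have "\<dots> = emeasure lebesgue (g ` S)"
    using emeasure_distr[OF to(1) *(1)] im by simp
  finally show "emeasure lebesgue (g ` S) = (\<integral>\<^sup>+x\<in>S. ennreal (D x) \<partial>lebesgue)"
    using *(2) tr by simp
qed

section \<open>The radial solution\<close>

lemma drop_coord_eq: "drop_coord k x = x - (x $ k) *\<^sub>R axis k 1"
  by (simp add: drop_coord_def vec_eq_iff axis_def)

lemma drop_coord_nth [simp]: "drop_coord k x $ k = 0"
  by (simp add: drop_coord_def)

lemma linear_drop_coord: "linear (drop_coord k)"
  by (intro linearI) (auto simp: drop_coord_def vec_eq_iff)

lemma bounded_linear_drop_coord: "bounded_linear (drop_coord (k :: 'n::finite))"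
  using linear_drop_coord linear_conv_bounded_linear by blast

lemma inner_axis_drop_coord [simp]:
  fixes x :: "real ^ 'n::finite"
  shows "axis k 1 \<bullet> drop_coord k x = 0" "drop_coord k x \<bullet> axis k 1 = 0"
  by (simp_all add: inner_axis inner_axis')

lemma inner_drop_coord:
  fixes x :: "real ^ 'n::finite"
  shows "drop_coord k x \<bullet> drop_coord k y = drop_coord k x \<bullet> y"
  by (subst (2) drop_coord_eq) (simp add: inner_diff_right)

lemma norm_drop_coord:
  fixes x :: "real ^ 'n::finite"
  shows "(norm x)\<^sup>2 = (norm (drop_coord k x))\<^sup>2 + (x $ k)\<^sup>2"
proof -
  have "drop_coord k x \<bullet> drop_coord k x = x \<bullet> x - (x $ k)\<^sup>2"
    unfolding inner_drop_coord
    by (simp add: drop_coord_eq inner_diff_left inner_axis' power2_eq_square)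
  then show ?thesis by (simp add: power2_norm_eq_inner)
qed

lemma norm_drop_coord_le: "norm (drop_coord k x) \<le> norm (x :: real ^ 'n::finite)"
proof (rule power2_le_imp_le)
  show "(norm (drop_coord k x))\<^sup>2 \<le> (norm x)\<^sup>2"
    unfolding norm_drop_coord[of x k] by simp
qed simp

lemma ball_drop_coord:
  fixes x :: "real ^ 'n::finite"
  assumes "x \<in> ball 0 1"
  shows "norm (drop_coord k x) < 1" "\<bar>x $ k\<bar> < 1"
proof -
  have "norm x < 1" using assms by (simp add: dist_norm)
  then show "norm (drop_coord k x) < 1" "\<bar>x $ k\<bar> < 1"
    using norm_drop_coord_le[of k x] component_le_norm_cart[of x k] by linarith+
qed

text \<open>The support at the convex combination is evaluated at both end points, and the linear
  terms cancel in the average. In this way convexity across the interface needs no second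
  derivatives there.\<close>

lemma convex_on_support:
  fixes f :: "'a::real_inner \<Rightarrow> real"
  assumes S: "convex S" and supp: "\<And>x. x \<in> S \<Longrightarrow> \<exists>p. \<forall>y\<in>S. f x + p \<bullet> (y - x) \<le> f y"
  shows "convex_on S f"
proof (rule convex_onI[OF _ S])
  fix t :: real and x y assume t: "0 < t" "t < 1" and xy: "x \<in> S" "y \<in> S"
  let ?z = "(1 - t) *\<^sub>R x + t *\<^sub>R y"
  have "?z \<in> S" using S t xy by (intro convexD) auto
  then obtain p where p: "\<forall>y\<in>S. f ?z + p \<bullet> (y - ?z) \<le> f y" using supp by blast
  have "(1 - t) * (f ?z + p \<bullet> (x - ?z)) + t * (f ?z + p \<bullet> (y - ?z)) \<le> (1 - t) * f x + t * f y"
    using p xy t by (intro add_mono mult_left_mono) auto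
  moreover have "(1 - t) * (f ?z + p \<bullet> (x - ?z)) + t * (f ?z + p \<bullet> (y - ?z)) = f ?z"
  proof -
    have "(1 - t) * (p \<bullet> (x - ?z)) + t * (p \<bullet> (y - ?z)) = p \<bullet> ((1 - t) *\<^sub>R (x - ?z) + t *\<^sub>R (y - ?z))"
      by (simp only: inner_add_right inner_scaleR_right)
    also have "(1 - t) *\<^sub>R (x - ?z) + t *\<^sub>R (y - ?z) = 0" by (simp add: algebra_simps)
    finally show ?thesis by (simp add: algebra_simps)
  qed
  ultimately show "f ?z \<le> (1 - t) * f x + t * f y" by simp
qed

text \<open>With the range \<open>\<bar>t\<bar> < 1\<close> and \<open>s < 1/2\<close>, the profile
  is available at every point of the unit ball outside the cylinder.\<close>

locale radial_profile =
  fixes k :: "'n::finite" and q d B :: real and V Vs Vt Vss Vst Vtt :: "real \<Rightarrow> real \<Rightarrow> real"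
  assumes card: "2 \<le> CARD('n)" and q: "0 < q"
    and prof: "ma_profile (CARD('n) - 2) q 1 d B V Vs Vt Vss Vst Vtt"
begin

lemma d_pos: "0 < d"
  using prof by (simp add: ma_profile_def)

lemma profD:
  assumes "0 < s" "s < 1 / 2" "\<bar>t\<bar> < 1"
  shows "((\<lambda>p. V (fst p) (snd p)) has_derivative (\<lambda>h. Vs s t * fst h + Vt s t * snd h)) (at (s, t))"
    "((\<lambda>p. Vs (fst p) (snd p)) has_derivative (\<lambda>h. Vss s t * fst h + Vst s t * snd h)) (at (s, t))"
    "((\<lambda>p. Vt (fst p) (snd p)) has_derivative (\<lambda>h. Vst s t * fst h + Vtt s t * snd h)) (at (s, t))"
    "0 < Vss s t"
    "Vs s t ^ (CARD('n) - 2) * (Vss s t * Vtt s t - (Vst s t)\<^sup>2) = (1 / 2 + s) ^ (CARD('n) - 2) * V s t powr q"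
    "d * s \<le> V s t" "V s t \<le> B * s" "d \<le> Vs s t" "Vs s t \<le> B" "\<bar>Vt s t\<bar> \<le> B"
  using prof assms unfolding ma_profile_def by blast+

lemma V_pos: "0 < s \<Longrightarrow> s < 1 / 2 \<Longrightarrow> \<bar>t\<bar> < 1 \<Longrightarrow> 0 < V s t"
  using profD(6)[of s t] mult_pos_pos[OF d_pos, of s] by linarith

lemma Vs_pos: "0 < s \<Longrightarrow> s < 1 / 2 \<Longrightarrow> \<bar>t\<bar> < 1 \<Longrightarrow> 0 < Vs s t"
  using profD(8)[of s t] d_pos by linarith

lemma B_pos: "0 < B"
  using profD(9)[of "1 / 4" 0] Vs_pos[of "1 / 4" 0] by simp

lemma det_pos:
  assumes "0 < s" "s < 1 / 2" "\<bar>t\<bar> < 1"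
  shows "0 < Vss s t * Vtt s t - (Vst s t)\<^sup>2"
proof -
  have "0 < (1 / 2 + s) ^ (CARD('n) - 2) * V s t powr q"
    using V_pos[OF assms] assms by (intro mult_pos_pos zero_less_power) auto
  then have "0 < Vs s t ^ (CARD('n) - 2) * (Vss s t * Vtt s t - (Vst s t)\<^sup>2)"
    using profD(5)[OF assms] by simp
  then show ?thesis
    using zero_less_power[OF Vs_pos[OF assms], of "CARD('n) - 2"] by (rule zero_less_mult_pos)
qed

text \<open>Completing the square after multiplication by \<open>Vss\<close>.\<close>

lemma hessian_pos:
  assumes "0 < s" "s < 1 / 2" "\<bar>t\<bar> < 1" "a \<noteq> 0 \<or> b \<noteq> 0"
  shows "0 < (Vss s t * a + Vst s t * b) * a + (Vst s t * a + Vtt s t * b) * b"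
proof -
  let ?Q = "(Vss s t * a + Vst s t * b) * a + (Vst s t * a + Vtt s t * b) * b"
  note pos = profD(4)[OF assms(1-3)] det_pos[OF assms(1-3)]
  have eq: "Vss s t * ?Q = (Vss s t * a + Vst s t * b)\<^sup>2 + (Vss s t * Vtt s t - (Vst s t)\<^sup>2) * b\<^sup>2"
    by (simp add: power2_eq_square algebra_simps)
  have "0 < (Vss s t * a + Vst s t * b)\<^sup>2 + (Vss s t * Vtt s t - (Vst s t)\<^sup>2) * b\<^sup>2"
  proof (cases "b = 0")
    case True
    then show ?thesis using assms(4) pos by simp
  next
    case False
    then show ?thesis using pos by (intro add_nonneg_pos mult_pos_pos) auto
  qed
  then have "0 < Vss s t * ?Q" unfolding eq .
  then show ?thesis using pos(1) by (simp add: zero_less_mult_iff)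
qed

text \<open>The second derivative along the segment is positive, so the slope at the start lies
  below the mean slope. Strictness is what later makes the gradient injective.\<close>

lemma planar_support:
  assumes st: "0 < s" "s < 1 / 2" "\<bar>t\<bar> < 1" and st': "0 < s'" "s' < 1 / 2" "\<bar>t'\<bar> < 1"
    and ne: "s' \<noteq> s \<or> t' \<noteq> t"
  shows "V s t + Vs s t * (s' - s) + Vt s t * (t' - t) < V s' t'"
proof -
  define a where "a = s' - s"
  define b where "b = t' - t"
  have ab: "a \<noteq> 0 \<or> b \<noteq> 0" using ne by (auto simp: a_def b_def)
  have in_D: "0 < s + l * a" "s + l * a < 1 / 2" "\<bar>t + l * b\<bar> < 1" if "0 \<le> l" "l \<le> 1" for l
  proof -
    have "(s + l * a, t + l * b) = (1 - l) *\<^sub>R (s, t) + l *\<^sub>R (s', t')"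
      by (simp add: a_def b_def algebra_simps)
    moreover have "convex ({0<..<1/2::real} \<times> {-1<..<1::real})" by (intro convex_Times) auto
    moreover have "(s, t) \<in> {0<..<1/2} \<times> {-1<..<1}" "(s', t') \<in> {0<..<1/2} \<times> {-1<..<1}"
      using st st' by auto
    ultimately have "(s + l * a, t + l * b) \<in> {0<..<1/2} \<times> {-1<..<1}"
      using that convexD_alt by metis
    then show "0 < s + l * a" "s + l * a < 1 / 2" "\<bar>t + l * b\<bar> < 1" by auto
  qed
  have line: "((\<lambda>l. (s + l * a, t + l * b)) has_derivative (\<lambda>h. (h * a, h * b))) (at l)" for l
    by (auto intro!: derivative_eq_intros)
  have along: "((\<lambda>l. F (s + l * a) (t + l * b)) has_real_derivative (P * a + Q * b)) (at l)"
    if "((\<lambda>p. F (fst p) (snd p)) has_derivative (\<lambda>h. P * fst h + Q * snd h)) (at (s + l * a, t + l * b))"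
    for F :: "real \<Rightarrow> real \<Rightarrow> real" and P Q l
    using has_derivative_compose[OF line that]
    by (simp add: has_field_derivative_def) (rule has_derivative_eq_rhs, assumption, auto simp: algebra_simps)
  define psi where "psi l = Vs (s + l * a) (t + l * b) * a + Vt (s + l * a) (t + l * b) * b" for l
  have d1: "((\<lambda>l. V (s + l * a) (t + l * b)) has_real_derivative psi l) (at l)" if "0 \<le> l" "l \<le> 1" for l
    unfolding psi_def by (rule along[OF profD(1)[OF in_D[OF that]]])
  have d2: "\<exists>y. (psi has_real_derivative y) (at l) \<and> 0 < y" if "0 \<le> l" "l \<le> 1" for l
    unfolding psi_def[abs_def]
    using DERIV_add[OF DERIV_cmult_right[OF along[OF profD(2)[OF in_D[OF that]]], of a]
        DERIV_cmult_right[OF along[OF profD(3)[OF in_D[OF that]]], of b]] hessian_pos[OF in_D[OF that] ab]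
    by blast
  have "\<exists>z>0. z < 1 \<and> V (s + 1 * a) (t + 1 * b) - V (s + 0 * a) (t + 0 * b) = (1 - 0) * psi z"
    by (rule MVT2) (auto intro: d1)
  then obtain z where z: "0 < z" "z < 1" "V (s + 1 * a) (t + 1 * b) - V (s + 0 * a) (t + 0 * b) = psi z"
    by auto
  have "psi 0 < psi z"
    by (rule DERIV_pos_imp_increasing[OF z(1)]) (use d2 z in auto)
  then show ?thesis using z(3) by (simp add: psi_def a_def b_def)
qed

text \<open>Supporting planes of the profile stay below the value 0 on the edge
  \<open>s = 0\<close>: otherwise one of them would exceed \<open>V\<close> at a point
  \<open>(r, t')\<close> with \<open>r\<close> small, where \<open>V \<le> B * r\<close>.\<close>

lemma planar_support_edge:
  assumes st: "0 < s" "s < 1 / 2" "\<bar>t\<bar> < 1" and t': "\<bar>t'\<bar> < 1"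
  shows "V s t - Vs s t * s + Vt s t * (t' - t) \<le> 0"
proof (rule ccontr)
  define c where "c = V s t - Vs s t * s + Vt s t * (t' - t)"
  assume "\<not> ?thesis"
  then have c: "0 < c" by (simp add: c_def)
  define r where "r = min (s / 2) (c / (2 * B))"
  have r: "0 < r" "r < 1 / 2" "r < s" "B * r < c"
  proof -
    show "0 < r" "r < 1 / 2" "r < s" using st c B_pos by (auto simp: r_def)
    have "B * r \<le> B * (c / (2 * B))" using B_pos by (intro mult_left_mono) (auto simp: r_def)
    also have "\<dots> = c / 2" using B_pos by simp
    finally show "B * r < c" using c by linarith
  qed
  have "V s t + Vs s t * (r - s) + Vt s t * (t' - t) < V r t'"
    using planar_support[OF st r(1,2) t'] r by simp
  also have "\<dots> \<le> B * r" using profD(7)[OF r(1,2) t'] .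
  finally have "c + Vs s t * r < B * r" by (simp add: c_def algebra_simps)
  then show False using r(4) mult_pos_pos[OF Vs_pos[OF st] r(1)] by linarith
qed

definition R :: "real ^ 'n \<Rightarrow> real" where "R x = norm (drop_coord k x)"

definition v :: "real ^ 'n \<Rightarrow> real" where
  "v x = (if R x \<le> 1 / 2 then 0 else V (R x - 1 / 2) (x $ k))"

definition e :: "real ^ 'n \<Rightarrow> real ^ 'n" where "e x = drop_coord k x /\<^sub>R R x"

text \<open>A selection of subgradients rather than the gradient: on the interface, where
  \<open>v\<close> has a kink, 0 is one subgradient among many.\<close>

definition v_grad :: "real ^ 'n \<Rightarrow> real ^ 'n" where
  "v_grad x = (if R x \<le> 1 / 2 then 0 else
     Vs (R x - 1 / 2) (x $ k) *\<^sub>R e x + Vt (R x - 1 / 2) (x $ k) *\<^sub>R axis k 1)"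

definition outer :: "(real ^ 'n) set" where "outer = {x \<in> ball 0 1. 1 / 2 < R x}"

lemma outerD:
  assumes "x \<in> outer"
  shows "1 / 2 < R x" "0 < R x - 1 / 2" "R x - 1 / 2 < 1 / 2" "\<bar>x $ k\<bar> < 1" "0 < R x"
  using assms ball_drop_coord[of x k] by (auto simp: outer_def R_def)

lemma R_continuous: "continuous_on S R"
  unfolding R_def[abs_def]
  by (intro continuous_on_norm bounded_linear.continuous_on[OF bounded_linear_drop_coord] continuous_on_id)

lemma open_outer: "open outer"
proof -
  have "outer = ball 0 1 \<inter> {x. 1 / 2 < R x}" by (auto simp: outer_def)
  then show ?thesis
    using open_Collect_less[OF continuous_on_const R_continuous, of "1 / 2"] by auto
qed

lemma e_inner:
  assumes "0 < R x"
  shows "e x \<bullet> e x = 1" "e x \<bullet> axis k 1 = 0" "axis k 1 \<bullet> e x = 0" "e x \<bullet> x = R x" "e x \<bullet> y \<le> R y"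
    "norm (e x) = 1" "drop_coord k x = R x *\<^sub>R e x"
proof -
  show n: "norm (e x) = 1" using assms by (simp add: e_def R_def)
  then show "e x \<bullet> e x = 1" by (simp add: dot_square_norm)
  show "e x \<bullet> axis k 1 = 0" "axis k 1 \<bullet> e x = 0" by (simp_all add: e_def)
  have ey: "e x \<bullet> y = e x \<bullet> drop_coord k y" for y
    by (simp add: e_def inner_drop_coord)
  show "drop_coord k x = R x *\<^sub>R e x" using assms by (simp add: e_def)
  show "e x \<bullet> x = R x"
    using assms by (subst ey) (simp add: e_def R_def dot_square_norm power2_eq_square)
  show "e x \<bullet> y \<le> R y"
    using norm_cauchy_schwarz[of "e x" "drop_coord k y"] n by (subst ey) (simp add: R_def)
qed

lemma v_outer: "x \<in> outer \<Longrightarrow> v x = V (R x - 1 / 2) (x $ k)"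
  using outerD(1)[of x] by (simp add: v_def)

lemma v_grad_outer: "x \<in> outer \<Longrightarrow>
    v_grad x = Vs (R x - 1 / 2) (x $ k) *\<^sub>R e x + Vt (R x - 1 / 2) (x $ k) *\<^sub>R axis k 1"
  using outerD(1)[of x] by (simp add: v_grad_def)

lemma v_outer_pos: "x \<in> outer \<Longrightarrow> 0 < v x"
  using v_outer V_pos outerD by simp

lemma v_inner: "R x \<le> 1 / 2 \<Longrightarrow> v x = 0"
  by (simp add: v_def)

lemma v_nonneg: "x \<in> ball 0 1 \<Longrightarrow> 0 \<le> v x"
  using v_outer_pos[of x] v_inner[of x] by (cases "R x \<le> 1 / 2") (auto simp: outer_def less_imp_le)

text \<open>The profile increases in \<open>s\<close>, and \<open>R y \<ge> e x \<bullet> y\<close>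
  with equality at \<open>x\<close>. So replacing \<open>R y\<close> by the linear function
  \<open>e x \<bullet> y\<close> only lowers the planar support, and the planar inequalities apply,
  in the form for the edge if \<open>y\<close> lies in the cylinder.\<close>

lemma v_grad_support:
  assumes x: "x \<in> ball 0 1" and y: "y \<in> ball 0 1"
  shows "v x + v_grad x \<bullet> (y - x) \<le> v y"
proof (cases "R x \<le> 1 / 2")
  case True
  then show ?thesis using v_nonneg[OF y] by (simp add: v_grad_def v_inner)
next
  case False
  then have xo: "x \<in> outer" using x by (simp add: outer_def)
  note D = outerD(2,3,4)[OF xo]
  let ?s = "R x - 1 / 2" and ?t = "x $ k"
  have "v_grad x \<bullet> (y - x) = Vs ?s ?t * (e x \<bullet> y - R x) + Vt ?s ?t * (y $ k - x $ k)"
    using e_inner[OF outerD(5)[OF xo]] unfolding v_grad_outer[OF xo]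
    by (simp add: inner_add_left inner_diff_right inner_axis' algebra_simps)
  also have "\<dots> \<le> Vs ?s ?t * (R y - R x) + Vt ?s ?t * (y $ k - x $ k)"
    using e_inner(5)[OF outerD(5)[OF xo], of y] Vs_pos[OF D] by (intro add_right_mono mult_left_mono) auto
  finally have le: "v_grad x \<bullet> (y - x) \<le> Vs ?s ?t * (R y - R x) + Vt ?s ?t * (y $ k - x $ k)" .
  show ?thesis
  proof (cases "R y \<le> 1 / 2")
    case True
    have "V ?s ?t - Vs ?s ?t * ?s + Vt ?s ?t * (y $ k - x $ k) \<le> 0"
      by (rule planar_support_edge[OF D ball_drop_coord(2)[OF y]])
    moreover have "Vs ?s ?t * (R y - R x) \<le> Vs ?s ?t * (- ?s)"
      using True Vs_pos[OF D] by (intro mult_left_mono) auto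
    then have "Vs ?s ?t * (R y - R x) \<le> - (Vs ?s ?t * ?s)" by (simp only: mult_minus_right)
    ultimately show ?thesis using le unfolding v_outer[OF xo] v_inner[OF True] by linarith
  next
    case False
    then have yo: "y \<in> outer" using y by (simp add: outer_def)
    show ?thesis
    proof (cases "R y = R x \<and> y $ k = x $ k")
      case True
      then show ?thesis using le by (simp add: v_outer xo yo)
    next
      case False
      then have "V ?s ?t + Vs ?s ?t * ((R y - 1 / 2) - ?s) + Vt ?s ?t * (y $ k - x $ k) < V (R y - 1 / 2) (y $ k)"
        by (intro planar_support[OF D outerD(2,3,4)[OF yo]]) auto
      then show ?thesis using le by (simp add: v_outer xo yo)
    qed
  qed
qed

lemma v_convex: "convex_on (ball 0 1) v"
  by (rule convex_on_support[OF convex_ball]) (use v_grad_support in blast)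

lemma v_grad_bound:
  assumes "x \<in> ball 0 1" shows "norm (v_grad x) \<le> 2 * B"
proof (cases "R x \<le> 1 / 2")
  case True
  then show ?thesis using B_pos by (simp add: v_grad_def)
next
  case False
  then have xo: "x \<in> outer" using assms by (simp add: outer_def)
  note D = outerD(2,3,4)[OF xo]
  have "norm (v_grad x) \<le> norm (Vs (R x - 1 / 2) (x $ k) *\<^sub>R e x) + norm (Vt (R x - 1 / 2) (x $ k) *\<^sub>R axis k (1::real))"
    unfolding v_grad_outer[OF xo] by (rule norm_triangle_ineq)
  also have "\<dots> \<le> B + B"
    using profD(9,10)[OF D] Vs_pos[OF D] e_inner(6)[OF outerD(5)[OF xo]]
    by (intro add_mono) (simp_all add: norm_axis_1)
  finally show ?thesis by simp
qed

text \<open>The support inequality is used at both points, so no integration along a segment across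
  the interface is needed.\<close>

lemma v_lipschitz: "(2 * B)-lipschitz_on (ball 0 1) v"
proof (rule lipschitz_onI)
  show "0 \<le> 2 * B" using B_pos by simp
  have one: "v x - v y \<le> 2 * B * norm (x - y)" if "x \<in> ball 0 1" "y \<in> ball 0 1" for x y
  proof -
    have "v x - v y \<le> v_grad x \<bullet> (x - y)" using v_grad_support[OF that] by (simp add: inner_diff_right)
    also have "\<dots> \<le> norm (v_grad x) * norm (x - y)" by (rule norm_cauchy_schwarz)
    also have "\<dots> \<le> 2 * B * norm (x - y)" using v_grad_bound[OF that(1)] by (intro mult_right_mono) auto
    finally show ?thesis .
  qed
  fix x y assume "x \<in> ball (0 :: real ^ 'n) 1" "y \<in> ball (0 :: real ^ 'n) 1"
  then show "dist (v x) (v y) \<le> 2 * B * dist x y"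
    using one[of x y] one[of y x] by (auto simp: dist_norm norm_minus_commute abs_le_iff)
qed

lemma v_locally_lipschitz: "locally_lipschitz_on (ball 0 1) v"
  unfolding locally_lipschitz_on_def
proof
  fix x :: "real ^ 'n"
  have "(2 * B)-lipschitz_on (ball x 1 \<inter> ball 0 1) v"
    by (rule lipschitz_on_subset[OF v_lipschitz]) simp
  then show "\<exists>r>0. \<exists>L. L-lipschitz_on (ball x r \<inter> ball 0 1) v" using zero_less_one by blast
qed

lemma v_coincidence: "coincidence_set (ball 0 1) v = {x. norm (drop_coord k x) \<le> 1 / 2} \<inter> ball 0 1"
proof -
  have "v x = 0 \<longleftrightarrow> R x \<le> 1 / 2" if "x \<in> ball 0 1" for x
    using v_inner[of x] v_outer_pos[of x] that by (cases "R x \<le> 1 / 2") (auto simp: outer_def)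
  then show ?thesis by (auto simp: coincidence_set_def R_def)
qed

end

section \<open>Hessian, Monge-Ampere measure and free boundary\<close>

context radial_profile
begin

lemma R_has_derivative:
  assumes "0 < R x"
  shows "(R has_derivative (\<lambda>h. e x \<bullet> h)) (at x)"
proof -
  have nz: "drop_coord k x \<noteq> 0" using assms by (auto simp: R_def)
  have "(R has_derivative (\<lambda>h. drop_coord k h \<bullet> sgn (drop_coord k x))) (at x)"
    unfolding R_def[abs_def]
    by (rule has_derivative_compose[OF bounded_linear_imp_has_derivative[OF bounded_linear_drop_coord] has_derivative_norm[OF nz]])
  moreover have "drop_coord k h \<bullet> sgn (drop_coord k x) = e x \<bullet> h" for h
    using inner_drop_coord[of k x h] by (simp add: sgn_div_norm e_def R_def inner_commute)
  ultimately show ?thesis by simp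
qed

lemma nth_has_derivative: "((\<lambda>y. y $ k) has_derivative (\<lambda>h. h $ k)) (at x)"
  by (rule bounded_linear_imp_has_derivative[OF bounded_linear_vec_nth])

lemma planar_compose:
  assumes x: "x \<in> outer"
    and F: "((\<lambda>p. F (fst p) (snd p)) has_derivative (\<lambda>h. P * fst h + Q * snd h)) (at (R x - 1 / 2, x $ k))"
  shows "((\<lambda>y. F (R y - 1 / 2) (y $ k)) has_derivative (\<lambda>h. P * (e x \<bullet> h) + Q * h $ k)) (at x)"
proof -
  have "((\<lambda>y. R y - 1 / 2) has_derivative (\<lambda>h. e x \<bullet> h - 0)) (at x)"
    by (intro has_derivative_diff R_has_derivative outerD(5)[OF x] has_derivative_const)
  then have "((\<lambda>y. (R y - 1 / 2, y $ k)) has_derivative (\<lambda>h. (e x \<bullet> h, h $ k))) (at x)"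
    by (intro has_derivative_Pair nth_has_derivative) simp
  from has_derivative_compose[OF this F] show ?thesis by simp
qed

lemma v_has_derivative:
  assumes x: "x \<in> outer"
  shows "(v has_derivative (\<lambda>h. v_grad x \<bullet> h)) (at x)"
proof -
  have "((\<lambda>y. V (R y - 1 / 2) (y $ k)) has_derivative
      (\<lambda>h. Vs (R x - 1 / 2) (x $ k) * (e x \<bullet> h) + Vt (R x - 1 / 2) (x $ k) * h $ k)) (at x)"
    by (rule planar_compose[OF x profD(1)[OF outerD(2,3,4)[OF x]]])
  then have "((\<lambda>y. V (R y - 1 / 2) (y $ k)) has_derivative (\<lambda>h. v_grad x \<bullet> h)) (at x)"
    by (simp add: v_grad_outer[OF x] inner_add_left inner_axis')
  then show ?thesis
    by (rule has_derivative_transform_within_open[OF _ open_outer x]) (simp add: v_outer)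
qed

definition grad_slope :: "real ^ 'n \<Rightarrow> real" where
  "grad_slope x = Vs (R x - 1 / 2) (x $ k) / R x"

text \<open>Eigenvalue \<open>Vs / R\<close> on the directions orthogonal to \<open>e x\<close> and
  the axis, corrected on the plane of these two to the Hessian of the profile. The form, a multiple
  of the identity plus a rank-two part, is that of \<open>det_rank_two_update\<close>.\<close>

definition v_hess :: "real ^ 'n \<Rightarrow> real ^ 'n \<Rightarrow> real ^ 'n" where
  "v_hess x h = grad_slope x *\<^sub>R h
      + ((Vss (R x - 1 / 2) (x $ k) - grad_slope x) * (e x \<bullet> h) + Vst (R x - 1 / 2) (x $ k) * (axis k 1 \<bullet> h)) *\<^sub>R e x
      + (Vst (R x - 1 / 2) (x $ k) * (e x \<bullet> h) + (Vtt (R x - 1 / 2) (x $ k) - grad_slope x) * (axis k 1 \<bullet> h)) *\<^sub>R axis k 1"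

text \<open>The radial part is written as \<open>grad_slope\<close> times \<open>drop_coord\<close>,
  a scalar times a linear map, which avoids differentiating the unit field \<open>e\<close>.\<close>

lemma v_grad_has_derivative:
  assumes x: "x \<in> outer"
  shows "(v_grad has_derivative v_hess x) (at x)"
proof -
  define p where "p = grad_slope x"
  let ?ss = "Vss (R x - 1 / 2) (x $ k)" and ?st = "Vst (R x - 1 / 2) (x $ k)" and ?tt = "Vtt (R x - 1 / 2) (x $ k)"
  let ?vs = "Vs (R x - 1 / 2) (x $ k)"
  note D = outerD(2,3,4)[OF x]
  note Rx = outerD(5)[OF x]
  have d1: "((\<lambda>y. Vs (R y - 1 / 2) (y $ k)) has_derivative (\<lambda>h. ?ss * (e x \<bullet> h) + ?st * h $ k)) (at x)"
    by (rule planar_compose[OF x profD(2)[OF D]])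
  have d2: "((\<lambda>y. Vt (R y - 1 / 2) (y $ k)) has_derivative (\<lambda>h. ?st * (e x \<bullet> h) + ?tt * h $ k)) (at x)"
    by (rule planar_compose[OF x profD(3)[OF D]])
  have d3: "(grad_slope has_derivative (\<lambda>h. ((?ss * (e x \<bullet> h) + ?st * h $ k) * R x - ?vs * (e x \<bullet> h)) / (R x * R x))) (at x)"
    unfolding grad_slope_def[abs_def]
    by (rule has_derivative_divide'[OF d1 R_has_derivative[OF Rx]]) (use Rx in simp)
  have d4: "((\<lambda>y. grad_slope y *\<^sub>R drop_coord k y) has_derivative
     (\<lambda>h. grad_slope x *\<^sub>R drop_coord k h +
        (((?ss * (e x \<bullet> h) + ?st * h $ k) * R x - ?vs * (e x \<bullet> h)) / (R x * R x)) *\<^sub>R drop_coord k x)) (at x)"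
    by (rule has_derivative_scaleR[OF d3 bounded_linear_imp_has_derivative[OF bounded_linear_drop_coord]])
  have d5: "((\<lambda>y. Vt (R y - 1 / 2) (y $ k) *\<^sub>R axis k (1::real)) has_derivative
     (\<lambda>h. (?st * (e x \<bullet> h) + ?tt * h $ k) *\<^sub>R axis k 1)) (at x)"
    by (rule has_derivative_scaleR_left[OF d2])
  have d6: "(v_grad has_derivative (\<lambda>h. (grad_slope x *\<^sub>R drop_coord k h +
        (((?ss * (e x \<bullet> h) + ?st * h $ k) * R x - ?vs * (e x \<bullet> h)) / (R x * R x)) *\<^sub>R drop_coord k x)
        + (?st * (e x \<bullet> h) + ?tt * h $ k) *\<^sub>R axis k 1)) (at x)"
  proof (rule has_derivative_transform_within_open[OF has_derivative_add[OF d4 d5] open_outer x])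
    fix y assume y: "y \<in> outer"
    show "grad_slope y *\<^sub>R drop_coord k y + Vt (R y - 1 / 2) (y $ k) *\<^sub>R axis k 1 = v_grad y"
      unfolding v_grad_outer[OF y] by (simp only: grad_slope_def e_def divide_inverse scaleR_scaleR)
  qed
  show ?thesis
  proof (rule has_derivative_eq_rhs[OF d6], rule ext)
    fix h
    have h: "axis k 1 \<bullet> h = h $ k" by (simp add: inner_axis')
    have c: "((?ss * (e x \<bullet> h) + ?st * h $ k) * R x - ?vs * (e x \<bullet> h)) / (R x * R x) * R x
        = (?ss - p) * (e x \<bullet> h) + ?st * h $ k"
      using Rx by (simp add: p_def grad_slope_def field_simps)
    have "(((?ss * (e x \<bullet> h) + ?st * h $ k) * R x - ?vs * (e x \<bullet> h)) / (R x * R x)) *\<^sub>R drop_coord k x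
      = ((?ss - p) * (e x \<bullet> h) + ?st * h $ k) *\<^sub>R e x"
      unfolding e_inner(7)[OF Rx] scaleR_scaleR c ..
    moreover have "p *\<^sub>R drop_coord k h = p *\<^sub>R h - (p * h $ k) *\<^sub>R axis k 1"
      by (simp add: drop_coord_eq scaleR_diff_right)
    ultimately show "(grad_slope x *\<^sub>R drop_coord k h +
        (((?ss * (e x \<bullet> h) + ?st * h $ k) * R x - ?vs * (e x \<bullet> h)) / (R x * R x)) *\<^sub>R drop_coord k x)
        + (?st * (e x \<bullet> h) + ?tt * h $ k) *\<^sub>R axis k 1 = v_hess x h"
      unfolding v_hess_def h p_def [symmetric] by (simp add: algebra_simps)
  qed
qed

lemma card_wo: "CARD('n wo) = CARD('n)"
  using type_definition.card[OF type_definition_wo] by simp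

text \<open>The \<open>n - 2\<close> tangential directions contribute \<open>(Vs / R)^(n-2)\<close>
  and the remaining plane the determinant of the profile; with \<open>R = 1/2 + s\<close> the
  profile equation leaves exactly \<open>v^q\<close>.\<close>

lemma v_grad_jacobian:
  assumes x: "x \<in> outer"
  shows "det (matrix (\<lambda>h. to_wo (v_hess x (of_wo h)))) = v x powr q"
proof -
  define p where "p = grad_slope x"
  let ?s = "R x - 1 / 2" and ?t = "x $ k"
  let ?ss = "Vss ?s ?t" and ?st = "Vst ?s ?t" and ?tt = "Vtt ?s ?t"
  note D = outerD(2,3,4)[OF x]
  note Rx = outerD(5)[OF x]
  define E where "E = to_wo (e x)"
  define F where "F = to_wo (axis k (1::real))"
  have EF: "E \<bullet> E = 1" "F \<bullet> F = 1" "E \<bullet> F = 0"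
    using e_inner[OF Rx] by (simp_all add: E_def F_def inner_to_wo inner_axis_axis)
  have p: "p \<noteq> 0" using Vs_pos[OF D] Rx by (simp add: p_def grad_slope_def)
  \<comment> \<open>\<open>?tt\<close> is the quantity \<open>p + c\<close> of the rank-two formula;
    if it vanished, the determinant could not be positive.\<close>
  have tt: "?tt \<noteq> 0"
  proof
    assume "?tt = 0"
    then show False using det_pos[OF D] by simp
  qed
  have eq: "(\<lambda>h. to_wo (v_hess x (of_wo h)))
    = (\<lambda>h. p *\<^sub>R h + ((?ss - p) * (E \<bullet> h) + ?st * (F \<bullet> h)) *\<^sub>R E + (?st * (E \<bullet> h) + (?tt - p) * (F \<bullet> h)) *\<^sub>R F)"
    unfolding v_hess_def p_def [symmetric] E_def F_def inner_to_wo
    by (simp add: linear_add[OF linear_to_wo] linear_cmul[OF linear_to_wo])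
  have "det (matrix (\<lambda>h. p *\<^sub>R h + ((?ss - p) * (E \<bullet> h) + ?st * (F \<bullet> h)) *\<^sub>R E + (?st * (E \<bullet> h) + (?tt - p) * (F \<bullet> h)) *\<^sub>R F))
    = p ^ (CARD('n wo) - 2) * ((p + (?ss - p)) * (p + (?tt - p)) - ?st\<^sup>2)"
    by (rule det_rank_two_update[OF _ EF p]) (use card card_wo tt in simp_all)
  also have "\<dots> = p ^ (CARD('n) - 2) * (?ss * ?tt - ?st\<^sup>2)"
    by (simp only: card_wo add_diff_cancel_left' add_diff_eq)
  also have "\<dots> = (Vs ?s ?t ^ (CARD('n) - 2) * (?ss * ?tt - ?st\<^sup>2)) / R x ^ (CARD('n) - 2)"
    by (simp only: p_def grad_slope_def power_divide times_divide_eq_left)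
  also have "\<dots> = v x powr q"
    unfolding profD(5)[OF D] using Rx by (simp add: v_outer[OF x])
  finally show ?thesis unfolding eq .
qed

text \<open>The part of the gradient orthogonal to the axis gives \<open>Vs\<close> by its norm and
  \<open>e\<close> by its direction; the component along the axis gives \<open>Vt\<close>. Two
  distinct planar points with the same \<open>Vs\<close> and \<open>Vt\<close> would satisfy strict
  support inequalities that contradict each other.\<close>

lemma v_grad_inj: "inj_on v_grad outer"
proof (rule inj_onI)
  fix x y assume xy: "x \<in> outer" "y \<in> outer" and eq: "v_grad x = v_grad y"
  let ?s = "R x - 1 / 2" and ?t = "x $ k" and ?s' = "R y - 1 / 2" and ?t' = "y $ k"
  note Dx = outerD(2,3,4)[OF xy(1)] and Dy = outerD(2,3,4)[OF xy(2)]
  note Rx = outerD(5)[OF xy(1)] and Ry = outerD(5)[OF xy(2)]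
  have drop: "drop_coord k (v_grad z) = Vs (R z - 1 / 2) (z $ k) *\<^sub>R e z" if "z \<in> outer" for z
  proof -
    have "e z $ k = 0" by (simp add: e_def)
    then show ?thesis unfolding v_grad_outer[OF that] by (simp add: drop_coord_eq)
  qed
  have kth: "v_grad z $ k = Vt (R z - 1 / 2) (z $ k)" if "z \<in> outer" for z
    unfolding v_grad_outer[OF that] by (simp add: e_def)
  have ve: "Vs ?s ?t *\<^sub>R e x = Vs ?s' ?t' *\<^sub>R e y"
    using drop[OF xy(1)] drop[OF xy(2)] eq by simp
  have "norm (Vs ?s ?t *\<^sub>R e x) = norm (Vs ?s' ?t' *\<^sub>R e y)" using ve by simp
  then have vs: "Vs ?s ?t = Vs ?s' ?t'"
    using e_inner(6)[OF Rx] e_inner(6)[OF Ry] Vs_pos[OF Dx] Vs_pos[OF Dy] by simp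
  then have ee: "e x = e y" using ve Vs_pos[OF Dy] by simp
  have vt: "Vt ?s ?t = Vt ?s' ?t'" using kth[OF xy(1)] kth[OF xy(2)] eq by simp
  have st: "?s' = ?s \<and> ?t' = ?t"
  proof (rule ccontr)
    assume "\<not> ?thesis"
    then have ne: "?s' \<noteq> ?s \<or> ?t' \<noteq> ?t" "?s \<noteq> ?s' \<or> ?t \<noteq> ?t'" by auto
    have "V ?s ?t + Vs ?s ?t * (?s' - ?s) + Vt ?s ?t * (?t' - ?t) < V ?s' ?t'"
      by (rule planar_support[OF Dx Dy ne(1)])
    moreover have "V ?s' ?t' + Vs ?s' ?t' * (?s - ?s') + Vt ?s' ?t' * (?t - ?t') < V ?s ?t"
      by (rule planar_support[OF Dy Dx ne(2)])
    moreover have "Vs ?s' ?t' * (?s - ?s') = - (Vs ?s ?t * (?s' - ?s))"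
      "Vt ?s' ?t' * (?t - ?t') = - (Vt ?s ?t * (?t' - ?t))"
      unfolding vs vt by (simp_all add: algebra_simps)
    ultimately show False by linarith
  qed
  then have "drop_coord k x = drop_coord k y"
    using e_inner(7)[OF Rx] e_inner(7)[OF Ry] ee by simp
  then show "x = y" using st by (simp add: drop_coord_eq)
qed

text \<open>For a subgradient \<open>p\<close>, the function \<open>v y - p \<bullet> y\<close> has
  a minimum at \<open>x\<close>, where it is differentiable.\<close>

lemma subdiff_outer:
  assumes x: "x \<in> outer"
  shows "subdiff (ball 0 1) v x = {v_grad x}"
proof (intro equalityI subsetI)
  fix p assume "p \<in> subdiff (ball 0 1) v x"
  then have p: "\<forall>y\<in>ball 0 1. v x + p \<bullet> (y - x) \<le> v y" by (simp add: subdiff_def)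
  have xb: "x \<in> ball 0 1" using x by (simp add: outer_def)
  have "((\<lambda>y. v y - p \<bullet> y) has_derivative (\<lambda>h. v_grad x \<bullet> h - p \<bullet> h)) (at x)"
    by (intro has_derivative_diff v_has_derivative[OF x] bounded_linear_imp_has_derivative[OF bounded_linear_inner_right])
  moreover have "\<forall>y\<in>ball 0 1. v x - p \<bullet> x \<le> v y - p \<bullet> y"
    using p by (auto simp: inner_diff_right)
  ultimately have "(\<lambda>h. v_grad x \<bullet> h - p \<bullet> h) = (\<lambda>h. 0)"
    using differential_zero_maxmin[OF xb open_ball] by blast
  then have "v_grad x \<bullet> (v_grad x - p) - p \<bullet> (v_grad x - p) = 0" by meson
  then have "(v_grad x - p) \<bullet> (v_grad x - p) = 0" by (simp add: inner_diff_left)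
  then show "p \<in> {v_grad x}" by simp
next
  fix p assume "p \<in> {v_grad x}"
  moreover have "x \<in> ball 0 1" using x by (simp add: outer_def)
  ultimately show "p \<in> subdiff (ball 0 1) v x" using v_grad_support by (simp add: subdiff_def)
qed

lemma shift_axis:
  assumes "x \<in> ball (0 :: real ^ 'n) 1"
  obtains r where "0 < r" "x + r *\<^sub>R axis k 1 \<in> ball 0 1" "x - r *\<^sub>R axis k 1 \<in> ball 0 1"
proof -
  define r where "r = (1 - norm x) / 2"
  have n: "norm x < 1" using assms by simp
  have "norm (r *\<^sub>R axis k (1::real)) = r" using n by (simp add: r_def norm_axis_1)
  then have "norm (x + r *\<^sub>R axis k 1) \<le> norm x + r" "norm (x - r *\<^sub>R axis k 1) \<le> norm x + r"
    using norm_triangle_ineq[of x "r *\<^sub>R axis k 1"] norm_triangle_ineq4[of x "r *\<^sub>R axis k 1"] by simp_all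
  moreover have "norm x + r < 1" "0 < r" using n by (simp_all add: r_def field_simps)
  ultimately show ?thesis using that[of r] by simp
qed

lemma drop_coord_shift: "drop_coord k (x + c *\<^sub>R axis k 1) = drop_coord k x"
  "drop_coord k (x - c *\<^sub>R axis k 1) = drop_coord k x"
  by (simp_all add: drop_coord_eq algebra_simps)

text \<open>\<open>v\<close> vanishes on a short segment through \<open>x\<close> parallel to the
  axis, so a subgradient has no component along it. All subgradients over the cylinder therefore lie
  in one hyperplane.\<close>

lemma subdiff_inner:
  assumes x: "x \<in> ball 0 1" "R x \<le> 1 / 2" and p: "p \<in> subdiff (ball 0 1) v x"
  shows "p $ k = 0"
proof -
  obtain r where r: "0 < r" "x + r *\<^sub>R axis k 1 \<in> ball 0 1" "x - r *\<^sub>R axis k 1 \<in> ball 0 1"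
    using shift_axis[OF x(1)] .
  have z: "v x = 0" "v (x + r *\<^sub>R axis k 1) = 0" "v (x - r *\<^sub>R axis k 1) = 0"
    using x(2) by (simp_all add: v_inner R_def drop_coord_shift)
  have "p \<bullet> (r *\<^sub>R axis k 1) \<le> 0"
    using p r(2) z unfolding subdiff_def by fastforce
  moreover have "p \<bullet> (- (r *\<^sub>R axis k 1)) \<le> 0"
    using p r(3) z unfolding subdiff_def by fastforce
  ultimately show ?thesis using r(1) by (simp add: inner_axis mult_le_0_iff zero_le_mult_iff)
qed

lemma v_aleksandrov:
  "aleksandrov_solution (ball 0 1) (\<lambda>x. v x powr q * indicator {y. v y > 0} x) v"
  unfolding aleksandrov_solution_def
proof (intro conjI ballI impI v_convex)
  fix A :: "(real ^ 'n) set" assume A: "A \<in> sets borel" "A \<subseteq> ball 0 1"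
  define S where "S = A \<inter> outer"
  define N where "N = (\<Union>x\<in>A - outer. subdiff (ball 0 1) v x)"
  have S: "S \<in> sets borel" using A open_outer by (auto simp: S_def)
  then have Sl: "S \<in> sets lebesgue" by auto
  have split: "(\<Union>x\<in>A. subdiff (ball 0 1) v x) = v_grad ` S \<union> N"
    using subdiff_outer by (auto simp: S_def N_def)
  have "N \<subseteq> {p. axis k 1 \<bullet> p = 0}"
    using subdiff_inner A(2) by (fastforce simp: N_def outer_def inner_axis' not_less)
  moreover have "negligible {p :: real ^ 'n. axis k 1 \<bullet> p = 0}"
    by (rule negligible_hyperplane) (simp add: axis_eq_0_iff)
  ultimately have "negligible N" by (rule negligible_subset[rotated])
  then have N: "N \<in> null_sets lebesgue" by (simp add: negligible_iff_null_sets)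
  \<comment> \<open>Cut off outside \<open>outer\<close>, where \<open>v\<close> is continuous; this
    gives measurability on the whole space without looking at \<open>v\<close> beyond the
    ball.\<close>
  define D where "D x = indicator outer x *\<^sub>R (v x powr q)" for x
  have vc: "continuous_on outer v"
    using v_has_derivative has_derivative_continuous continuous_at_imp_continuous_on by blast
  have powc: "continuous_on outer (\<lambda>x. v x powr q)"
  proof (intro continuous_on_powr vc continuous_on_const ballI)
    fix x assume "x \<in> outer"
    from v_outer_pos[OF this] show "v x \<noteq> 0" by simp
  qed
  have "D \<in> borel_measurable borel"
    unfolding D_def[abs_def]
    by (rule borel_measurable_continuous_on_indicator[OF borel_open[OF open_outer] powc])
  then have Dm: "D \<in> borel_measurable lebesgue"
    by (intro measurable_completion) simp
  have D_outer: "D x = v x powr q" if "x \<in> outer" for x using that by (simp add: D_def)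
  have bound: "D x \<le> B powr q" for x
  proof (cases "x \<in> outer")
    case True
    note Dx = outerD(2,3,4)[OF True]
    have "v x \<le> B * (R x - 1 / 2)" unfolding v_outer[OF True] by (rule profD(7)[OF Dx])
    also have "\<dots> \<le> B * 1" using B_pos Dx by (intro mult_left_mono) auto
    finally show ?thesis
      unfolding D_outer[OF True] using v_outer_pos[OF True] q by (intro powr_mono2) auto
  qed (simp add: D_def)
  have "(\<integral>\<^sup>+x\<in>S. ennreal (D x) \<partial>lebesgue) \<le> (\<integral>\<^sup>+x. ennreal (B powr q) * indicator (ball (0 :: real ^ 'n) 1) x \<partial>lebesgue)"
  proof (rule nn_integral_mono)
    fix x :: "real ^ 'n"
    show "ennreal (D x) * indicator S x \<le> ennreal (B powr q) * indicator (ball 0 1) x"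
      using A(2) ennreal_leI[OF bound[of x]] by (auto simp: S_def indicator_def)
  qed
  also have "\<dots> = ennreal (B powr q) * emeasure lebesgue (ball (0 :: real ^ 'n) 1)"
    by (rule nn_integral_cmult_indicator) simp
  also have "\<dots> < \<infinity>"
    using emeasure_bounded_finite[of "ball (0 :: real ^ 'n) 1"] by (simp add: ennreal_mult_less_top)
  finally have fin: "(\<integral>\<^sup>+x\<in>S. ennreal (D x) \<partial>lebesgue) < \<infinity>" .
  have So: "x \<in> outer" if "x \<in> S" for x using that by (simp add: S_def)
  have inj: "inj_on v_grad S" using v_grad_inj by (rule inj_on_subset) (simp add: S_def)
  have Djac: "D x = \<bar>det (matrix (\<lambda>h. to_wo (v_hess x (of_wo h))))\<bar>"
    if "x \<in> S" for x
    unfolding v_grad_jacobian[OF So[OF that]] D_outer[OF So[OF that]] by simp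
  note img = emeasure_differentiable_image[OF Sl v_grad_has_derivative[OF So] inj Dm Djac fin]
  show "(\<Union>x\<in>A. subdiff (ball 0 1) v x) \<in> sets lebesgue"
    unfolding split using img(1) N by auto
  have "emeasure lebesgue (\<Union>x\<in>A. subdiff (ball 0 1) v x) = emeasure lebesgue (v_grad ` S)"
    unfolding split by (rule emeasure_Un_null_set[OF img(1) N])
  also have "\<dots> = (\<integral>\<^sup>+x\<in>S. ennreal (D x) \<partial>lebesgue)" by (rule img(2))
  also have "\<dots> = (\<integral>\<^sup>+x\<in>A. ennreal (v x powr q * indicator {y. v y > 0} x) \<partial>lebesgue)"
  proof (rule nn_integral_cong)
    fix x
    show "ennreal (D x) * indicator S x = ennreal (v x powr q * indicator {y. v y > 0} x) * indicator A x"
    proof (cases "x \<in> A")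
      case True
      show ?thesis
      proof (cases "x \<in> outer")
        case True
        then show ?thesis using \<open>x \<in> A\<close> v_outer_pos[OF True] by (simp add: S_def D_outer)
      next
        case False
        then have "v x = 0" using \<open>x \<in> A\<close> A(2) by (intro v_inner) (auto simp: outer_def)
        then show ?thesis using False by (simp add: S_def)
      qed
    qed (simp add: S_def)
  qed
  finally show "emeasure lebesgue (\<Union>x\<in>A. subdiff (ball 0 1) v x) =
      (\<integral>\<^sup>+x\<in>A. ennreal (v x powr q * indicator {y. v y > 0} x) \<partial>lebesgue)" .
qed

lemma frontier_cylinder:
  assumes x: "x \<in> ball (0 :: real ^ 'n) 1"
  shows "x \<in> frontier ({x. norm (drop_coord k x) \<le> 1 / 2} \<inter> ball 0 1) \<longleftrightarrow> norm (drop_coord k x) = 1 / 2"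
    (is "x \<in> frontier ?C \<longleftrightarrow> _")
proof -
  have cont: "continuous_on UNIV (\<lambda>x :: real ^ 'n. norm (drop_coord k x))"
    using R_continuous[of UNIV] by (simp add: R_def[abs_def])
  show ?thesis
  proof
    assume xf: "x \<in> frontier ?C"
    have "norm (drop_coord k x) \<le> 1 / 2"
    proof -
      have "closed {x. norm (drop_coord k x) \<le> 1 / 2}"
        by (rule closed_Collect_le[OF cont continuous_on_const])
      then have "closure ?C \<subseteq> {x. norm (drop_coord k x) \<le> 1 / 2}" by (intro closure_minimal) auto
      then show ?thesis using xf by (auto simp: frontier_def)
    qed
    moreover have "\<not> norm (drop_coord k x) < 1 / 2"
    proof
      assume lt: "norm (drop_coord k x) < 1 / 2"
      have "open ({x. norm (drop_coord k x) < 1 / 2} \<inter> ball 0 1)"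
        by (intro open_Int open_Collect_less[OF cont continuous_on_const] open_ball)
      moreover have "{x. norm (drop_coord k x) < 1 / 2} \<inter> ball 0 1 \<subseteq> ?C" by auto
      ultimately have "{x. norm (drop_coord k x) < 1 / 2} \<inter> ball 0 1 \<subseteq> interior ?C"
        by (rule interior_maximal[rotated])
      then have "x \<in> interior ?C" using lt x by blast
      then show False using xf by (simp add: frontier_def)
    qed
    ultimately show "norm (drop_coord k x) = 1 / 2" by simp
  next
    assume eq: "norm (drop_coord k x) = 1 / 2"
    have "x \<in> ?C" using eq x by simp
    moreover have "x \<notin> interior ?C"
    proof
      assume "x \<in> interior ?C"
      then obtain r where r: "0 < r" "ball x r \<subseteq> ?C" using mem_interior by blast
      \<comment> \<open>Stretching the part of \<open>x\<close> orthogonal to the axis leaves the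
        cylinder at once.\<close>
      define y where "y = x + r *\<^sub>R drop_coord k x"
      have "norm (y - x) < r" using eq r by (simp add: y_def)
      then have "y \<in> ?C" using r(2) by (auto simp: dist_norm norm_minus_commute)
      moreover have "drop_coord k y = (1 + r) *\<^sub>R drop_coord k x"
      proof -
        have "drop_coord k (drop_coord k x) = drop_coord k x" by (subst drop_coord_eq) simp
        then show ?thesis
          using linear_add[OF linear_drop_coord, of k x "r *\<^sub>R drop_coord k x"] linear_cmul[OF linear_drop_coord, of k r "drop_coord k x"]
          by (simp add: y_def scaleR_left_distrib)
      qed
      ultimately show False using eq r(1) by simp
    qed
    moreover have "?C \<subseteq> closure ?C" by (rule closure_subset)
    ultimately show "x \<in> frontier ?C" unfolding frontier_def by blast
  qed
qed

text \<open>Every point of the coincidence set is the midpoint of a segment in it parallel to the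
  axis, so there are no extreme points, let alone exposed ones.\<close>

lemma v_free_boundary_nsc:
  "free_boundary_nsc (ball 0 1) v = {x. norm (drop_coord k x) = 1 / 2} \<inter> ball 0 1"
proof -
  have "free_boundary (ball 0 1) v = {x. norm (drop_coord k x) = 1 / 2} \<inter> ball 0 1"
    unfolding free_boundary_def v_coincidence using frontier_cylinder by blast
  moreover have "free_boundary_sc (ball 0 1) v = {}"
  proof (rule ccontr)
    assume "free_boundary_sc (ball 0 1) v \<noteq> {}"
    then obtain x where x: "x \<in> ball 0 1" and ex: "{x} exposed_face_of coincidence_set (ball 0 1) v"
      by (auto simp: free_boundary_sc_def)
    then have "{x} face_of coincidence_set (ball 0 1) v" by (simp add: exposed_face_of_def)
    then have "x extreme_point_of coincidence_set (ball 0 1) v" by (simp add: face_of_singleton)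
    then have xC: "x \<in> coincidence_set (ball 0 1) v"
      and ext: "\<And>a b. a \<in> coincidence_set (ball 0 1) v \<Longrightarrow> b \<in> coincidence_set (ball 0 1) v \<Longrightarrow> x \<notin> open_segment a b"
      by (auto simp: extreme_point_of_def)
    obtain r where r: "0 < r" "x + r *\<^sub>R axis k 1 \<in> ball 0 1" "x - r *\<^sub>R axis k 1 \<in> ball 0 1"
      using shift_axis[OF x] .
    have "x + r *\<^sub>R axis k 1 \<in> coincidence_set (ball 0 1) v" "x - r *\<^sub>R axis k 1 \<in> coincidence_set (ball 0 1) v"
      using xC r unfolding v_coincidence by (auto simp: drop_coord_shift)
    moreover have "x = midpoint (x + r *\<^sub>R axis k 1) (x - r *\<^sub>R axis k 1)"
      by (simp add: midpoint_def algebra_simps flip: scaleR_2)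
    moreover have "x + r *\<^sub>R axis k 1 \<noteq> x - r *\<^sub>R axis k 1"
    proof
      assume eq: "x + r *\<^sub>R axis k 1 = x - r *\<^sub>R axis k 1"
      have "(x + r *\<^sub>R axis k 1) $ k = x $ k + r" "(x - r *\<^sub>R axis k 1) $ k = x $ k - r"
        by (simp_all add: axis_def)
      then have "x $ k + r = x $ k - r" unfolding eq by simp
      then show False using r(1) by simp
    qed
    ultimately show False using ext midpoint_in_open_segment by metis
  qed
  ultimately show ?thesis by (simp add: free_boundary_nsc_def)
qed

lemma other_index: obtains j where "j \<noteq> k"
proof -
  have "\<exists>j. j \<noteq> k"
  proof (rule ccontr)
    assume "\<not> ?thesis"
    then have "UNIV = {k}" by auto
    then have "CARD('n) = 1" by (metis card_1_singleton_iff One_nat_def)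
    then show False using card by simp
  qed
  then show ?thesis using that by blast
qed

lemma R_axis:
  assumes "j \<noteq> k"
  shows "drop_coord k (axis j c) = axis j c"
  using assms by (simp add: drop_coord_def vec_eq_iff axis_def)

text \<open>On the line through \<open>axis j\<close> the function has a minimum at the interface,
  so a derivative there would be 0; but beyond the interface \<open>v\<close> is at least
  \<open>d * h\<close>. Not even differentiability holds.\<close>

lemma v_not_C1: "\<not> C1_on (ball 0 1) v"
proof
  assume "C1_on (ball 0 1) v"
  then obtain g where g: "\<And>x. x \<in> ball 0 1 \<Longrightarrow> GDERIV v x :> g x" unfolding C1_on_def by blast
  obtain j where j: "j \<noteq> k" by (rule other_index)
  define f where "f h = v (axis j (1 / 2 + h))" for h
  have ax: "axis j (1 / 2 + h) = axis j (1 / 2) + h *\<^sub>R axis j (1 :: real)" for h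
    by (simp add: vec_eq_iff axis_def)
  have n: "norm (axis j (c :: real)) = \<bar>c\<bar>" for c
  proof -
    have "axis j c = c *\<^sub>R axis j (1 :: real)" by (simp add: vec_eq_iff axis_def)
    then show ?thesis by (simp add: norm_axis_1)
  qed
  have fR: "R (axis j c) = \<bar>c\<bar>" for c by (simp add: R_def R_axis[OF j] n)
  have D: "(f has_real_derivative (axis j 1 \<bullet> g (axis j (1 / 2)))) (at 0)"
  proof -
    have "(v has_derivative (\<lambda>h. h \<bullet> g (axis j (1 / 2)))) (at (axis j (1 / 2) + 0 *\<^sub>R axis j 1))"
      using g[of "axis j (1 / 2)"] n[of "1 / 2"] by (simp add: gderiv_def)
    moreover have "((\<lambda>h :: real. axis j (1 / 2) + h *\<^sub>R axis j (1 :: real)) has_derivative (\<lambda>h. h *\<^sub>R axis j 1)) (at 0)"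
      by (auto intro!: derivative_eq_intros)
    ultimately have "((\<lambda>h. v (axis j (1 / 2) + h *\<^sub>R axis j 1)) has_derivative (\<lambda>h. (h *\<^sub>R axis j 1) \<bullet> g (axis j (1 / 2)))) (at 0)"
      by (rule has_derivative_compose[rotated])
    then show ?thesis unfolding f_def[abs_def] ax has_field_derivative_def
      by (rule has_derivative_eq_rhs) (auto simp: mult.commute)
  qed
  have f0: "f 0 = 0" using fR[of "1 / 2"] by (simp add: f_def v_inner)
  have fpos: "d * h \<le> f h" if "0 < h" "h < 1 / 2" for h
  proof -
    have o: "axis j (1 / 2 + h) \<in> outer" using that fR[of "1 / 2 + h"] n[of "1 / 2 + h"] by (simp add: outer_def)
    show ?thesis
      using profD(6)[OF outerD(2,3,4)[OF o]] that unfolding f_def v_outer[OF o] fR by simp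
  qed
  have fzero: "f h = 0" if "- 1 < h" "h \<le> 0" for h
    using that fR[of "1 / 2 + h"] by (simp add: f_def v_inner abs_if)
  have min: "f 0 \<le> f h" if "\<bar>0 - h\<bar> < 1 / 2" for h
    using f0 fzero[of h] fpos[of h] mult_pos_pos[OF d_pos, of h] that by (cases "h \<le> 0") auto
  have z: "axis j 1 \<bullet> g (axis j (1 / 2)) = 0"
    by (rule DERIV_local_min[OF D, of "1 / 2"]) (use min in auto)
  \<comment> \<open>With derivative \<open>- d\<close> at 0 this difference would be negative just
    to the right of 0, against \<open>fpos\<close>.\<close>
  have "((\<lambda>h. f h - d * h) has_real_derivative (0 - d * 1)) (at 0)"
    using D unfolding z by (intro DERIV_diff DERIV_cmult DERIV_ident)
  then have "((\<lambda>h. f h - d * h) has_real_derivative (- d)) (at 0)" by simp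
  from DERIV_neg_dec_right[OF this] obtain r where r: "0 < r" "\<And>h. 0 < h \<Longrightarrow> h < r \<Longrightarrow> f (0 + h) - d * (0 + h) < f 0 - d * 0"
    using d_pos by auto
  define h where "h = min (r / 2) (1 / 4)"
  have "0 < h" "h < r" "h < 1 / 2" using r(1) by (auto simp: h_def)
  then show False using r(2)[of h] fpos[of h] f0 by simp
qed

end

section \<open>Failure of second-order Sobolev regularity\<close>

text \<open>The polynomial factor makes the family closed under differentiation, so that a single
  lemma yields the derivatives of \<open>exp (- 1 / x)\<close> of all orders.\<close>

definition expinv :: "real poly \<Rightarrow> real \<Rightarrow> real" where
  "expinv p x = (if 0 < x then poly p (1 / x) * exp (- 1 / x) else 0)"

lemma poly_exp_tendsto_0: "((\<lambda>y. poly p y * exp (- y)) \<longlongrightarrow> 0) at_top" for p :: "real poly"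
proof -
  have "((\<lambda>y. \<Sum>i\<le>degree p. coeff p i * (y ^ i / exp y)) \<longlongrightarrow> (\<Sum>i\<le>degree p. coeff p i * 0)) at_top"
    by (intro tendsto_sum tendsto_mult tendsto_const tendsto_power_div_exp_0)
  then show ?thesis
    by (simp add: poly_altdef sum_distrib_left exp_minus divide_inverse mult_ac)
qed

text \<open>With \<open>y = 1 / x\<close> the chain rule gives the polynomial
  \<open>y^2 (p - p')\<close>. At 0 the right difference quotient is \<open>y p(y) exp (- y)\<close>
  with \<open>y\<close> tending to infinity, the left one is 0.\<close>

lemma expinv_has_derivative:
  "(expinv p has_real_derivative expinv ([:0, 0, 1:] * (p - pderiv p)) x) (at x)"
proof -
  consider "0 < x" | "x < 0" | "x = 0" by linarith
  then show ?thesis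
  proof cases
    case 1
    have "((\<lambda>x. poly p (1 / x) * exp (- 1 / x)) has_real_derivative
        poly (pderiv p) (1 / x) * (- 1 / x\<^sup>2) * exp (- 1 / x) + poly p (1 / x) * (exp (- 1 / x) * (1 / x\<^sup>2))) (at x)"
      using 1 by (auto intro!: derivative_eq_intros DERIV_chain'[OF _ poly_DERIV] simp: power2_eq_square divide_simps)
    moreover have "poly (pderiv p) (1 / x) * (- 1 / x\<^sup>2) * exp (- 1 / x) + poly p (1 / x) * (exp (- 1 / x) * (1 / x\<^sup>2))
       = expinv ([:0, 0, 1:] * (p - pderiv p)) x"
      using 1 by (simp add: expinv_def power2_eq_square field_simps)
    ultimately show ?thesis
      using 1 by (auto intro: has_field_derivative_transform_within_open[of _ _ _ "{0<..}"] simp: expinv_def)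
  next
    case 2
    have "((\<lambda>x. 0) has_real_derivative 0) (at x)" by simp
    then have "(expinv p has_real_derivative 0) (at x)"
      by (rule has_field_derivative_transform_within_open[of _ _ _ "{..<0}"]) (use 2 in \<open>auto simp: expinv_def\<close>)
    then show ?thesis using 2 by (simp add: expinv_def)
  next
    case 3
    have right: "((\<lambda>h. expinv p h / h) \<longlongrightarrow> 0) (at_right 0)"
    proof -
      have "((\<lambda>y. poly ([:0, 1:] * p) y * exp (- y)) \<longlongrightarrow> 0) at_top" by (rule poly_exp_tendsto_0)
      from filterlim_compose[OF this filterlim_inverse_at_top_right]
      have "((\<lambda>h. poly ([:0, 1:] * p) (inverse h) * exp (- inverse h)) \<longlongrightarrow> 0) (at_right 0)" .
      then show ?thesis
      proof (rule Lim_transform_eventually)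
        show "\<forall>\<^sub>F h in at_right 0. poly ([:0, 1:] * p) (inverse h) * exp (- inverse h) = expinv p h / h"
          by (rule eventually_mono[OF eventually_at_right_less]) (simp add: expinv_def divide_inverse mult_ac)
      qed
    qed
    have left: "((\<lambda>h. expinv p h / h) \<longlongrightarrow> 0) (at_left 0)"
    proof (rule Lim_transform_eventually[OF tendsto_const])
      have "\<forall>\<^sub>F h in at_left 0. h < (0::real)" by (simp add: eventually_at_filter)
      then show "\<forall>\<^sub>F h in at_left 0. 0 = expinv p h / h"
        by (rule eventually_mono) (simp add: expinv_def)
    qed
    have "((\<lambda>h. expinv p h / h) \<longlongrightarrow> 0) (at 0)"
      using left right by (rule filterlim_split_at)
    then show ?thesis using 3 by (simp add: DERIV_def expinv_def)
  qed
qed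

lemma expinv_1_nonneg: "0 \<le> expinv 1 x"
  by (simp add: expinv_def)

lemma expinv_1_le_1: "expinv 1 x \<le> 1"
  by (simp add: expinv_def)

lemma expinv_1_pos: "0 < expinv 1 x \<longleftrightarrow> 0 < x"
  by (simp add: expinv_def)

lemma expinv_1_mono: "x \<le> y \<Longrightarrow> expinv 1 x \<le> expinv 1 y"
  by (auto simp: expinv_def divide_simps)

text \<open>A stock of smooth functions just large enough for the bumps below. It is closed under
  directional derivatives, by induction, and this provides the derivatives of all orders that
  \<open>test_functions\<close> demands.\<close>

inductive smooth_fun :: "('a::euclidean_space \<Rightarrow> real) \<Rightarrow> bool" where
  smooth_const: "smooth_fun (\<lambda>x. c)"
| smooth_inner: "smooth_fun (\<lambda>x. x \<bullet> b)"
| smooth_add: "smooth_fun f \<Longrightarrow> smooth_fun g \<Longrightarrow> smooth_fun (\<lambda>x. f x + g x)"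
| smooth_mult: "smooth_fun f \<Longrightarrow> smooth_fun g \<Longrightarrow> smooth_fun (\<lambda>x. f x * g x)"
| smooth_expinv: "smooth_fun f \<Longrightarrow> smooth_fun (\<lambda>x. expinv p (f x))"

lemma smooth_fun_has_derivative:
  assumes "smooth_fun f"
  shows "\<exists>f'. (\<forall>x. (f has_derivative f' x) (at x)) \<and> (\<forall>b. smooth_fun (\<lambda>x. f' x b))"
  using assms
proof induction
  case (smooth_const c)
  show ?case by (rule exI[of _ "\<lambda>x h. 0"]) (auto intro: smooth_fun.smooth_const)
next
  case (smooth_inner b)
  have "((\<lambda>x. x \<bullet> b) has_derivative (\<lambda>h. h \<bullet> b)) (at x)" for x :: 'a
    by (rule bounded_linear_imp_has_derivative[OF bounded_linear_inner_left])
  then show ?case by (intro exI[of _ "\<lambda>x h. h \<bullet> b"]) (auto intro: smooth_fun.smooth_const)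
next
  case (smooth_add f g)
  then obtain f' g' where "\<forall>x. (f has_derivative f' x) (at x)" "\<forall>b. smooth_fun (\<lambda>x. f' x b)"
    "\<forall>x. (g has_derivative g' x) (at x)" "\<forall>b. smooth_fun (\<lambda>x. g' x b)" by blast
  then show ?case
    by (intro exI[of _ "\<lambda>x h. f' x h + g' x h"]) (auto intro: has_derivative_add smooth_fun.smooth_add)
next
  case (smooth_mult f g)
  then obtain f' g' where "\<forall>x. (f has_derivative f' x) (at x)" "\<forall>b. smooth_fun (\<lambda>x. f' x b)"
    "\<forall>x. (g has_derivative g' x) (at x)" "\<forall>b. smooth_fun (\<lambda>x. g' x b)" by blast
  with smooth_mult(1,2) show ?case
    by (intro exI[of _ "\<lambda>x h. f x * g' x h + f' x h * g x"])
      (auto intro!: has_derivative_mult smooth_fun.smooth_add smooth_fun.smooth_mult)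
next
  case (smooth_expinv f p)
  then obtain f' where f': "\<forall>x. (f has_derivative f' x) (at x)" "\<forall>b. smooth_fun (\<lambda>x. f' x b)" by blast
  let ?p = "[:0, 0, 1:] * (p - pderiv p)"
  have "((\<lambda>x. expinv p (f x)) has_derivative (\<lambda>h. expinv ?p (f x) * f' x h)) (at x)" for x
    using has_derivative_compose[of f "f' x" x UNIV "expinv p" "\<lambda>h. expinv ?p (f x) * h"]
      f'(1) expinv_has_derivative[of p "f x"] unfolding has_field_derivative_def by blast
  then show ?case using smooth_expinv(1) f'(2)
    by (intro exI[of _ "\<lambda>x h. expinv ?p (f x) * f' x h"])
      (auto intro!: smooth_fun.smooth_mult smooth_fun.smooth_expinv)
qed

lemma smooth_fun_differentiable: "smooth_fun f \<Longrightarrow> f differentiable (at x)"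
  using smooth_fun_has_derivative differentiableI by blast

lemma smooth_fun_frechet: "smooth_fun f \<Longrightarrow> smooth_fun (\<lambda>x. frechet_derivative f (at x) b)"
proof -
  assume "smooth_fun f"
  then obtain f' where f': "\<forall>x. (f has_derivative f' x) (at x)" "\<forall>b. smooth_fun (\<lambda>x. f' x b)"
    using smooth_fun_has_derivative by blast
  have "frechet_derivative f (at x) = f' x" for x using f'(1) frechet_derivative_at by metis
  then show ?thesis using f'(2) by simp
qed

lemma smooth_fun_partial_deriv: "smooth_fun f \<Longrightarrow> smooth_fun (partial_deriv bs f)"
  by (induction bs) (simp_all add: smooth_fun_frechet)

lemma smooth_fun_continuous: "smooth_fun f \<Longrightarrow> continuous_on S f"
  using smooth_fun_differentiable differentiable_imp_continuous_within continuous_at_imp_continuous_on by blast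

lemma smooth_fun_diff:
  assumes "smooth_fun f" "smooth_fun g" shows "smooth_fun (\<lambda>x. f x - g x)"
  using smooth_add[OF assms(1) smooth_mult[OF smooth_const[of "-1"] assms(2)]] by simp

lemma smooth_fun_sum:
  "finite A \<Longrightarrow> (\<And>i. i \<in> A \<Longrightarrow> smooth_fun (f i)) \<Longrightarrow> smooth_fun (\<lambda>x. \<Sum>i\<in>A. f i x)"
  by (induction A rule: finite_induct) (auto intro: smooth_const smooth_add)

lemma smooth_fun_inner_self: "smooth_fun (\<lambda>x. x \<bullet> x)"
proof -
  have "(\<lambda>x :: 'a. x \<bullet> x) = (\<lambda>x. \<Sum>b\<in>Basis. (x \<bullet> b) * (x \<bullet> b))"
    using euclidean_inner by blast
  then show ?thesis by (simp add: smooth_fun_sum smooth_mult smooth_inner)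
qed

lemma partial_deriv_zero:
  assumes "open W" "\<And>x. x \<in> W \<Longrightarrow> f x = 0" "x \<in> W"
  shows "partial_deriv bs f x = 0"
  using assms(3)
proof (induction bs arbitrary: x)
  case Nil
  then show ?case using assms(2) by simp
next
  case (Cons b bs)
  have "((\<lambda>x. 0) has_derivative (\<lambda>h. 0)) (at x)" by simp
  then have "(partial_deriv bs f has_derivative (\<lambda>h. 0)) (at x)"
    by (rule has_derivative_transform_within_open[OF _ assms(1) Cons.prems]) (simp add: Cons.IH)
  then have "frechet_derivative (partial_deriv bs f) (at x) = (\<lambda>h. 0)"
    using frechet_derivative_at by metis
  then show ?case by simp
qed

lemma smooth_fun_test_function:
  assumes "smooth_fun f" "\<And>x. x \<notin> cball a r \<Longrightarrow> f x = 0" "cball a r \<subseteq> U"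
  shows "f \<in> test_functions U"
proof -
  have "closure {x. f x \<noteq> 0} \<subseteq> cball a r"
    by (rule closure_minimal) (use assms(2) in blast, simp)
  moreover have "compact (closure {x. f x \<noteq> 0})"
    by (rule compact_closure[THEN iffD2], rule bounded_subset[OF bounded_cball[of a r]]) (use assms(2) in blast)
  ultimately show ?thesis
    unfolding test_functions_def using assms smooth_fun_differentiable smooth_fun_partial_deriv by blast
qed

text \<open>Taylor expansions in the directions \<open>b\<close> and \<open>- b\<close>
  (\<open>c = 1\<close> and \<open>c = -1\<close> in the proof): the first-order terms cancel, and
  each remainder keeps its own intermediate point.\<close>

lemma second_difference_taylor:
  fixes f :: "'a::euclidean_space \<Rightarrow> real"
  assumes f: "smooth_fun f" and h: "0 < h"
  shows "\<exists>r s. \<bar>r\<bar> \<le> h \<and> \<bar>s\<bar> \<le> h \<and> f (x + h *\<^sub>R b) + f (x - h *\<^sub>R b) - 2 * f x =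
    h\<^sup>2 / 2 * (partial_deriv [b, b] f (x + r *\<^sub>R b) + partial_deriv [b, b] f (x + s *\<^sub>R b))"
proof -
  have der: "((\<lambda>t. partial_deriv bs f (x + (c * t) *\<^sub>R b)) has_real_derivative
      c * partial_deriv (b # bs) f (x + (c * t) *\<^sub>R b)) (at t)" for bs c t
  proof -
    have lin: "((\<lambda>t. x + (c * t) *\<^sub>R b) has_derivative (\<lambda>h. (c * h) *\<^sub>R b)) (at t)"
      by (auto intro!: derivative_eq_intros)
    let ?D = "frechet_derivative (partial_deriv bs f) (at (x + (c * t) *\<^sub>R b))"
    have D: "(partial_deriv bs f has_derivative ?D) (at (x + (c * t) *\<^sub>R b))"
      using smooth_fun_differentiable[OF smooth_fun_partial_deriv[OF f]] frechet_derivative_works by blast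
    have "linear ?D" using D has_derivative_linear by blast
    then have e: "?D ((c * h) *\<^sub>R b) = c * ?D b * h" for h by (simp add: linear_cmul)
    show ?thesis
      using has_derivative_compose[OF lin D] unfolding has_field_derivative_def e by simp
  qed
  have taylor: "\<exists>r. 0 < r \<and> r < h \<and> f (x + (c * h) *\<^sub>R b) = f x + c * partial_deriv [b] f x * h
      + c * c * partial_deriv [b, b] f (x + (c * r) *\<^sub>R b) / 2 * h\<^sup>2" for c
  proof -
    define diff where "diff m t = c ^ m * partial_deriv (replicate m b) f (x + (c * t) *\<^sub>R b)" for m t
    have "\<exists>t>0. t < h \<and> diff 0 h = (\<Sum>m<2. diff m 0 / fact m * h ^ m) + diff 2 t / fact 2 * h ^ 2"
    proof (rule Maclaurin[OF h _ refl])
      show "\<forall>m t. m < 2 \<and> 0 \<le> t \<and> t \<le> h \<longrightarrow> (diff m has_real_derivative diff (Suc m) t) (at t)"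
      proof (intro allI impI)
        fix m t
        have "((\<lambda>t. c ^ m * partial_deriv (replicate m b) f (x + (c * t) *\<^sub>R b)) has_real_derivative
          c ^ m * (c * partial_deriv (b # replicate m b) f (x + (c * t) *\<^sub>R b))) (at t)"
          by (intro DERIV_cmult der)
        then show "(diff m has_real_derivative diff (Suc m) t) (at t)"
          by (simp add: diff_def[abs_def] mult_ac)
      qed
    qed simp
    then obtain t where "0 < t" "t < h" "diff 0 h = (\<Sum>m<2. diff m 0 / fact m * h ^ m) + diff 2 t / fact 2 * h ^ 2"
      by blast
    then show ?thesis
      by (intro exI[of _ t]) (simp add: diff_def numeral_2_eq_2)
  qed
  obtain r where r: "0 < r" "r < h" "f (x + (1 * h) *\<^sub>R b) = f x + 1 * partial_deriv [b] f x * h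
      + 1 * 1 * partial_deriv [b, b] f (x + (1 * r) *\<^sub>R b) / 2 * h\<^sup>2"
    using taylor[of 1] by blast
  obtain s where s: "0 < s" "s < h" "f (x + ((- 1) * h) *\<^sub>R b) = f x + (- 1) * partial_deriv [b] f x * h
      + (- 1) * (- 1) * partial_deriv [b, b] f (x + ((- 1) * s) *\<^sub>R b) / 2 * h\<^sup>2"
    using taylor[of "- 1"] by blast
  have "f (x + h *\<^sub>R b) + f (x - h *\<^sub>R b) - 2 * f x =
    h\<^sup>2 / 2 * (partial_deriv [b, b] f (x + r *\<^sub>R b) + partial_deriv [b, b] f (x + (- s) *\<^sub>R b))"
    using r(3) s(3) by (simp add: algebra_simps)
  then show ?thesis using r s by (intro exI[of _ r] exI[of _ "- s"]) auto
qed

declare partial_deriv.simps(2) [simp del]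

lemma integral_translation_lborel:
  fixes f :: "'a::euclidean_space \<Rightarrow> real"
  assumes "f \<in> borel_measurable borel"
  shows "(\<integral>x. f (x + c) \<partial>lborel) = (\<integral>x. f x \<partial>lborel)"
proof -
  have "(\<integral>x. f x \<partial>lborel) = (\<integral>x. f x \<partial>distr lborel borel ((+) c))"
    by (simp add: lborel_distr_plus)
  also have "\<dots> = (\<integral>x. f (c + x) \<partial>lborel)"
    using assms by (subst integral_distr) auto
  finally show ?thesis by (simp add: add.commute)
qed

lemma integrable_translation_lborel:
  fixes f :: "'a::euclidean_space \<Rightarrow> real"
  assumes "integrable lborel f"
  shows "integrable lborel (\<lambda>x. f (x + c))"
proof -
  have "integrable (distr lborel borel ((+) c)) f" using assms by (simp add: lborel_distr_plus)
  then have "integrable lborel (\<lambda>x. f (c + x))" by (subst (asm) integrable_distr_eq) (use assms in auto)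
  then show ?thesis by (simp add: add.commute)
qed

lemma integrable_mult_bounded:
  fixes f p :: "'a::euclidean_space \<Rightarrow> real"
  assumes f: "integrable lborel f" and p: "p \<in> borel_measurable borel" "\<And>x. \<bar>p x\<bar> \<le> M"
  shows "integrable lborel (\<lambda>x. f x * p x)"
proof (rule Bochner_Integration.integrable_bound)
  show "integrable lborel (\<lambda>x. M * f x)" using f by simp
  show "(\<lambda>x. f x * p x) \<in> borel_measurable lborel" using f p(1) by simp
  have "0 \<le> M" using p(2)[of undefined] by (meson abs_ge_zero order_trans)
  then have "norm (f x * p x) \<le> norm (M * f x)" for x
    using mult_mono[OF p(2)[of x] order_refl[of "\<bar>f x\<bar>"]] by (simp add: abs_mult mult.commute)
  then show "AE x in lborel. norm (f x * p x) \<le> norm (M * f x)" by simp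
qed

text \<open>Discrete integration by parts: translation invariance moves the second difference from
  the smooth \<open>p\<close> to the merely integrable \<open>f\<close>.\<close>

lemma second_difference_translate:
  fixes f p :: "'a::euclidean_space \<Rightarrow> real"
  assumes f: "integrable lborel f" and p: "p \<in> borel_measurable borel" "\<And>x. \<bar>p x\<bar> \<le> M"
  shows "(\<integral>x. f x * (p (x + c) + p (x - c) - 2 * p x) \<partial>lborel) =
    (\<integral>x. (f (x + c) + f (x - c) - 2 * f x) * p x \<partial>lborel)"
proof -
  have fm: "f \<in> borel_measurable borel" using f by simp
  have ps: "(\<lambda>x. p (x + c)) \<in> borel_measurable borel" for c using p(1) by simp
  have fs: "integrable lborel (\<lambda>x. f (x + c))" for c by (rule integrable_translation_lborel[OF f])
  have i1: "integrable lborel (\<lambda>x. f x * p (x + c))" for c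
    by (rule integrable_mult_bounded[OF f ps p(2)])
  have i2: "integrable lborel (\<lambda>x. f (x + c) * p x)" for c
    by (rule integrable_mult_bounded[OF fs p])
  have tr: "(\<integral>x. f x * p (x + c) \<partial>lborel) = (\<integral>x. f (x - c) * p x \<partial>lborel)" for c
  proof -
    have "(\<lambda>x. f (x - c) * p x) \<in> borel_measurable borel" using fm p(1) by simp
    from integral_translation_lborel[OF this, of c] show ?thesis by simp
  qed
  have "(\<integral>x. f x * (p (x + c) + p (x - c) - 2 * p x) \<partial>lborel) =
     (\<integral>x. f x * p (x + c) + f x * p (x + - c) - 2 * (f x * p (x + 0)) \<partial>lborel)"
    by (simp add: algebra_simps)
  also have "\<dots> = (\<integral>x. f x * p (x + c) \<partial>lborel) + (\<integral>x. f x * p (x + - c) \<partial>lborel) - 2 * (\<integral>x. f x * p (x + 0) \<partial>lborel)"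
    using i1[of c] i1[of "- c"] i1[of 0] by simp
  also have "\<dots> = (\<integral>x. f (x - c) * p x \<partial>lborel) + (\<integral>x. f (x - - c) * p x \<partial>lborel) - 2 * (\<integral>x. f (x - 0) * p x \<partial>lborel)"
    unfolding tr ..
  also have "\<dots> = (\<integral>x. f (x + - c) * p x + f (x + c) * p x - 2 * (f (x + 0) * p x) \<partial>lborel)"
    using i2[of c] i2[of "- c"] i2[of 0] by simp
  also have "\<dots> = (\<integral>x. (f (x + c) + f (x - c) - 2 * f x) * p x \<partial>lborel)"
    by (simp add: algebra_simps)
  finally show ?thesis .
qed

text \<open>Each quotient is the average of two nearby values of the second derivative, hence
  bounded by \<open>M\<close> and convergent to it; dominated convergence applies with majorant
  \<open>M * \<bar>f\<bar>\<close>.\<close>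

lemma second_difference_integral_tendsto:
  fixes f p :: "'a::euclidean_space \<Rightarrow> real"
  assumes f: "integrable lborel f" and p: "smooth_fun p"
    and bound: "\<And>x. \<bar>partial_deriv [b, b] p x\<bar> \<le> M"
    and h: "\<And>n. 0 < h n" "h \<longlonglongrightarrow> 0"
  shows "(\<lambda>n. \<integral>x. f x * ((p (x + h n *\<^sub>R b) + p (x - h n *\<^sub>R b) - 2 * p x) / (h n)\<^sup>2) \<partial>lborel)
    \<longlonglongrightarrow> (\<integral>x. f x * partial_deriv [b, b] p x \<partial>lborel)"
proof -
  let ?d = "partial_deriv [b, b] p"
  let ?D = "\<lambda>n x. (p (x + h n *\<^sub>R b) + p (x - h n *\<^sub>R b) - 2 * p x) / (h n)\<^sup>2"
  have "\<exists>r s. \<bar>r\<bar> \<le> h n \<and> \<bar>s\<bar> \<le> h n \<and> ?D n x = (?d (x + r *\<^sub>R b) + ?d (x + s *\<^sub>R b)) / 2" for n x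
    using second_difference_taylor[OF p h(1), of n x b] h(1)[of n] by (simp add: field_simps)
  then obtain r s where rs: "\<And>n x. \<bar>r n x\<bar> \<le> h n" "\<And>n x. \<bar>s n x\<bar> \<le> h n"
    "\<And>n x. ?D n x = (?d (x + r n x *\<^sub>R b) + ?d (x + s n x *\<^sub>R b)) / 2" by metis
  have contd: "continuous_on UNIV ?d" by (rule smooth_fun_continuous[OF smooth_fun_partial_deriv[OF p]])
  have contp: "continuous_on UNIV p" by (rule smooth_fun_continuous[OF p])
  have pm[measurable]: "p \<in> borel_measurable borel" using contp by (rule borel_measurable_continuous_onI)
  have dm[measurable]: "?d \<in> borel_measurable borel" using contd by (rule borel_measurable_continuous_onI)
  have fm[measurable]: "f \<in> borel_measurable borel" using f by simp
  have lim: "(\<lambda>n. ?D n x) \<longlonglongrightarrow> ?d x" for x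
  proof -
    have to0: "(\<lambda>n. u n x) \<longlonglongrightarrow> 0" if "\<And>n x. \<bar>u n x\<bar> \<le> h n" for u :: "nat \<Rightarrow> 'a \<Rightarrow> real"
      by (rule Lim_null_comparison[OF _ h(2)]) (use that in simp)
    have to: "(\<lambda>n. ?d (x + u n x *\<^sub>R b)) \<longlonglongrightarrow> ?d x" if "\<And>n x. \<bar>u n x\<bar> \<le> h n" for u
    proof -
      have "(\<lambda>n. x + u n x *\<^sub>R b) \<longlonglongrightarrow> x + 0 *\<^sub>R b" by (intro tendsto_intros to0 that)
      then have "(\<lambda>n. x + u n x *\<^sub>R b) \<longlonglongrightarrow> x" by simp
      then show ?thesis using contd continuous_on_tendsto_compose[OF contd] by fastforce
    qed
    have "(\<lambda>n. (?d (x + r n x *\<^sub>R b) + ?d (x + s n x *\<^sub>R b)) / 2) \<longlonglongrightarrow> (?d x + ?d x) / 2"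
      by (intro tendsto_intros to rs) simp
    then show ?thesis unfolding rs(3) by simp
  qed
  show ?thesis
  proof (rule integral_dominated_convergence[where w = "\<lambda>x. M * norm (f x)"])
    show "integrable lborel (\<lambda>x. M * norm (f x))" using f by simp
    show "AE x in lborel. (\<lambda>n. f x * ?D n x) \<longlonglongrightarrow> f x * ?d x"
      by (intro AE_I2 tendsto_mult tendsto_const lim)
    fix n
    have avg: "\<bar>(a + c) / 2\<bar> \<le> M" if "\<bar>a\<bar> \<le> M" "\<bar>c\<bar> \<le> M" for a c :: real
      using that by (auto simp: abs_le_iff)
    have "\<bar>?D n x\<bar> \<le> M" for x
      unfolding rs(3) by (rule avg[OF bound bound])
    then have "norm (f x * ?D n x) \<le> M * norm (f x)" for x
      using mult_right_mono[of "\<bar>?D n x\<bar>" M "\<bar>f x\<bar>"] by (simp add: abs_mult mult.commute)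
    then show "AE x in lborel. norm (f x * ?D n x) \<le> M * norm (f x)" by simp
    show "(\<lambda>x. f x * ?D n x) \<in> borel_measurable lborel" by simp
    show "(\<lambda>x. f x * ?d x) \<in> borel_measurable lborel" by simp
  qed
qed

section \<open>Mass of the second differences near the interface\<close>

context radial_profile
begin

lemma R_sq: "(R x)\<^sup>2 = x \<bullet> x - (x $ k)\<^sup>2"
  using norm_drop_coord[of x k] by (simp add: R_def power2_norm_eq_inner)

lemma R_nonneg: "0 \<le> R x"
  by (simp add: R_def)

lemma R_axis_shift_sq:
  assumes "j \<noteq> k"
  shows "(R (x + c *\<^sub>R axis j 1))\<^sup>2 = (R x)\<^sup>2 + 2 * c * x $ j + c\<^sup>2"
proof -
  have "axis j (1 :: real) $ k = 0" using assms by (simp add: axis_def)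
  then show ?thesis unfolding R_sq
    by (simp add: inner_add_left inner_add_right inner_axis inner_axis' power2_eq_square algebra_simps)
qed

lemma R_shift_le: "R (x + c *\<^sub>R axis j 1) \<le> R x + \<bar>c\<bar>"
proof -
  have "R (x + c *\<^sub>R axis j 1) = norm (drop_coord k x + drop_coord k (c *\<^sub>R axis j 1))"
    by (simp only: R_def linear_add[OF linear_drop_coord])
  also have "\<dots> \<le> R x + norm (drop_coord k (c *\<^sub>R axis j 1))"
    unfolding R_def by (rule norm_triangle_ineq)
  also have "norm (drop_coord k (c *\<^sub>R axis j 1)) \<le> norm (c *\<^sub>R axis j (1 :: real))"
    by (rule norm_drop_coord_le)
  finally show ?thesis by (simp add: norm_axis_1)
qed

lemma nth_le_R:
  assumes "j \<noteq> k"
  shows "x $ j \<le> R x"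
proof -
  have "x $ j = drop_coord k x $ j" using assms by (simp add: drop_coord_def)
  also have "\<dots> \<le> R x" unfolding R_def using component_le_norm_cart[of "drop_coord k x" j] by simp
  finally show ?thesis .
qed

text \<open>The layer of points from which one step leaves the cylinder; there the second difference
  of \<open>v\<close> sees the gradient jump.\<close>

definition exit_set :: "'n \<Rightarrow> real ^ 'n \<Rightarrow> real \<Rightarrow> real \<Rightarrow> (real ^ 'n) set" where
  "exit_set j z w s = {x \<in> cball z (w / 2). R x \<le> 1 / 2 \<and> 1 / 2 < R (x + s *\<^sub>R axis j 1)}"

lemma exit_set_measurable: "exit_set j z w s \<in> sets borel"
proof -
  have c: "continuous_on UNIV (\<lambda>x. R (x + s *\<^sub>R axis j 1))"
    by (rule continuous_on_compose2[OF R_continuous[of UNIV]]) (auto intro!: continuous_intros)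
  have "exit_set j z w s = cball z (w / 2) \<inter> {x. R x \<le> 1 / 2} \<inter> {x. 1 / 2 < R (x + s *\<^sub>R axis j 1)}"
    by (auto simp: exit_set_def)
  moreover have "{x. R x \<le> 1 / 2} \<in> sets borel"
    by (intro borel_closed closed_Collect_le R_continuous continuous_on_const)
  moreover have "{x. 1 / 2 < R (x + s *\<^sub>R axis j 1)} \<in> sets borel"
    by (intro borel_open open_Collect_less c continuous_on_const)
  ultimately show ?thesis by simp
qed

text \<open>The translates of the exit set by multiples of the step tile a fixed ball.\<close>

lemma exit_set_lower:
  assumes j: "j \<noteq> k" and w: "0 < w" "w \<le> 1" and s: "0 < s" "s \<le> 1 / 4"
  defines "z \<equiv> axis j (1 / 2)"
  shows "measure lborel (ball (z - (w / 4) *\<^sub>R axis j 1) (w / 8)) * s \<le> measure lborel (exit_set j z w s)"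
proof -
  let ?b = "axis j (1 :: real)" and ?T = "exit_set j z w s"
  let ?Q = "ball (z - (w / 4) *\<^sub>R ?b) (w / 8)"
  \<comment> \<open>Enough steps to cover the length \<open>w / 2\<close>, from depth
    \<open>w / 4\<close> inside the cylinder to \<open>w / 4\<close> outside;
    \<open>w \<le> 1\<close> and \<open>s \<le> 1/4\<close> keep the total length
    \<open>N * s\<close> below 1.\<close>
  define N where "N = nat \<lceil>w / (2 * s)\<rceil>"
  have N: "w / (2 * s) \<le> real N" "real N < w / (2 * s) + 1"
  proof -
    have "0 < w / (2 * s)" using w s by simp
    then show "w / (2 * s) \<le> real N" "real N < w / (2 * s) + 1" unfolding N_def by linarith+
  qed
  have Ns: "w / 2 \<le> real N * s" using N(1) s by (simp add: field_simps)
  have Ns': "real N * s \<le> 1"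
  proof -
    have "real N * s \<le> (w / (2 * s) + 1) * s" using N(2) s by (intro mult_right_mono) auto
    also have "\<dots> = w / 2 + s" using s by (simp add: field_simps)
    finally show ?thesis using w s by linarith
  qed
  have sub: "?Q \<subseteq> (\<Union>i<N. (\<lambda>y. real i *\<^sub>R (s *\<^sub>R ?b) + y) -` ?T)"
  proof
    fix y assume y: "y \<in> ?Q"
    define u where "u = y - (z - (w / 4) *\<^sub>R ?b)"
    have u: "norm u < w / 8" using y by (simp add: u_def dist_norm norm_minus_commute)
    have yt: "y + t *\<^sub>R ?b = z + ((t - w / 4) *\<^sub>R ?b + u)" for t by (simp add: u_def algebra_simps)
    define P where "P i = (1 / 2 < R (y + (real i * s) *\<^sub>R ?b))" for i
    have "P N"
    proof -
      have "1 / 2 < (y + (real N * s) *\<^sub>R ?b) $ j"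
        unfolding yt using component_le_norm_cart[of u j] u Ns w by (simp add: z_def)
      also have "\<dots> \<le> R (y + (real N * s) *\<^sub>R ?b)" by (rule nth_le_R[OF j])
      finally show ?thesis by (simp add: P_def)
    qed
    have "\<not> P 0"
    proof -
      have y0: "y = (z + (- (w / 4)) *\<^sub>R ?b) + u" by (simp add: u_def)
      have "R y \<le> R (z + (- (w / 4)) *\<^sub>R ?b) + norm u"
      proof -
        have "R y = norm (drop_coord k (z + (- (w / 4)) *\<^sub>R ?b) + drop_coord k u)"
          using linear_add[OF linear_drop_coord, of k "z + (- (w / 4)) *\<^sub>R ?b" u] y0 by (simp add: R_def)
        also have "\<dots> \<le> R (z + (- (w / 4)) *\<^sub>R ?b) + norm (drop_coord k u)"
          unfolding R_def by (rule norm_triangle_ineq)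
        finally show ?thesis using norm_drop_coord_le[of k u] by linarith
      qed
      moreover have "R (z + (- (w / 4)) *\<^sub>R ?b) = 1 / 2 - w / 4"
      proof -
        have "z + (- (w / 4)) *\<^sub>R ?b = axis j (1 / 2 - w / 4)" by (simp add: z_def vec_eq_iff axis_def)
        moreover have "axis j (1 / 2 - w / 4) = (1 / 2 - w / 4) *\<^sub>R ?b" by (simp add: vec_eq_iff axis_def)
        ultimately show ?thesis using R_axis[OF j, of "1 / 2 - w / 4"] w by (simp add: R_def norm_axis_1)
      qed
      ultimately show ?thesis using u w by (simp add: P_def)
    qed
    \<comment> \<open>The number of steps to the first exit; the position one step earlier belongs
      to the exit set.\<close>
    define i where "i = (LEAST i. P i)"
    have Pi: "P i" unfolding i_def by (rule LeastI[of P, OF \<open>P N\<close>])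
    then have "i \<noteq> 0" using \<open>\<not> P 0\<close> by metis
    then obtain m where m: "i = Suc m" using not0_implies_Suc by blast
    have nPm: "\<not> P m" using not_less_Least[of m P] m unfolding i_def by simp
    have "i \<le> N" unfolding i_def by (rule Least_le[of P, OF \<open>P N\<close>])
    then have mN: "m < N" using m by simp
    have "real m * s \<le> w / 2"
    proof -
      have "real m + 1 \<le> real N" using mN by linarith
      then have "real m \<le> w / (2 * s)" using N(2) by linarith
      then show ?thesis using s by (simp add: field_simps)
    qed
    moreover have "0 \<le> real m * s" using s by simp
    ultimately have "\<bar>real m * s - w / 4\<bar> \<le> w / 4" by linarith
    then have "norm ((real m * s - w / 4) *\<^sub>R ?b + u) \<le> w / 4 + w / 8"
      using norm_triangle_ineq[of "(real m * s - w / 4) *\<^sub>R ?b" u] u by (simp add: norm_axis_1)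
    moreover have "z + x \<in> cball z (w / 2)" if "norm x \<le> w / 4 + w / 8" for x
      using that w by (simp add: dist_norm)
    ultimately have "y + (real m * s) *\<^sub>R ?b \<in> cball z (w / 2)"
      unfolding yt by blast
    then have cb: "dist z (y + (real m * s) *\<^sub>R ?b) \<le> w / 2" by (rule mem_cball[THEN iffD1])
    have st: "(y + (real m * s) *\<^sub>R ?b) + s *\<^sub>R ?b = y + (real i * s) *\<^sub>R ?b"
      by (simp add: m algebra_simps)
    have "y + (real m * s) *\<^sub>R ?b \<in> ?T"
      unfolding exit_set_def mem_Collect_eq mem_cball st
      using cb nPm Pi unfolding P_def by (simp only: not_less simp_thms)
    then have "y \<in> (\<lambda>y. real m *\<^sub>R (s *\<^sub>R ?b) + y) -` ?T" by (simp add: add.commute)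
    then show "y \<in> (\<Union>i<N. (\<lambda>y. real i *\<^sub>R (s *\<^sub>R ?b) + y) -` ?T)" using mN by blast
  qed
  have T: "?T \<in> sets borel" by (rule exit_set_measurable)
  have finT: "emeasure lborel ?T < \<infinity>"
    by (rule emeasure_bounded_finite) (rule bounded_subset[OF bounded_cball[of z "w / 2"]], auto simp: exit_set_def)
  have shift: "emeasure lborel ((\<lambda>y. c + y) -` ?T) = emeasure lborel ?T" for c
  proof -
    have "emeasure lborel ?T = emeasure (distr lborel borel ((+) c)) ?T" by (simp add: lborel_distr_plus)
    also have "\<dots> = emeasure lborel ((\<lambda>y. c + y) -` ?T)" using T by (subst emeasure_distr) auto
    finally show ?thesis by simp
  qed
  have Ts: "(\<lambda>y. c + y) -` ?T \<in> sets lborel" for c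
  proof -
    have "(\<lambda>y. c + y) \<in> borel_measurable borel" by simp
    from measurable_sets[OF this T] show ?thesis by simp
  qed
  have "emeasure lborel ?Q \<le> emeasure lborel (\<Union>i<N. (\<lambda>y. real i *\<^sub>R (s *\<^sub>R ?b) + y) -` ?T)"
    by (rule emeasure_mono[OF sub]) (use Ts in blast)
  also have "\<dots> \<le> (\<Sum>i<N. emeasure lborel ((\<lambda>y. real i *\<^sub>R (s *\<^sub>R ?b) + y) -` ?T))"
    by (rule emeasure_subadditive_finite) (use Ts in auto)
  also have "\<dots> = of_nat N * emeasure lborel ?T" unfolding shift by simp
  also have "\<dots> = ennreal (real N * measure lborel ?T)"
    using finT by (simp add: emeasure_eq_ennreal_measure ennreal_mult ennreal_of_nat_eq_real_of_nat less_top)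
  finally have "measure lborel ?Q \<le> real N * measure lborel ?T"
    by (simp add: measure_def enn2real_leI)
  then have "measure lborel ?Q * s \<le> (real N * measure lborel ?T) * s"
    using s by (intro mult_right_mono) auto
  also have "\<dots> = (real N * s) * measure lborel ?T" by simp
  also have "\<dots> \<le> 1 * measure lborel ?T" using Ns' by (intro mult_right_mono) auto
  finally show ?thesis by simp
qed

lemma v_second_difference_nonneg:
  assumes "x \<in> ball 0 1" "x + y \<in> ball 0 1" "x - y \<in> ball 0 1"
  shows "0 \<le> v (x + y) + v (x - y) - 2 * v x"
proof -
  have "v x + v_grad x \<bullet> (x + y - x) \<le> v (x + y)" "v x + v_grad x \<bullet> (x - y - x) \<le> v (x - y)"
    using v_grad_support assms by blast+
  then show ?thesis by simp
qed

text \<open>The step is twice that of the exit set: the first half leaves the cylinder, the second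
  raises \<open>R^2\<close> by at least \<open>s / 2\<close>, since the \<open>j\<close>-th
  coordinate is at least 1/4, and so takes \<open>R\<close> at least \<open>s / 4\<close> beyond
  1/2. There \<open>v \<ge> d * (s / 4)\<close>, while \<open>v\<close> is 0 at the centre and
  nonnegative at the other end.\<close>

lemma v_second_difference_exit:
  assumes j: "j \<noteq> k" and s: "0 < s" and w: "w \<le> 1 / 2" and x: "x \<in> exit_set j (axis j (1 / 2)) w s"
    and b: "x \<in> ball 0 1" "x + (2 * s) *\<^sub>R axis j 1 \<in> ball 0 1" "x - (2 * s) *\<^sub>R axis j 1 \<in> ball 0 1"
  shows "d * (s / 4) \<le> v (x + (2 * s) *\<^sub>R axis j 1) + v (x - (2 * s) *\<^sub>R axis j 1) - 2 * v x"
proof -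
  let ?y = "x + (2 * s) *\<^sub>R axis j 1" and ?m = "x + s *\<^sub>R axis j 1"
  have Rx: "R x \<le> 1 / 2" and Rm: "1 / 2 < R ?m" and xc: "norm (x - axis j (1 / 2)) \<le> w / 2"
    using x by (auto simp: exit_set_def dist_norm norm_minus_commute)
  have xj: "1 / 4 \<le> x $ j"
  proof -
    have "\<bar>x $ j - 1 / 2\<bar> \<le> w / 2"
      using component_le_norm_cart[of "x - axis j (1 / 2)" j] xc by simp
    then show ?thesis using w by linarith
  qed
  have "(R ?y)\<^sup>2 - (R ?m)\<^sup>2 = s * (2 * x $ j + 3 * s)"
    unfolding R_axis_shift_sq[OF j] by (simp add: power2_eq_square algebra_simps)
  also have "\<dots> \<ge> s * (1 / 2)" using s xj by (intro mult_left_mono) auto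
  finally have gap: "s / 2 \<le> (R ?y - R ?m) * (R ?y + R ?m)"
    by (simp add: power2_eq_square algebra_simps)
  have Ry1: "R ?y < 1" using ball_drop_coord(1)[OF b(2)] by (simp add: R_def)
  have ym: "R ?m < R ?y"
  proof (rule ccontr)
    assume "\<not> ?thesis"
    then have "(R ?y - R ?m) * (R ?y + R ?m) \<le> 0"
      using R_nonneg by (intro mult_nonpos_nonneg) auto
    then show False using gap s by linarith
  qed
  have "(R ?y - R ?m) * (R ?y + R ?m) \<le> (R ?y - R ?m) * 2"
    using ym Ry1 by (intro mult_left_mono) auto
  moreover have "s / 4 \<le> a - 1 / 2" if "s / 2 \<le> (a - c) * 2" "1 / 2 < c" for a c :: real
  proof -
    have "s / 4 \<le> a - c" using that(1) by simp
    then show ?thesis using that(2) by simp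
  qed
  ultimately have "s / 4 \<le> R ?y - 1 / 2" using gap Rm order_trans by blast
  then have "d * (s / 4) \<le> d * (R ?y - 1 / 2)" using d_pos by (intro mult_left_mono) auto
  also have "\<dots> \<le> v ?y"
  proof -
    have yo: "?y \<in> outer" using b(2) Rm ym by (simp add: outer_def)
    show ?thesis unfolding v_outer[OF yo] by (rule profD(6)[OF outerD(2,3,4)[OF yo]])
  qed
  finally show ?thesis using v_inner[OF Rx] v_nonneg[OF b(3)] by simp
qed

text \<open>The thickness \<open>r\<close> is measured in \<open>R^2 - 1/4\<close> instead of
  \<open>R - 1/2\<close>, which is polynomial in \<open>x\<close> and so keeps the function in
  \<open>smooth_fun\<close>; \<open>w\<close> is the radius of the support around
  \<open>z\<close>.\<close>

definition bump :: "real ^ 'n \<Rightarrow> real \<Rightarrow> real \<Rightarrow> real ^ 'n \<Rightarrow> real" where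
  "bump z w r x = expinv 1 (1 - (((R x)\<^sup>2 - 1 / 4) / r)\<^sup>2) * expinv 1 (w\<^sup>2 - (x - z) \<bullet> (x - z))"

lemma bump_smooth: "smooth_fun (bump z w r)"
proof -
  have sq: "smooth_fun (\<lambda>x. (f x)\<^sup>2)" if "smooth_fun f" for f :: "real ^ 'n \<Rightarrow> real"
    using smooth_mult[OF that that] by (simp add: power2_eq_square)
  have "smooth_fun (\<lambda>x. x \<bullet> x - (x \<bullet> axis k (1 :: real))\<^sup>2)"
    by (intro smooth_fun_diff smooth_fun_inner_self sq smooth_inner)
  then have R2: "smooth_fun (\<lambda>x. (R x)\<^sup>2)" by (simp add: R_sq inner_axis)
  have "smooth_fun (\<lambda>x. ((R x)\<^sup>2 - 1 / 4) * (1 / r))"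
    by (intro smooth_mult smooth_fun_diff R2 smooth_const)
  then have 1: "smooth_fun (\<lambda>x. expinv 1 (1 - (((R x)\<^sup>2 - 1 / 4) / r)\<^sup>2))"
    by (intro smooth_expinv smooth_fun_diff smooth_const sq) simp
  have "smooth_fun (\<lambda>x. x \<bullet> x - 2 * (x \<bullet> z) + z \<bullet> z)"
    by (intro smooth_add smooth_fun_diff smooth_mult smooth_fun_inner_self smooth_const smooth_inner)
  then have "smooth_fun (\<lambda>x. (x - z) \<bullet> (x - z))"
    by (simp add: inner_diff_left inner_diff_right inner_commute algebra_simps)
  then have 2: "smooth_fun (\<lambda>x. expinv 1 (w\<^sup>2 - (x - z) \<bullet> (x - z)))"
    by (intro smooth_expinv smooth_fun_diff smooth_const)
  show ?thesis unfolding bump_def[abs_def] by (rule smooth_mult[OF 1 2])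
qed

lemma bump_nonneg: "0 \<le> bump z w r x"
  by (simp add: bump_def expinv_1_nonneg)

lemma bump_le_1: "bump z w r x \<le> 1"
  unfolding bump_def using mult_mono[OF expinv_1_le_1 expinv_1_le_1] expinv_1_nonneg by fastforce

lemma bump_outside:
  assumes "0 \<le> w" "x \<notin> cball z w"
  shows "bump z w r x = 0"
proof -
  have "w \<le> norm (x - z)" using assms by (simp add: dist_norm norm_minus_commute)
  then have "w\<^sup>2 \<le> (x - z) \<bullet> (x - z)"
    using assms(1) unfolding power2_norm_eq_inner [symmetric] by (rule power_mono)
  then show ?thesis by (simp add: bump_def expinv_def)
qed

text \<open>Points of the exit set are within \<open>s\<close> of the interface, so that
  \<open>\<bar>R^2 - 1/4\<bar> \<le> s \<le> r / 2\<close>. The lower bound is free of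
  \<open>r\<close>, and this is what survives as the bump gets thin.\<close>

lemma bump_lower:
  assumes "0 < s" "s \<le> r / 2" "x \<in> exit_set j z w s"
  shows "expinv 1 (3 / 4) * expinv 1 (3 / 4 * w\<^sup>2) \<le> bump z w r x"
proof -
  have Rx: "R x \<le> 1 / 2" "1 / 2 < R (x + s *\<^sub>R axis j 1)" and xc: "norm (x - z) \<le> w / 2"
    using assms(3) by (auto simp: exit_set_def dist_norm norm_minus_commute)
  have r: "0 < r" using assms by linarith
  have "1 / 2 - s \<le> R x" using R_shift_le[of x s j] Rx(2) assms(1) by simp
  then have "(1 / 2 - R x) * (1 / 2 + R x) \<le> s * 1"
    using Rx(1) R_nonneg[of x] assms(1) by (intro mult_mono) auto
  moreover have "0 \<le> (1 / 2 - R x) * (1 / 2 + R x)" using Rx(1) R_nonneg[of x] by (intro mult_nonneg_nonneg) auto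
  moreover have "(1 / 2 - R x) * (1 / 2 + R x) = - ((R x)\<^sup>2 - 1 / 4)"
    by (simp add: power2_eq_square algebra_simps)
  ultimately have "\<bar>(R x)\<^sup>2 - 1 / 4\<bar> \<le> r / 2" using assms(2) by linarith
  then have "\<bar>((R x)\<^sup>2 - 1 / 4) / r\<bar> \<le> 1 / 2" using r by (simp add: abs_divide field_simps)
  then have "(((R x)\<^sup>2 - 1 / 4) / r)\<^sup>2 \<le> (1 / 2)\<^sup>2" unfolding abs_le_square_iff [symmetric] by simp
  then have 1: "3 / 4 \<le> 1 - (((R x)\<^sup>2 - 1 / 4) / r)\<^sup>2" by (simp add: power2_eq_square)
  have "(norm (x - z))\<^sup>2 \<le> (w / 2)\<^sup>2" using xc by (rule power_mono) simp
  then have 2: "3 / 4 * w\<^sup>2 \<le> w\<^sup>2 - (x - z) \<bullet> (x - z)"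
    by (simp add: power2_norm_eq_inner power_divide)
  show ?thesis unfolding bump_def
    by (intro mult_mono expinv_1_mono 1 2 expinv_1_nonneg)
qed

text \<open>Off the interface the bump is 0 as soon as its thickness is at most
  \<open>\<bar>R^2 - 1/4\<bar>\<close>.\<close>

lemma bump_tendsto_0:
  assumes "R x \<noteq> 1 / 2"
  shows "(\<lambda>n. bump z w (1 / (real n + 1)) x) \<longlonglongrightarrow> 0"
proof -
  define c where "c = \<bar>(R x)\<^sup>2 - 1 / 4\<bar>"
  have "(R x)\<^sup>2 \<noteq> (1 / 2)\<^sup>2" using assms R_nonneg[of x] by (simp add: power2_eq_iff)
  then have c: "0 < c" by (simp add: c_def power2_eq_square)
  obtain m where m: "1 / c < real m" using reals_Archimedean2 by blast
  have "bump z w (1 / (real n + 1)) x = 0" if "m \<le> n" for n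
  proof -
    have "1 / c < real n + 1" using m that by linarith
    then have "1 \<le> c * (real n + 1)" using c by (simp add: field_simps)
    then have "1 \<le> \<bar>((R x)\<^sup>2 - 1 / 4) / (1 / (real n + 1))\<bar>" by (simp add: c_def abs_mult)
    then have "1\<^sup>2 \<le> (((R x)\<^sup>2 - 1 / 4) / (1 / (real n + 1)))\<^sup>2"
      by (intro abs_le_square_iff[THEN iffD1]) simp
    then show ?thesis by (simp add: bump_def expinv_def)
  qed
  then show ?thesis
    by (intro tendsto_eventually) (auto simp: eventually_sequentially)
qed

text \<open>The interface lies in the frontier of a convex set.\<close>

lemma negligible_interface: "negligible ({x. R x = 1 / 2} \<inter> ball (0 :: real ^ 'n) 1)"
proof -
  have "{x. norm (drop_coord k x) \<le> 1 / 2} = drop_coord k -` cball 0 (1 / 2)" by auto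
  then have "convex {x. norm (drop_coord k x) \<le> 1 / 2}"
    using convex_linear_vimage[OF linear_drop_coord convex_cball] by metis
  then have "convex ({x. norm (drop_coord k x) \<le> 1 / 2} \<inter> ball 0 1)" by (intro convex_Int convex_ball)
  then have "negligible (frontier ({x. norm (drop_coord k x) \<le> 1 / 2} \<inter> ball 0 1))"
    by (rule negligible_convex_frontier)
  moreover have "{x. R x = 1 / 2} \<inter> ball 0 1 \<subseteq> frontier ({x. norm (drop_coord k x) \<le> 1 / 2} \<inter> ball 0 1)"
    using frontier_cylinder by (auto simp: R_def)
  ultimately show ?thesis by (rule negligible_subset)
qed

text \<open>Extension by 0, so that translations act on an integrable function on the whole space.
  The jump at the unit sphere is out of reach of the bump and its small translates.\<close>

definition v0 :: "real ^ 'n \<Rightarrow> real" where "v0 x = indicator (ball 0 1) x *\<^sub>R v x"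

lemma v0_integrable: "integrable lborel v0"
proof -
  have cont: "continuous_on (ball 0 1) v" using v_lipschitz by (rule lipschitz_on_continuous_on)
  have m: "v0 \<in> borel_measurable borel"
    unfolding v0_def[abs_def] by (intro borel_measurable_continuous_on_indicator cont) simp
  have bd: "\<bar>v x\<bar> \<le> B" if "x \<in> ball 0 1" for x
  proof (cases "R x \<le> 1 / 2")
    case True
    then show ?thesis using B_pos by (simp add: v_inner)
  next
    case False
    then have xo: "x \<in> outer" using that by (simp add: outer_def)
    have "v x \<le> B * (R x - 1 / 2)" unfolding v_outer[OF xo] by (rule profD(7)[OF outerD(2,3,4)[OF xo]])
    also have "\<dots> \<le> B * 1" using B_pos outerD(3)[OF xo] by (intro mult_left_mono) auto
    finally show ?thesis using v_outer_pos[OF xo] by simp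
  qed
  have "integrable lborel (\<lambda>x. indicator (ball (0 :: real ^ 'n) 1) x *\<^sub>R B)"
    using emeasure_bounded_finite[of "ball (0 :: real ^ 'n) 1"]
    by (intro integrable_real_indicator integrable_scaleR_left) auto
  then show ?thesis
  proof (rule Bochner_Integration.integrable_bound)
    show "v0 \<in> borel_measurable lborel" using m by simp
    show "AE x in lborel. norm (v0 x) \<le> norm (indicator (ball (0 :: real ^ 'n) 1) x *\<^sub>R B)"
    proof (rule AE_I2)
      fix x
      show "norm (v0 x) \<le> norm (indicator (ball (0 :: real ^ 'n) 1) x *\<^sub>R B)"
        using bd[of x] B_pos by (auto simp: v0_def indicator_def)
    qed
  qed
qed

text \<open>
  Pairing \<open>v\<close> with the second derivative of a bump function is a limit of integrals of second
  differences of \<open>v\<close> against the bump. These are nonnegative by convexity and of order \<open>h\<close> on an exit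
  set of measure of order \<open>h\<close>, however thin the bump is around the interface.
\<close>

lemma v_not_sobolev:
  assumes U: "open U" "coincidence_set (ball 0 1) v \<subseteq> U" "U \<subseteq> ball 0 1"
  shows "v \<notin> sobolev_W1 2 U"
proof
  assume sob: "v \<in> sobolev_W1 2 U"
  obtain j where j: "j \<noteq> k" by (rule other_index)
  let ?b = "axis j (1 :: real)"
  define z where "z = axis j (1 / 2 :: real)"
  have zb: "z = (1 / 2) *\<^sub>R ?b" by (simp add: z_def vec_eq_iff axis_def)
  have nz: "norm z = 1 / 2" by (simp add: zb norm_axis_1)
  have "z \<in> coincidence_set (ball 0 1) v"
    unfolding v_coincidence using nz R_axis[OF j, of "1 / 2"] by (simp add: z_def)
  then have "z \<in> U" using U(2) by blast
  then obtain r0 where r0: "0 < r0" "cball z r0 \<subseteq> U" using U(1) open_contains_cball by blast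
  \<comment> \<open>\<open>w \<le> 1/4\<close> keeps the \<open>w\<close>-ball around
    \<open>z\<close> inside the unit ball even after a shift by less than 1/4, as
    \<open>1/2 + 1/4 + 1/4 = 1\<close>.\<close>
  define w where "w = min r0 (1 / 4)"
  have w: "0 < w" "w \<le> 1 / 4" "cball z w \<subseteq> U" using r0 by (auto simp: w_def)
  have inball: "x + c *\<^sub>R ?b \<in> ball 0 1" if "x \<in> cball z w" "\<bar>c\<bar> < 1 / 4" for x c
  proof -
    have "norm (x + c *\<^sub>R ?b) \<le> norm z + norm (x - z) + norm (c *\<^sub>R ?b)"
      using norm_triangle_ineq[of x "c *\<^sub>R ?b"] norm_triangle_ineq[of z "x - z"] by simp
    also have "\<dots> < 1 / 2 + 1 / 4 + 1 / 4"
      using that w(2) nz by (simp add: dist_norm norm_minus_commute norm_axis_1)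
    finally show ?thesis by simp
  qed
  have "[?b, ?b] \<in> lists Basis" by (simp add: axis_in_Basis_iff)
  moreover have "length [?b, ?b] \<le> 2" by simp
  moreover have "\<forall>bs\<in>lists Basis. length bs \<le> 2 \<longrightarrow>
      (\<exists>g. g absolutely_integrable_on U \<and> weak_deriv U bs v g)"
    using sob unfolding sobolev_W1_def by blast
  ultimately obtain g where gU: "g absolutely_integrable_on U" and wd: "weak_deriv U [?b, ?b] v g"
    by blast
  define kap where "kap = expinv 1 (3 / 4) * expinv 1 (3 / 4 * w\<^sup>2)"
  have kap: "0 < kap" unfolding kap_def using w(1) by (intro mult_pos_pos) (simp_all add: expinv_1_pos)
  define Q where "Q = measure lborel (ball (z - (w / 4) *\<^sub>R ?b) (w / 8))"
  have Q: "0 < Q" unfolding Q_def using w(1) content_ball_pos by simp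
  \<comment> \<open>With exit step \<open>h / 2\<close>, the exit set has measure at least
    \<open>Q * h / 2\<close>, the second difference is at least \<open>d * h / 8\<close> on it and
    the bump at least \<open>kap\<close>; the product is \<open>c0 * h^2\<close>.\<close>
  define c0 where "c0 = d * kap * Q / 16"
  have c0: "0 < c0" using d_pos kap Q by (simp add: c0_def)
  \<comment> \<open>The bound does not depend on \<open>r\<close>, whereas the right side tends to 0
    with \<open>r\<close> by dominated convergence, since \<open>g\<close> is integrable and the
    bumps shrink to a null set.\<close>
  have lower: "c0 \<le> (LINT x:U|lebesgue. g x * bump z w r x)" if r: "0 < r" for r
  proof -
    let ?p = "bump z w r"
    let ?D = "partial_deriv [?b, ?b] ?p"
    have p: "smooth_fun ?p" by (rule bump_smooth)
    have pout: "?p x = 0" if "x \<notin> cball z w" for x using bump_outside[OF _ that] w(1) by simp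
    have pbd: "\<bar>?p x\<bar> \<le> 1" for x using bump_nonneg bump_le_1 by simp
    have pm: "?p \<in> borel_measurable borel"
      using smooth_fun_continuous[OF p] by (rule borel_measurable_continuous_onI)
    have "?p \<in> test_functions U" by (rule smooth_fun_test_function[OF p pout w(3)])
    then have "(LINT x:U|lebesgue. v x * ?D x) = (-1) ^ length [?b, ?b] * (LINT x:U|lebesgue. g x * ?p x)"
      using wd unfolding weak_deriv_def by blast
    then have eq: "(LINT x:U|lebesgue. v x * ?D x) = (LINT x:U|lebesgue. g x * ?p x)" by simp
    have Dc: "continuous_on UNIV ?D" by (rule smooth_fun_continuous[OF smooth_fun_partial_deriv[OF p]])
    have Dout: "?D x = 0" if "x \<notin> cball z w" for x
      by (rule partial_deriv_zero[of "- cball z w"]) (use pout that in auto)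
    have "\<exists>M. \<forall>x. \<bar>?D x\<bar> \<le> M"
    proof -
      have "compact (?D ` cball z w)"
        by (rule compact_continuous_image[OF continuous_on_subset[OF Dc]]) auto
      then obtain M where M: "\<forall>y\<in>?D ` cball z w. norm y \<le> M"
        using compact_imp_bounded bounded_iff by metis
      have "\<bar>?D x\<bar> \<le> max M 0" for x
        using M Dout[of x] by (cases "x \<in> cball z w") (auto simp: le_max_iff_disj)
      then show ?thesis by blast
    qed
    then obtain M where M: "\<And>x. \<bar>?D x\<bar> \<le> M" by blast
    have "(LINT x:U|lebesgue. v x * ?D x) = (\<integral>x. v0 x * ?D x \<partial>lborel)"
    proof -
      have "indicator U x *\<^sub>R (v x * ?D x) = v0 x * ?D x" for x
        using Dout[of x] w(3) U(3) by (cases "x \<in> cball z w") (auto simp: v0_def indicator_def)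
      then have "(LINT x:U|lebesgue. v x * ?D x) = (\<integral>x. v0 x * ?D x \<partial>lebesgue)"
        by (simp only: set_lebesgue_integral_def)
      also have "\<dots> = (\<integral>x. v0 x * ?D x \<partial>lborel)"
      proof (rule integral_completion)
        have "?D \<in> borel_measurable borel" using Dc by (rule borel_measurable_continuous_onI)
        then show "(\<lambda>x. v0 x * ?D x) \<in> borel_measurable lborel" using v0_integrable by simp
      qed
      finally show ?thesis .
    qed
    with eq have eq': "(\<integral>x. v0 x * ?D x \<partial>lborel) = (LINT x:U|lebesgue. g x * ?p x)" by simp
    \<comment> \<open>The offset 9 makes \<open>h n < 1/8\<close> from the start, so that all
      translates used stay in the ball.\<close>
    define h where "h n = 1 / real (n + 9)" for n :: nat
    have h: "0 < h n" "h n < 1 / 8" for n by (auto simp: h_def field_simps)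
    have hlim: "h \<longlonglongrightarrow> 0"
      unfolding h_def[abs_def] by (rule LIMSEQ_ignore_initial_segment[OF lim_1_over_n])
    have conv: "(\<lambda>n. \<integral>x. v0 x * ((?p (x + h n *\<^sub>R ?b) + ?p (x - h n *\<^sub>R ?b) - 2 * ?p x) / (h n)\<^sup>2) \<partial>lborel)
       \<longlonglongrightarrow> (\<integral>x. v0 x * ?D x \<partial>lborel)"
      by (rule second_difference_integral_tendsto[OF v0_integrable p M h(1) hlim])
    have "\<forall>\<^sub>F n in sequentially. h n < r"
      using hlim r by (rule order_tendstoD(2))
    then have "\<forall>\<^sub>F n in sequentially. c0 \<le> (\<integral>x. v0 x * ((?p (x + h n *\<^sub>R ?b) + ?p (x - h n *\<^sub>R ?b) - 2 * ?p x) / (h n)\<^sup>2) \<partial>lborel)"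
    proof eventually_elim
      case (elim n)
      let ?h = "h n" and ?s = "h n / 2"
      let ?T = "exit_set j z w ?s"
      let ?E = "\<lambda>x. (v0 (x + ?h *\<^sub>R ?b) + v0 (x - ?h *\<^sub>R ?b) - 2 * v0 x) * ?p x"
      have hn: "0 < ?h" "?h < 1 / 8" using h by auto
      have Tm: "?T \<in> sets lborel" using exit_set_measurable by simp
      have Tsub: "?T \<subseteq> cball z w" using w(1) by (auto simp: exit_set_def)
      have Tfin: "emeasure lborel ?T < \<infinity>"
        by (rule emeasure_bounded_finite) (rule bounded_subset[OF bounded_cball Tsub])
      have "(\<integral>x. v0 x * ((?p (x + ?h *\<^sub>R ?b) + ?p (x - ?h *\<^sub>R ?b) - 2 * ?p x) / ?h\<^sup>2) \<partial>lborel)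
        = (\<integral>x. v0 x * (?p (x + ?h *\<^sub>R ?b) + ?p (x - ?h *\<^sub>R ?b) - 2 * ?p x) \<partial>lborel) / ?h\<^sup>2"
        by simp
      also have "\<dots> = (\<integral>x. ?E x \<partial>lborel) / ?h\<^sup>2"
        by (simp only: second_difference_translate[OF v0_integrable pm pbd])
      finally have tr: "(\<integral>x. v0 x * ((?p (x + ?h *\<^sub>R ?b) + ?p (x - ?h *\<^sub>R ?b) - 2 * ?p x) / ?h\<^sup>2) \<partial>lborel)
        = (\<integral>x. ?E x \<partial>lborel) / ?h\<^sup>2" .
      have "(\<integral>x. indicator ?T x *\<^sub>R (d * (?s / 4) * kap) \<partial>lborel) \<le> (\<integral>x. ?E x \<partial>lborel)"
      proof (rule integral_mono)
        show "integrable lborel (\<lambda>x. indicator ?T x *\<^sub>R (d * (?s / 4) * kap))"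
          using Tm Tfin by (intro integrable_scaleR_left integrable_real_indicator)
        have "integrable lborel (\<lambda>x. v0 (x + ?h *\<^sub>R ?b) + v0 (x + - (?h *\<^sub>R ?b)) - 2 * v0 x)"
          by (intro Bochner_Integration.integrable_diff Bochner_Integration.integrable_add
              integrable_translation_lborel integrable_mult_right v0_integrable)
        from integrable_mult_bounded[OF this pm pbd] show "integrable lborel ?E" by simp
        fix x
        show "indicator ?T x *\<^sub>R (d * (?s / 4) * kap) \<le> ?E x"
        proof (cases "x \<in> cball z w")
          case True
          have xb: "x \<in> ball 0 1" "x + ?h *\<^sub>R ?b \<in> ball 0 1" "x - ?h *\<^sub>R ?b \<in> ball 0 1"
            using inball[OF True, of 0] inball[OF True, of ?h] inball[OF True, of "- ?h"] hn by simp_all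
          have E: "?E x = (v (x + ?h *\<^sub>R ?b) + v (x - ?h *\<^sub>R ?b) - 2 * v x) * ?p x"
            using xb by (simp add: v0_def)
          show ?thesis
          proof (cases "x \<in> ?T")
            case True
            have "d * (?s / 4) \<le> v (x + (2 * ?s) *\<^sub>R ?b) + v (x - (2 * ?s) *\<^sub>R ?b) - 2 * v x"
              by (rule v_second_difference_exit[OF j]) (use True hn w(2) xb in \<open>auto simp: z_def\<close>)
            moreover have "kap \<le> ?p x"
              unfolding kap_def by (rule bump_lower[OF _ _ True]) (use hn elim in auto)
            ultimately have "d * (?s / 4) * kap \<le> (v (x + ?h *\<^sub>R ?b) + v (x - ?h *\<^sub>R ?b) - 2 * v x) * ?p x"
              using d_pos hn kap v_second_difference_nonneg[OF xb] by (intro mult_mono) auto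
            then show ?thesis unfolding E using True by simp
          next
            case False
            have "0 \<le> (v (x + ?h *\<^sub>R ?b) + v (x - ?h *\<^sub>R ?b) - 2 * v x) * ?p x"
              by (intro mult_nonneg_nonneg v_second_difference_nonneg[OF xb] bump_nonneg)
            then show ?thesis unfolding E using False by simp
          qed
        next
          case False
          then have "x \<notin> ?T" using Tsub by blast
          then show ?thesis using pout[OF False] by simp
        qed
      qed
      moreover have "(\<integral>x. indicator ?T x *\<^sub>R (d * (?s / 4) * kap) \<partial>lborel) = measure lborel ?T * (d * (?s / 4) * kap)"
        using Tm Tfin by simp
      moreover have "Q * ?s \<le> measure lborel ?T"
        unfolding Q_def z_def by (rule exit_set_lower[OF j]) (use w hn in auto)
      then have "(Q * ?s) * (d * (?s / 4) * kap) \<le> measure lborel ?T * (d * (?s / 4) * kap)"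
        using d_pos kap hn by (intro mult_right_mono) auto
      moreover have "(Q * ?s) * (d * (?s / 4) * kap) = c0 * ?h\<^sup>2"
        by (simp add: c0_def power2_eq_square)
      ultimately have "c0 * ?h\<^sup>2 \<le> (\<integral>x. ?E x \<partial>lborel)" by linarith
      then have "c0 \<le> (\<integral>x. ?E x \<partial>lborel) / ?h\<^sup>2" using hn by (simp add: pos_le_divide_eq)
      then show ?case unfolding tr .
    qed
    then have "c0 \<le> (\<integral>x. v0 x * ?D x \<partial>lborel)"
      by (rule tendsto_lowerbound[OF conv]) simp
    then show ?thesis unfolding eq' .
  qed
  have gint: "integrable lebesgue (\<lambda>x. indicator U x *\<^sub>R g x)"
    using gU unfolding set_integrable_def .
  have "(\<lambda>n. LINT x:U|lebesgue. g x * bump z w (1 / (real n + 1)) x) \<longlonglongrightarrow> (\<integral>x. 0 \<partial>(lebesgue :: (real ^ 'n) measure))"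
    unfolding set_lebesgue_integral_def
  proof (rule integral_dominated_convergence[where w = "\<lambda>x. norm (indicator U x *\<^sub>R g x)"])
    show "integrable lebesgue (\<lambda>x. norm (indicator U x *\<^sub>R g x))" using gint by simp
    have eq: "indicator U x *\<^sub>R (g x * bump z w r x) = (indicator U x *\<^sub>R g x) * bump z w r x" for x r
      by simp
    have bm: "bump z w r \<in> borel_measurable lebesgue" for r
      using borel_measurable_continuous_onI[OF smooth_fun_continuous[OF bump_smooth]]
      by (intro measurable_completion) simp
    show "(\<lambda>x. indicator U x *\<^sub>R (g x * bump z w (1 / (real n + 1)) x)) \<in> borel_measurable lebesgue" for n
      unfolding eq using gint bm by simp
    show "AE x in lebesgue. norm (indicator U x *\<^sub>R (g x * bump z w (1 / (real n + 1)) x)) \<le> norm (indicator U x *\<^sub>R g x)" for n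
    proof (rule AE_I2)
      fix x
      show "norm (indicator U x *\<^sub>R (g x * bump z w (1 / (real n + 1)) x)) \<le> norm (indicator U x *\<^sub>R g x)"
        unfolding eq norm_mult using bump_le_1 bump_nonneg by (intro mult_left_le) auto
    qed
    have "{x. R x = 1 / 2} \<inter> ball 0 1 \<in> null_sets lebesgue"
      using negligible_interface by (simp add: negligible_iff_null_sets)
    then have "AE x in lebesgue. x \<notin> {x. R x = 1 / 2} \<inter> ball 0 1" by (rule AE_not_in)
    then show "AE x in lebesgue. (\<lambda>n. indicator U x *\<^sub>R (g x * bump z w (1 / (real n + 1)) x)) \<longlonglongrightarrow> 0"
    proof eventually_elim
      case (elim x)
      show ?case
      proof (cases "x \<in> U")
        case True
        then have "R x \<noteq> 1 / 2" using elim U(3) by blast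
        from tendsto_mult_right_zero[OF bump_tendsto_0[OF this], of "indicator U x *\<^sub>R g x"]
        show ?thesis unfolding eq .
      qed simp
    qed
  qed simp
  then have "(\<lambda>n. LINT x:U|lebesgue. g x * bump z w (1 / (real n + 1)) x) \<longlonglongrightarrow> 0" by simp
  then have "c0 \<le> 0"
    by (rule LIMSEQ_le_const) (use lower in auto)
  then show False using c0 by simp
qed

end

theorem proposition2p8:
  fixes k :: "'n::finite" and q :: real
  assumes "CARD('n) \<ge> 2" and "0 < q" and "q < real CARD('n)"
  shows "\<exists>v :: real ^ 'n \<Rightarrow> real.
    (\<forall>x\<in>ball 0 1. v x \<ge> 0) \<and>
    convex_on (ball 0 1) v \<and>
    aleksandrov_solution (ball 0 1) (\<lambda>x. v x powr q * indicator {y. v y > 0} x) v \<and>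
    coincidence_set (ball 0 1) v = {x. norm (drop_coord k x) \<le> 1/2} \<inter> ball 0 1 \<and>
    free_boundary_nsc (ball 0 1) v = {x. norm (drop_coord k x) = 1/2} \<inter> ball 0 1 \<and>
    locally_lipschitz_on (ball 0 1) v \<and>
    \<not> C1_on (ball 0 1) v \<and>
    (\<forall>U. open U \<and> coincidence_set (ball 0 1) v \<subseteq> U \<and> U \<subseteq> ball 0 1 \<longrightarrow>
         v \<notin> sobolev_W1 2 U)"
proof -
  let ?m = "CARD('n) - 2"
  obtain t1 B V Vs Vt Vss Vst Vtt where "ma_profile ?m q t1 1 B V Vs Vt Vss Vst Vtt"
    using ma_profile_exists[OF assms(2)] by blast
  moreover have "q < real ?m + 2" using assms(1,3) by (simp add: of_nat_diff)
  ultimately have "\<exists>d B V Vs Vt Vss Vst Vtt. ma_profile ?m q 1 d B V Vs Vt Vss Vst Vtt"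
    by (rule ma_profile_rescale)
  then obtain d B V Vs Vt Vss Vst Vtt where "ma_profile ?m q 1 d B V Vs Vt Vss Vst Vtt"
    by (elim exE)
  then interpret radial_profile k q d B V Vs Vt Vss Vst Vtt
    using assms(1,2) by unfold_locales
  show ?thesis
    using v_nonneg v_convex v_aleksandrov v_coincidence v_free_boundary_nsc v_locally_lipschitz
      v_not_C1 v_not_sobolev
    by (intro exI[of _ v] conjI ballI allI impI) blast+
qed

end
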